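(* The field of $\mathrm{P}$-numbers, and the field of $\mathcal{E}_n$-numbers for each $n\ge3$, do not have computable copies.
   Context: For a total $f:\omega\to\{0,1,2\}$ put $\overline f=\sum_{i=0}^\infty\frac{f(i)-1}{2^{i+1}}$. For a class $C$ of total computable functions let $\widetilde C=\{m+\overline f\mid m\in\mathbb{Z},\ f\in C \text{ unary},\ \mathrm{im}(f)\subseteq\{0,1,2\}\}$. The $\mathrm{P}$-numbers (polynomial time computable reals) are the elements of $\widetilde{C}$ where $C$ is the class of functions whose value is computable in time polynomial in the argument itself (not its length); i.e. the digit $f(i)$ is computed in time polynomial in $i$. For $n\ge3$, the $\mathcal{E}_n$-numbers are the elements of $\widetilde{\mathcal{E}_n}$, where $\mathcal{E}_n$ is the $n$-th Grzegorczyk class (standard indexing: $\mathcal{E}_3$ is the class of Kalmár elementary functions). These sets of reals are (real closed) subfields of $\mathbb{R}$. A computable copy of a field $F=(F,+,\cdot)$ is a surjection $\nu:\omega\to F$ with respect to which addition, multiplication and equality are computable. *)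

theory Defs
  imports Complex_Main "HOL-Computational_Algebra.Polynomial"
begin

text \<open>
  A function of arity k is represented by a function on lists of which only the values on lists
  of length k are meaningful.  Recursion is on the first argument.
\<close>

definition prim_rec :: "(nat list \<Rightarrow> nat) \<Rightarrow> (nat list \<Rightarrow> nat) \<Rightarrow> nat list \<Rightarrow> nat" where
  "prim_rec g h xs = rec_nat (g (tl xs)) (\<lambda>y r. h (y # r # tl xs)) (hd xs)"

text \<open>
  The total computable functions: the primitive recursive operations together with
  minimization of regular functions.
\<close>

inductive computable :: "nat \<Rightarrow> (nat list \<Rightarrow> nat) \<Rightarrow> bool" where
  zero: "computable k (\<lambda>_. 0)"
| succ: "computable 1 (\<lambda>xs. Suc (xs ! 0))"
| proj: "i < k \<Longrightarrow> computable k (\<lambda>xs. xs ! i)"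
| comp: "computable (length hs) g \<Longrightarrow> (\<forall>h \<in> set hs. computable k h) \<Longrightarrow>
    computable k (\<lambda>xs. g (map (\<lambda>h. h xs) hs))"
| prec: "computable k g \<Longrightarrow> computable (k + 2) h \<Longrightarrow> computable (k + 1) (prim_rec g h)"
| minim: "computable (k + 1) g \<Longrightarrow> (\<forall>xs. length xs = k \<longrightarrow> (\<exists>y. g (y # xs) = 0)) \<Longrightarrow>
    computable k (\<lambda>xs. LEAST y. g (y # xs) = 0)"

definition computable2 :: "(nat \<Rightarrow> nat \<Rightarrow> nat) \<Rightarrow> bool" where
  "computable2 f \<longleftrightarrow> (\<exists>F. computable 2 F \<and> (\<forall>x y. f x y = F [x, y]))"

text \<open>
  The generating functions \<open>E\<^sub>0(x, y) = x + y\<close>, \<open>E\<^sub>1(x) = x\<^sup>2 + 2\<close>,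
  \<open>E\<^sub>m\<^sub>+\<^sub>2(0) = 2\<close>, \<open>E\<^sub>m\<^sub>+\<^sub>2(x + 1) = E\<^sub>m\<^sub>+\<^sub>1(E\<^sub>m\<^sub>+\<^sub>2(x))\<close> are those used by Rose
  (Subrecursion, 1984).  The class with index n is generated from the \<open>E\<^sub>m\<close> with \<open>m < n\<close>, so
  that the class with index 3 consists of the Kalmar elementary functions.  Below,
  \<open>grz_gen m\<close> is \<open>E\<^sub>m\<^sub>+\<^sub>1\<close>.
\<close>

primrec grz_gen :: "nat \<Rightarrow> nat \<Rightarrow> nat" where
  "grz_gen 0 = (\<lambda>x. x\<^sup>2 + 2)"
| "grz_gen (Suc m) = (\<lambda>x. (grz_gen m ^^ x) 2)"

inductive grzegorczyk :: "nat \<Rightarrow> nat \<Rightarrow> (nat list \<Rightarrow> nat) \<Rightarrow> bool" for n where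
  zero: "grzegorczyk n k (\<lambda>_. 0)"
| succ: "grzegorczyk n 1 (\<lambda>xs. Suc (xs ! 0))"
| proj: "i < k \<Longrightarrow> grzegorczyk n k (\<lambda>xs. xs ! i)"
| add: "0 < n \<Longrightarrow> grzegorczyk n 2 (\<lambda>xs. xs ! 0 + xs ! 1)"
| gen: "m + 1 < n \<Longrightarrow> grzegorczyk n 1 (\<lambda>xs. grz_gen m (xs ! 0))"
| comp: "grzegorczyk n (length hs) g \<Longrightarrow> (\<forall>h \<in> set hs. grzegorczyk n k h) \<Longrightarrow>
    grzegorczyk n k (\<lambda>xs. g (map (\<lambda>h. h xs) hs))"
| bounded_rec: "grzegorczyk n k g \<Longrightarrow> grzegorczyk n (k + 2) h \<Longrightarrow> grzegorczyk n (k + 1) b \<Longrightarrow>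
    (\<forall>xs. length xs = k + 1 \<longrightarrow> prim_rec g h xs \<le> b xs) \<Longrightarrow>
    grzegorczyk n (k + 1) (prim_rec g h)"

definition grzegorczyk_unary :: "nat \<Rightarrow> (nat \<Rightarrow> nat) set" where
  "grzegorczyk_unary n = {f. \<exists>F. grzegorczyk n 1 F \<and> (\<forall>x. f x = F [x])}"

text \<open>
  Deterministic Turing machines with finitely many two-way infinite tapes.  States and tape
  symbols are initial segments of the natural numbers, and 0 is the blank.
\<close>

datatype move = MoveLeft | Stay | MoveRight

record tm =
  tapes :: nat
  states :: nat
  symbols :: nat
  start_state :: nat
  halt_state :: nat
  delta :: "nat \<Rightarrow> nat list \<Rightarrow> nat \<times> (nat \<times> move) list"

definition wf_tm :: "tm \<Rightarrow> bool" where
  "wf_tm M \<longleftrightarrow> 0 < tapes M \<and> 3 \<le> symbols M \<and> start_state M < states M \<and> halt_state M < states M \<and>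
    (\<forall>q as. q < states M \<and> length as = tapes M \<and> set as \<subseteq> {..<symbols M} \<longrightarrow>
      (case delta M q as of (q', acts) \<Rightarrow>
        q' < states M \<and> length acts = tapes M \<and> fst ` set acts \<subseteq> {..<symbols M}))"

text \<open>A tape is given by the position of its head and its contents.\<close>

type_synonym tape = "int \<times> (int \<Rightarrow> nat)"
type_synonym config = "nat \<times> tape list"

fun read_tape :: "tape \<Rightarrow> nat" where
  "read_tape (p, c) = c p"

fun act_tape :: "nat \<times> move \<Rightarrow> tape \<Rightarrow> tape" where
  "act_tape (a, d) (p, c) =
    ((case d of MoveLeft \<Rightarrow> p - 1 | Stay \<Rightarrow> p | MoveRight \<Rightarrow> p + 1), c(p := a))"

definition step :: "tm \<Rightarrow> config \<Rightarrow> config" where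
  "step M = (\<lambda>(q, ts). if q = halt_state M then (q, ts) else
     (case delta M q (map read_tape ts) of (q', acts) \<Rightarrow> (q', map2 act_tape acts ts)))"

text \<open>
  Binary numerals, most significant digit first.  On a tape the digits 0 and 1 are written as
  the symbols 1 and 2.
\<close>

fun binary :: "nat \<Rightarrow> nat list" where
  "binary n = (if n < 2 then [n] else binary (n div 2) @ [n mod 2])"

declare binary.simps [simp del]

definition word :: "nat \<Rightarrow> nat list" where
  "word n = map Suc (binary n)"

definition input_tape :: "nat list \<Rightarrow> tape" where
  "input_tape w = (0, \<lambda>z. if 0 \<le> z \<and> z < int (length w) then w ! nat z else 0)"

text \<open>The result is read on the first tape, from the head rightwards up to the first blank.\<close>

definition tape_result :: "tape \<Rightarrow> nat list \<Rightarrow> bool" where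
  "tape_result t w \<longleftrightarrow> (case t of (p, c) \<Rightarrow>
     (\<forall>j < length w. c (p + int j) = w ! j) \<and> c (p + int (length w)) = 0)"

definition initial_config :: "tm \<Rightarrow> nat \<Rightarrow> config" where
  "initial_config M n =
    (start_state M, input_tape (word n) # replicate (tapes M - 1) (input_tape []))"

definition computes_in_time :: "tm \<Rightarrow> (nat \<Rightarrow> nat) \<Rightarrow> (nat \<Rightarrow> nat) \<Rightarrow> bool" where
  "computes_in_time M f T \<longleftrightarrow> (\<forall>n. \<exists>t \<le> T n. \<exists>ts.
     (step M ^^ t) (initial_config M n) = (halt_state M, ts) \<and> tape_result (hd ts) (word (f n)))"

text \<open>The time bound is a polynomial in the argument itself, not in the length of its numeral.\<close>

definition poly_time_in_argument :: "(nat \<Rightarrow> nat) set" where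
  "poly_time_in_argument =
    {f. \<exists>M (p :: nat poly). wf_tm M \<and> computes_in_time M f (poly p)}"

definition real_of_digits :: "(nat \<Rightarrow> nat) \<Rightarrow> real" where
  "real_of_digits f = (\<Sum>i. (real (f i) - 1) / 2 ^ (i + 1))"

text \<open>Only the unary members of a class of functions matter here.\<close>

definition digit_reals :: "(nat \<Rightarrow> nat) set \<Rightarrow> real set" where
  "digit_reals C = {of_int m + real_of_digits f | m f. f \<in> C \<and> range f \<subseteq> {0, 1, 2}}"

definition P_numbers :: "real set" where
  "P_numbers = digit_reals poly_time_in_argument"

definition E_numbers :: "nat \<Rightarrow> real set" where
  "E_numbers n = digit_reals (grzegorczyk_unary n)"

text \<open>
  Here \<open>F\<close> is a subfield of the ambient field, with the operations inherited from it.
  Closure of \<open>F\<close> under addition and multiplication is implied by the conditions on \<open>\<nu>\<close>.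
\<close>

definition computable_copy :: "'a::field set \<Rightarrow> (nat \<Rightarrow> 'a) \<Rightarrow> bool" where
  "computable_copy F \<nu> \<longleftrightarrow> range \<nu> = F \<and>
    (\<exists>g. computable2 g \<and> (\<forall>a b. \<nu> (g a b) = \<nu> a + \<nu> b)) \<and>
    (\<exists>g. computable2 g \<and> (\<forall>a b. \<nu> (g a b) = \<nu> a * \<nu> b)) \<and>
    computable2 (\<lambda>a b. of_bool (\<nu> a = \<nu> b))"

end

theory Submission
  imports Defs
begin

text \<open>
  A computable copy of a field of reals in which every positive element becomes a square
  after multiplication by a nonzero square has a decidable order. So there is a uniform
  procedure that compares the k-th element of the field with a given rational number. It
  need not be fast, and it cannot be used to compute digits within a fixed time bound. But a
  diagonal number can wait for it: with the signed digits -1, 0, 1, written 0, 1, 2, it can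
  emit the digit of weight zero as long as it likes without moving. Once the comparison of
  the k-th element with the current partial sum has ended, a single nonzero digit makes the
  number different from that element. The resulting digit sequence is of very low
  complexity: it lies in the second Grzegorczyk class (\<open>no_computable_copy\<close>).
  The waiting rests on a clocked form of the normal form theorem,
  \<open>slow_exists\<close>, in which the clock bounds all values.

  It remains to see that each class C of digit sequences in question contains the unary
  functions of the second Grzegorczyk class with values 0, 1, 2, and that it is closed under
  root extraction. For the latter, the schoolbook method is run with signed digits: from an
  integer Z and an approximate root Y with |Z - Y^2| \<open>\<le>\<close> Y the next digit e
  of the root is determined by comparing integers, and \<open>root_step_near\<close> keeps
  the invariant. For the Grzegorczyk classes from index three on, all numbers that occur
  have exponential size and are computed by bounded recursion
  (\<open>grz_root_digit\<close>).

  For polynomial time, Turing machines have to be constructed. Structured programs on tapes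
  are translated into machines without loss of time (\<open>exec_trans\<close>). Programs
  whose tapes are stacks are treated as functions on stacks, with closure under composition,
  branching and loops (\<open>polytime_seq\<close>, \<open>polytime_if\<close>,
  \<open>polytime_while\<close>). The second Grzegorczyk class consists of polynomially
  bounded functions and is compiled to programs on unary numbers
  (\<open>computes_grz2\<close>). A given machine is made callable any number of times by
  marking the cells that it visits and erasing them afterwards
  (\<open>computes_of_poly_time\<close>). The root extraction is arranged such that each
  step evaluates linear forms of two binary numbers, which is done by passes with a bounded
  carry (\<open>encodes_step\<close>, \<open>poly_time_root_digit\<close>).
\<close>

section \<open>Functions on tuples\<close>

text \<open>
  The Grzegorczyk classes, the computable functions and the functions that stack programs
  compute below share these closure properties, so the bookkeeping of arguments is done once
  for all three.
\<close>

locale clone =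
  fixes C :: "nat \<Rightarrow> (nat list \<Rightarrow> nat) \<Rightarrow> bool"
  assumes zero: "C k (\<lambda>_. 0)"
    and succ: "C 1 (\<lambda>xs. Suc (xs ! 0))"
    and proj: "i < k \<Longrightarrow> C k (\<lambda>xs. xs ! i)"
    and comp: "C (length hs) g \<Longrightarrow> (\<forall>h \<in> set hs. C k h) \<Longrightarrow> C k (\<lambda>xs. g (map (\<lambda>h. h xs) hs))"
begin

text \<open>
  Only the values on lists of length k are meaningful, so membership is taken up to these
  values; closure lemmas can then be stated for readable terms.
\<close>

definition fn :: "nat \<Rightarrow> (nat list \<Rightarrow> nat) \<Rightarrow> bool" where
  "fn k F \<longleftrightarrow> (\<exists>F'. C k F' \<and> (\<forall>xs. length xs = k \<longrightarrow> F' xs = F xs))"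

lemma fnI: "C k F \<Longrightarrow> fn k F"
  by (auto simp: fn_def)

lemma fn_cong: "fn k F \<Longrightarrow> (\<And>xs. length xs = k \<Longrightarrow> F xs = G xs) \<Longrightarrow> fn k G"
  by (fastforce simp: fn_def)

lemma fn_proj: "i < k \<Longrightarrow> fn k (\<lambda>xs. xs ! i)"
  by (rule fnI, rule proj)

lemma fn_comp:
  assumes "fn (length hs) g" and "\<And>h. h \<in> set hs \<Longrightarrow> fn k h"
  shows "fn k (\<lambda>xs. g (map (\<lambda>h. h xs) hs))"
proof -
  obtain g' where g': "C (length hs) g'" "\<And>xs. length xs = length hs \<Longrightarrow> g' xs = g xs"
    using assms(1) by (auto simp: fn_def)
  obtain r where r: "\<And>h. h \<in> set hs \<Longrightarrow> C k (r h)"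
      "\<And>h xs. h \<in> set hs \<Longrightarrow> length xs = k \<Longrightarrow> r h xs = h xs"
    using assms(2) unfolding fn_def by metis
  have "C k (\<lambda>xs. g' (map (\<lambda>h. h xs) (map r hs)))"
    by (rule comp) (use g' r in auto)
  moreover have "g' (map (\<lambda>h. h xs) (map r hs)) = g (map (\<lambda>h. h xs) hs)" if "length xs = k" for xs
  proof -
    have "map (\<lambda>h. h xs) (map r hs) = map (\<lambda>h. h xs) hs"
      using r that by (auto simp: map_eq_conv)
    then show ?thesis by (simp only: g' length_map)
  qed
  ultimately show ?thesis
    unfolding fn_def by blast
qed

lemma fn_app1: "fn 1 (\<lambda>ys. p (ys ! 0)) \<Longrightarrow> fn k a \<Longrightarrow> fn k (\<lambda>xs. p (a xs))"
  using fn_comp[of "[a]" "\<lambda>ys. p (ys ! 0)" k] by simp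

lemma fn_app2: "fn 2 (\<lambda>ys. p (ys ! 0) (ys ! 1)) \<Longrightarrow> fn k a \<Longrightarrow> fn k b \<Longrightarrow> fn k (\<lambda>xs. p (a xs) (b xs))"
  by (rule fn_cong[OF fn_comp[of "[a, b]" "\<lambda>ys. p (ys ! 0) (ys ! 1)"]]) (auto simp: numeral_2_eq_2)

lemma fn_app3: "fn 3 (\<lambda>ys. p (ys ! 0) (ys ! 1) (ys ! 2)) \<Longrightarrow> fn k a \<Longrightarrow> fn k b \<Longrightarrow> fn k c \<Longrightarrow>
    fn k (\<lambda>xs. p (a xs) (b xs) (c xs))"
  by (rule fn_cong[OF fn_comp[of "[a, b, c]" "\<lambda>ys. p (ys ! 0) (ys ! 1) (ys ! 2)"]])
    (auto simp: numeral_3_eq_3 numeral_2_eq_2)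

lemma fn_Suc: "fn k a \<Longrightarrow> fn k (\<lambda>xs. Suc (a xs))"
  by (rule fn_app1[where p = Suc], rule fnI, rule succ)

lemma fn_const: "fn k (\<lambda>_. c)"
  by (induction c) (auto intro: fn_Suc fnI zero)

lemma fn_hd: "fn (Suc k) hd"
  by (rule fn_cong[OF fn_proj[of 0]]) (auto simp: length_Suc_conv)

text \<open>
  Recursion hands over the parameters as the tail of the argument list, so most calls compute
  a few leading arguments and pass on such a tail unchanged.
\<close>

lemma fn_append_drop:
  assumes "fn (length hs + m) g" "\<And>h. h \<in> set hs \<Longrightarrow> fn k h" "m + d = k"
  shows "fn k (\<lambda>xs. g (map (\<lambda>h. h xs) hs @ drop d xs))"
proof -
  have "fn k (\<lambda>xs. g (map (\<lambda>h. h xs) (hs @ map (\<lambda>i xs. xs ! (i + d)) [0..<m])))"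
    by (rule fn_comp) (use assms fn_proj in auto)
  then show ?thesis
  proof (rule fn_cong)
    fix xs :: "nat list" assume "length xs = k"
    then have "map (\<lambda>i. xs ! (i + d)) [0..<m] = drop d xs"
      using assms(3) by (intro nth_equalityI) (auto simp: add.commute)
    then show "g (map (\<lambda>h. h xs) (hs @ map (\<lambda>i xs. xs ! (i + d)) [0..<m])) = g (map (\<lambda>h. h xs) hs @ drop d xs)"
      by (simp add: comp_def)
  qed
qed

lemma fn_Cons:
  assumes "fn (Suc k) g" "fn k a"
  shows "fn k (\<lambda>xs. g (a xs # xs))"
proof -
  have "fn k (\<lambda>xs. g (map (\<lambda>h. h xs) (a # map (\<lambda>i xs. xs ! i) [0..<k])))"
    by (rule fn_comp) (use assms fn_proj in auto)
  then show ?thesis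
    by (rule fn_cong) (auto simp: comp_def intro!: arg_cong[of _ _ g] nth_equalityI)
qed

lemma fn_tl:
  assumes "fn k g" shows "fn (Suc k) (\<lambda>xs. g (tl xs))"
proof -
  have "fn (Suc k) (\<lambda>xs. g (map (\<lambda>h. h xs) (map (\<lambda>i xs. xs ! Suc i) [0..<k])))"
    by (rule fn_comp) (use assms fn_proj in auto)
  then show ?thesis
    by (rule fn_cong) (auto simp: comp_def nth_tl intro!: arg_cong[of _ _ g] nth_equalityI)
qed

end

global_interpretation grz: clone "grzegorczyk n" for n
  defines grz = grz.fn
  by unfold_locales (rule grzegorczyk.intros; assumption)+

global_interpretation cmp: clone computable
  defines cmp = cmp.fn
  by unfold_locales (rule computable.intros; assumption)+

text \<open>
  Bounded recursion with the number of steps given by an expression in the parameters; the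
  parameters stay visible to the step function behind the counter and the previous value.
\<close>

lemma grz_rec:
  assumes "grz n k g" "grz n (k + 2) h" "grz n (k + 1) b" "grz n k t"
    and bound: "\<And>m xs. length xs = k \<Longrightarrow> rec_nat (g xs) (\<lambda>y r. h (y # r # xs)) m \<le> b (m # xs)"
  shows "grz n k (\<lambda>xs. rec_nat (g xs) (\<lambda>y r. h (y # r # xs)) (t xs))"
proof -
  obtain g' where g': "grzegorczyk n k g'" "\<And>xs. length xs = k \<Longrightarrow> g' xs = g xs"
    using assms(1) by (auto simp: grz.fn_def)
  obtain h' where h': "grzegorczyk n (k + 2) h'" "\<And>xs. length xs = k + 2 \<Longrightarrow> h' xs = h xs"
    using assms(2) by (auto simp: grz.fn_def)
  obtain b' where b': "grzegorczyk n (k + 1) b'" "\<And>xs. length xs = k + 1 \<Longrightarrow> b' xs = b xs"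
    using assms(3) by (auto simp: grz.fn_def)
  have eq: "prim_rec g' h' xs = rec_nat (g (tl xs)) (\<lambda>y r. h (y # r # tl xs)) (hd xs)"
    if "length xs = k + 1" for xs
    using that by (simp add: prim_rec_def g' h')
  have "grzegorczyk n (k + 1) (prim_rec g' h')"
  proof (rule grzegorczyk.bounded_rec[OF g'(1) h'(1) b'(1)], intro allI impI)
    fix xs :: "nat list" assume len: "length xs = k + 1"
    then have "rec_nat (g (tl xs)) (\<lambda>y r. h (y # r # tl xs)) (hd xs) \<le> b (hd xs # tl xs)"
      by (intro bound) auto
    moreover have "hd xs # tl xs = xs" using len by (cases xs) auto
    ultimately show "prim_rec g' h' xs \<le> b' xs"
      by (simp add: eq[OF len] b'(2)[OF len])
  qed
  then have "grz n (Suc k) (prim_rec g' h')"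
    by (simp add: grz.fnI)
  then have "grz n k (\<lambda>xs. prim_rec g' h' (t xs # xs))"
    using assms(4) by (rule grz.fn_Cons)
  then show ?thesis
    by (rule grz.fn_cong) (simp add: eq)
qed

lemma cmp_rec:
  assumes "cmp k g" "cmp (k + 2) h" "cmp k t"
  shows "cmp k (\<lambda>xs. rec_nat (g xs) (\<lambda>y r. h (y # r # xs)) (t xs))"
proof -
  obtain g' where g': "computable k g'" "\<And>xs. length xs = k \<Longrightarrow> g' xs = g xs"
    using assms(1) by (auto simp: cmp.fn_def)
  obtain h' where h': "computable (k + 2) h'" "\<And>xs. length xs = k + 2 \<Longrightarrow> h' xs = h xs"
    using assms(2) by (auto simp: cmp.fn_def)
  have "cmp (Suc k) (prim_rec g' h')"
    using computable.prec[OF g'(1) h'(1)] by (simp add: cmp.fnI)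
  then have "cmp k (\<lambda>xs. prim_rec g' h' (t xs # xs))"
    using assms(3) by (rule cmp.fn_Cons)
  then show ?thesis
    by (rule cmp.fn_cong) (simp add: prim_rec_def g' h')
qed

lemma cmp_minim:
  assumes "cmp (k + 1) g" and "\<And>xs. length xs = k \<Longrightarrow> \<exists>y. g (y # xs) = 0"
  shows "cmp k (\<lambda>xs. LEAST y. g (y # xs) = 0)"
proof -
  obtain g' where g': "computable (k + 1) g'" "\<And>xs. length xs = k + 1 \<Longrightarrow> g' xs = g xs"
    using assms(1) by (auto simp: cmp.fn_def)
  have "computable k (\<lambda>xs. LEAST y. g' (y # xs) = 0)"
    by (rule computable.minim[OF g'(1)]) (use assms(2) g' in auto)
  then show ?thesis
    by (rule cmp.fn_cong[OF cmp.fnI]) (simp add: g')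
qed

section \<open>Arithmetic in the second Grzegorczyk class\<close>

lemma grz_add: "0 < n \<Longrightarrow> grz n k a \<Longrightarrow> grz n k b \<Longrightarrow> grz n k (\<lambda>xs. a xs + b xs)"
  by (rule grz.fn_app2[where p = "(+)"], rule grz.fnI, rule grzegorczyk.add)

lemma grz_pred: "grz n k a \<Longrightarrow> grz n k (\<lambda>xs. a xs - 1)"
proof -
  have "grz n 1 (\<lambda>xs. rec_nat 0 (\<lambda>y r. (y # r # xs) ! 0) (xs ! 0))"
  proof (rule grz_rec[where b = "\<lambda>ys. ys ! 0"])
    show "rec_nat 0 (\<lambda>y r. (y # r # xs) ! 0) m \<le> (m # xs) ! 0" for m xs
      by (cases m) auto
  qed (auto intro: grz.fn_proj grz.fn_const)
  then have "grz n 1 (\<lambda>xs. xs ! 0 - 1)"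
    by (rule grz.fn_cong) (case_tac "xs ! 0"; simp)
  then show "grz n k a \<Longrightarrow> grz n k (\<lambda>xs. a xs - 1)"
    by (rule grz.fn_app1)
qed

lemma rec_nat_diff: "rec_nat x (\<lambda>_ r. r - 1) y = x - (y::nat)"
  by (induction y) auto

lemma grz_diff: "grz n k a \<Longrightarrow> grz n k b \<Longrightarrow> grz n k (\<lambda>xs. a xs - b xs)"
proof -
  have "grz n 2 (\<lambda>xs. rec_nat (xs ! 0) (\<lambda>y r. (y # r # xs) ! 1 - 1) (xs ! 1))"
  proof (rule grz_rec[where b = "\<lambda>ys. ys ! 1"])
    show "rec_nat (xs ! 0) (\<lambda>y r. (y # r # xs) ! 1 - 1) m \<le> (m # xs) ! 1" for m xs
      using rec_nat_diff[of "xs ! 0"] by simp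
  qed (auto intro!: grz.fn_proj grz_pred[simplified])
  then have "grz n 2 (\<lambda>xs. xs ! 0 - xs ! 1)"
    using rec_nat_diff by simp
  then show "grz n k a \<Longrightarrow> grz n k b \<Longrightarrow> grz n k (\<lambda>xs. a xs - b xs)"
    by (rule grz.fn_app2)
qed

lemma rec_nat_if: "rec_nat x (\<lambda>_ _. y) m = (if m = 0 then x else y)"
  by (cases m) auto

text \<open>
  A recursion that ignores its previous value distinguishes zero from successors, and the sum
  of the two branches bounds it.
\<close>

lemma grz_if0:
  assumes "0 < n" "grz n k c" "grz n k a" "grz n k b"
  shows "grz n k (\<lambda>xs. if c xs = 0 then a xs else b xs)"
proof -
  have "grz n 3 (\<lambda>xs. rec_nat (xs ! 1) (\<lambda>y r. (y # r # xs) ! 4) (xs ! 0))"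
  proof (rule grz_rec[where b = "\<lambda>ys. ys ! 2 + ys ! 3"])
    show "rec_nat (xs ! 1) (\<lambda>y r. (y # r # xs) ! 4) m \<le> (m # xs) ! 2 + (m # xs) ! 3" for m xs
      by (cases m) (auto simp: numeral_3_eq_3 numeral_2_eq_2 eval_nat_numeral)
  qed (auto intro!: grz.fn_proj grz_add \<open>0 < n\<close>)
  then have "grz n 3 (\<lambda>xs. if xs ! 0 = 0 then xs ! 1 else xs ! 2)"
    by (rule grz.fn_cong) (simp add: rec_nat_if eval_nat_numeral)
  then show ?thesis
    by (rule grz.fn_app3[where p = "\<lambda>c a b. if c = 0 then a else b"]) (use assms in auto)
qed

lemma grz_if_le:
  assumes "0 < n" "grz n k c" "grz n k d" "grz n k a" "grz n k b"
  shows "grz n k (\<lambda>xs. if c xs \<le> d xs then a xs else b xs)"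
  using grz_if0[OF assms(1) grz_diff[OF assms(2,3)] assms(4,5)] by simp

lemma grz_if_less:
  assumes "0 < n" "grz n k c" "grz n k d" "grz n k a" "grz n k b"
  shows "grz n k (\<lambda>xs. if c xs < d xs then a xs else b xs)"
  using grz_if_le[OF assms(1) grz.fn_Suc[OF assms(2)] assms(3-5)] by (simp add: Suc_le_eq)

lemma grz_if_eq:
  assumes "0 < n" "grz n k c" "grz n k d" "grz n k a" "grz n k b"
  shows "grz n k (\<lambda>xs. if c xs = d xs then a xs else b xs)"
  using grz_if_le[OF assms(1-3) grz_if_le[OF assms(1,3,2,4,5)] assms(5)]
  by (rule grz.fn_cong) auto

lemma grz_square2: "2 \<le> n \<Longrightarrow> grz n k a \<Longrightarrow> grz n k (\<lambda>xs. (a xs)\<^sup>2 + 2)"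
  using grz.fn_app1[where p = "grz_gen 0", OF grz.fnI[OF grzegorczyk.gen[of 0]]] by simp

lemma rec_nat_mult: "rec_nat 0 (\<lambda>_ r. r + x) y = y * (x::nat)"
  by (induction y) auto

text \<open>
  The bound comes from the generator that squares: a product is at most the square of the sum
  of its factors.
\<close>

lemma grz_mult:
  assumes n: "2 \<le> n" and "grz n k a" "grz n k b"
  shows "grz n k (\<lambda>xs. a xs * b xs)"
proof -
  have "grz n 2 (\<lambda>xs. rec_nat 0 (\<lambda>y r. (y # r # xs) ! 1 + (y # r # xs) ! 3) (xs ! 0))"
  proof (rule grz_rec[where b = "\<lambda>ys. (ys ! 0 + ys ! 2)\<^sup>2 + 2"])
    show "rec_nat 0 (\<lambda>y r. (y # r # xs) ! 1 + (y # r # xs) ! 3) m \<le> ((m # xs) ! 0 + (m # xs) ! 2)\<^sup>2 + 2" for m xs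
      by (simp add: rec_nat_mult eval_nat_numeral algebra_simps)
  qed (use n in \<open>auto intro!: grz.fn_proj grz_add grz.fn_const grz_square2[simplified]\<close>)
  then have "grz n 2 (\<lambda>xs. xs ! 0 * xs ! 1)"
    by (simp add: rec_nat_mult eval_nat_numeral)
  then show ?thesis
    by (rule grz.fn_app2) (use assms in auto)
qed

lemma rec_nat_mod2: "rec_nat 0 (\<lambda>_ r. 1 - r) m = m mod (2::nat)"
  by (induction m) (auto simp: mod_Suc)

lemma grz_mod2:
  assumes "grz n k a" shows "grz n k (\<lambda>xs. a xs mod 2)"
proof -
  have "grz n 1 (\<lambda>xs. rec_nat 0 (\<lambda>y r. 1 - (y # r # xs) ! 1) (xs ! 0))"
  proof (rule grz_rec[where b = "\<lambda>_. 1"])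
    show "rec_nat 0 (\<lambda>y r. 1 - (y # r # xs) ! 1) m \<le> 1" for m and xs :: "nat list"
      using rec_nat_mod2[of m] by simp
  qed (auto intro!: grz.fn_proj grz.fn_const grz_diff)
  then have "grz n 1 (\<lambda>xs. xs ! 0 mod 2)"
    using rec_nat_mod2 by simp
  then show ?thesis
    by (rule grz.fn_app1) (use assms in auto)
qed

lemma grz_prod_list:
  assumes "2 \<le> n" "\<And>t. t \<in> set ts \<Longrightarrow> grz n k t"
  shows "grz n k (\<lambda>xs. prod_list (map (\<lambda>t. t xs) ts))"
  using assms(2) by (induction ts) (auto intro!: grz.fn_const grz_mult assms(1))

lemma grz_mono:
  assumes "grzegorczyk n k F" "n \<le> m"
  shows "grzegorczyk m k F"
  using assms
proof induction
  case (bounded_rec k g h b)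
  then show ?case by (intro grzegorczyk.bounded_rec) auto
qed (simp_all add: grzegorczyk.intros del: One_nat_def)

text \<open>
  Each generator with index below two is a polynomial, hence primitive recursive; dropping
  the bounds from the recursions gives the rest.
\<close>

lemma cmp_of_grz2:
  assumes "grz 2 k F" shows "cmp k F"
proof -
  have add: "cmp 2 (\<lambda>xs. xs ! 0 + xs ! 1)"
  proof -
    have "cmp 2 (\<lambda>xs. rec_nat (xs ! 0) (\<lambda>y r. Suc ((y # r # xs) ! 1)) (xs ! 1))"
      by (rule cmp_rec) (auto intro!: cmp.fn_proj cmp.fn_Suc)
    moreover have "rec_nat x (\<lambda>_ r. Suc r) y = x + y" for x y by (induction y) auto
    ultimately show ?thesis by simp
  qed
  have mult: "cmp 2 (\<lambda>xs. xs ! 0 * xs ! 1)"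
  proof -
    have "cmp 2 (\<lambda>xs. rec_nat 0 (\<lambda>y r. (y # r # xs) ! 1 + (y # r # xs) ! 3) (xs ! 0))"
      by (rule cmp_rec) (auto intro!: cmp.fn_proj cmp.fn_const cmp.fn_app2[OF add])
    then show ?thesis by (simp add: rec_nat_mult eval_nat_numeral)
  qed
  have *: "\<exists>F'. computable k F' \<and> (\<forall>xs. length xs = k \<longrightarrow> F' xs = F xs)" if "grzegorczyk 2 k F" for k F
  proof -
    have "cmp k F"
      using that
    proof induction
      case (gen m)
      then have "grz_gen m = (\<lambda>x. x * x + 2)" by (cases m) (auto simp: power2_eq_square)
      then show ?case
        by (simp del: add_2_eq_Suc')
          (intro cmp.fn_proj cmp.fn_const cmp.fn_app2[OF add] cmp.fn_app2[OF mult]; simp)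
    next
      case (comp hs g k)
      then show ?case by (auto intro: cmp.fn_comp)
    next
      case (bounded_rec k g h b)
      have "cmp (k + 1) (\<lambda>xs. rec_nat (g (tl xs)) (\<lambda>y r. (\<lambda>us. h (map (\<lambda>h. h us)
          [\<lambda>us. us ! 0, \<lambda>us. us ! 1] @ drop 3 us)) (y # r # xs)) (hd xs))"
        by (rule cmp_rec, use bounded_rec.IH in \<open>auto intro!: cmp.fn_tl cmp.fn_hd\<close>)
          (rule cmp.fn_append_drop[where m = k and hs = "[\<lambda>us. us ! 0, \<lambda>us. us ! 1]", simplified];
            auto intro!: cmp.fn_proj[of 0, simplified] cmp.fn_proj[of "Suc 0"])
      then show ?case
        by (rule cmp.fn_cong) (auto simp: prim_rec_def drop_Suc eval_nat_numeral)
    qed (auto intro: cmp.fnI computable.intros add[simplified] cmp.fn_const cmp.fn_proj cmp.fn_Suc)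
    then show ?thesis by (simp add: cmp.fn_def)
  qed
  then show ?thesis
    using assms unfolding grz.fn_def cmp.fn_def by metis
qed

section \<open>Slow simulation of computable functions\<close>

text \<open>
  A clocked version of Kleene's normal form. With clock s the function T either answers 0,
  for no result yet, or the successor of the result. Answers are kept once given. An answer
  never exceeds the clock: this makes the clock itself a bound for every recursion over
  values of T, which is what keeps T inside the second Grzegorczyk class although F may grow
  arbitrarily fast.
\<close>

definition slow :: "nat \<Rightarrow> (nat list \<Rightarrow> nat) \<Rightarrow> (nat list \<Rightarrow> nat) \<Rightarrow> bool" where
  "slow k F T \<longleftrightarrow> grz 2 (Suc k) T \<and> (\<forall>xs. length xs = k \<longrightarrow>
     (\<forall>s. T (s # xs) \<noteq> 0 \<longrightarrow> T (s # xs) = Suc (F xs) \<and> Suc (F xs) \<le> s) \<and>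
     (\<forall>s s'. T (s # xs) \<noteq> 0 \<longrightarrow> s \<le> s' \<longrightarrow> T (s' # xs) \<noteq> 0) \<and> (\<exists>s. T (s # xs) \<noteq> 0))"

text \<open>
  Answers above the clock are suppressed. Monotonicity survives, because an answer is fixed
  while the clock grows.
\<close>

lemma slowI:
  assumes T: "grz 2 (Suc k) T"
    and val: "\<And>xs s. length xs = k \<Longrightarrow> T (s # xs) \<noteq> 0 \<Longrightarrow> T (s # xs) = Suc (F xs)"
    and mono: "\<And>xs s s'. length xs = k \<Longrightarrow> T (s # xs) \<noteq> 0 \<Longrightarrow> s \<le> s' \<Longrightarrow> T (s' # xs) \<noteq> 0"
    and ev: "\<And>xs. length xs = k \<Longrightarrow> \<exists>s. T (s # xs) \<noteq> 0"
  shows "\<exists>T. slow k F T"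
proof
  let ?T = "\<lambda>zs. if T zs \<le> hd zs then T zs else 0"
  have "grz 2 (Suc k) ?T"
    by (intro grz_if_le T grz.fn_hd grz.fn_const) auto
  moreover have "\<exists>s. ?T (s # xs) \<noteq> 0" if len: "length xs = k" for xs
  proof -
    obtain s where s: "T (s # xs) \<noteq> 0" using ev len by blast
    define s' where "s' = max s (Suc (F xs))"
    have "T (s' # xs) \<noteq> 0" using mono[OF len s, of s'] by (simp add: s'_def)
    with val[OF len this] have "?T (s' # xs) \<noteq> 0" by (auto simp: s'_def)
    then show ?thesis by blast
  qed
  moreover have "?T (s' # xs) \<noteq> 0" if len: "length xs = k" and s: "?T (s # xs) \<noteq> 0" "s \<le> s'" for xs s s'
  proof -
    have 1: "T (s # xs) \<noteq> 0" "T (s # xs) \<le> s" using s by (auto split: if_splits)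
    have 2: "T (s' # xs) \<noteq> 0" using mono[OF len 1(1) s(2)] .
    have "T (s' # xs) \<le> s'" using 1 val[OF len 1(1)] val[OF len 2] s(2) by simp
    then show ?thesis using 2 by simp
  qed
  moreover have "?T (s # xs) = Suc (F xs) \<and> Suc (F xs) \<le> s" if "length xs = k" "?T (s # xs) \<noteq> 0" for xs s
    using val[of xs s] that by (auto split: if_splits)
  ultimately show "slow k F ?T"
    unfolding slow_def by blast
qed

lemma slowD:
  assumes "slow k F T" "length xs = k"
  shows "T (s # xs) \<noteq> 0 \<Longrightarrow> T (s # xs) = Suc (F xs)" "T (s # xs) \<le> s"
    "T (s # xs) \<noteq> 0 \<Longrightarrow> s \<le> s' \<Longrightarrow> T (s' # xs) \<noteq> 0" "\<exists>s. T (s # xs) \<noteq> 0"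
  using assms unfolding slow_def by (blast, metis bot_nat_0.extremum, blast, blast)

lemma slow_comp:
  assumes "slow (length hs) g G" and "\<forall>h \<in> set hs. \<exists>T. slow k h T"
  shows "\<exists>T. slow k (\<lambda>xs. g (map (\<lambda>h. h xs) hs)) T"
proof -
  obtain r where r: "\<And>h. h \<in> set hs \<Longrightarrow> slow k h (r h)"
    using assms(2) by metis
  let ?P = "\<lambda>zs. prod_list (map (\<lambda>t. t zs) (map r hs))"
  let ?V = "\<lambda>zs. hd zs # map (\<lambda>h. r h zs - 1) hs"
  let ?T = "\<lambda>zs. if ?P zs = 0 then 0 else G (?V zs)"
  have len_hs: "length (map (\<lambda>h. h xs) hs) = length hs" for xs by simp
  note gG = assms(1)[unfolded slow_def]
  have rgrz: "grz 2 (Suc k) (r h)" if "h \<in> set hs" for h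
    using r[OF that] by (simp add: slow_def)
  have "grz 2 (Suc k) (\<lambda>zs. G (map (\<lambda>t. t zs) (hd # map (\<lambda>h zs. r h zs - 1) hs)))"
    by (rule grz.fn_comp) (use gG rgrz in \<open>auto intro!: grz_pred[simplified] grz.fn_hd\<close>)
  then have "grz 2 (Suc k) (\<lambda>zs. G (?V zs))" by (simp add: comp_def)
  then have T: "grz 2 (Suc k) ?T"
    by (intro grz_if0 grz_prod_list grz.fn_const) (use rgrz in auto)
  have P0: "?P zs \<noteq> 0 \<longleftrightarrow> (\<forall>h \<in> set hs. r h zs \<noteq> 0)" for zs
    by (auto simp: prod_list_zero_iff)
  have V: "?V (s # xs) = s # map (\<lambda>h. h xs) hs" if "length xs = k" "?P (s # xs) \<noteq> 0" for s xs
  proof -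
    have "r h (s # xs) - 1 = h xs" if h: "h \<in> set hs" for h
      using r[OF h] \<open>length xs = k\<close> \<open>?P (s # xs) \<noteq> 0\<close> h unfolding slow_def P0
      by (metis diff_Suc_1)
    then show ?thesis by simp
  qed
  show ?thesis
  proof (rule slowI[OF T])
    fix xs s assume len: "length xs = k" and nz: "?T (s # xs) \<noteq> 0"
    then have P: "?P (s # xs) \<noteq> 0" by (auto split: if_splits)
    show "?T (s # xs) = Suc (g (map (\<lambda>h. h xs) hs))"
      using nz P slowD(1)[OF assms(1) len_hs[of xs], of s] by (simp only: V[OF len P] if_False not_False_eq_True simp_thms)
  next
    fix xs s s' assume len: "length xs = k" and nz: "?T (s # xs) \<noteq> 0" and s: "s \<le> s'"
    then have P: "?P (s # xs) \<noteq> 0" by (auto split: if_splits)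
    have P': "?P (s' # xs) \<noteq> 0"
      using P r s len unfolding P0 slow_def by blast
    have "G (s # map (\<lambda>h. h xs) hs) \<noteq> 0" using nz P by (simp only: V[OF len P] if_False not_False_eq_True simp_thms)
    then have "G (s' # map (\<lambda>h. h xs) hs) \<noteq> 0"
      using gG[THEN conjunct2, rule_format, OF len_hs[of xs]] s by blast
    then show "?T (s' # xs) \<noteq> 0" using P' by (simp only: V[OF len P'] if_False not_False_eq_True simp_thms)
  next
    fix xs :: "nat list" assume len: "length xs = k"
    have "\<exists>s. \<forall>h \<in> set hs'. r h (s # xs) \<noteq> 0" if "set hs' \<subseteq> set hs" for hs'
      using that
    proof (induction hs')
      case (Cons h hs')
      then obtain s where s: "\<forall>h \<in> set hs'. r h (s # xs) \<noteq> 0" by auto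
      obtain s2 where s2: "r h (s2 # xs) \<noteq> 0" using r[of h] Cons.prems len by (auto simp: slow_def)
      have "\<forall>h \<in> set (h # hs'). r h (max s s2 # xs) \<noteq> 0"
      proof
        fix h' assume "h' \<in> set (h # hs')"
        then obtain s3 where "r h' (s3 # xs) \<noteq> 0" "s3 \<le> max s s2" "h' \<in> set hs"
          using s s2 Cons.prems max.cobounded1[of s s2] max.cobounded2[of s2 s]
          by (cases "h' = h") (auto simp del: max.cobounded1 max.cobounded2)
        then show "r h' (max s s2 # xs) \<noteq> 0" using r[of h'] len unfolding slow_def by blast
      qed
      then show ?case by blast
    qed auto
    then obtain s where s: "?P (s # xs) \<noteq> 0" unfolding P0 by blast
    obtain s2 where s2: "G (s2 # map (\<lambda>h. h xs) hs) \<noteq> 0"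
      using gG[THEN conjunct2, rule_format, OF len_hs[of xs]] by blast
    have P': "?P (max s s2 # xs) \<noteq> 0"
    proof -
      have "r h (max s s2 # xs) \<noteq> 0" if h: "h \<in> set hs" for h
      proof -
        have "r h (s # xs) \<noteq> 0" using s h unfolding P0 by blast
        then show ?thesis
          using r[OF h] len max.cobounded1[of s s2] unfolding slow_def by blast
      qed
      then show ?thesis unfolding P0 by blast
    qed
    have "G (max s s2 # map (\<lambda>h. h xs) hs) \<noteq> 0"
      using gG[THEN conjunct2, rule_format, OF len_hs[of xs]] s2 max.cobounded2 by blast
    then have "?T (max s s2 # xs) \<noteq> 0" using P' by (simp only: V[OF len P'] if_False not_False_eq_True simp_thms)
    then show "\<exists>s. ?T (s # xs) \<noteq> 0" by blast
  qed
qed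

text \<open>
  All values of the recursion are computed with the same clock, and one missing answer makes
  all later ones missing. The clock bounds the recursion.
\<close>

lemma slow_prec:
  assumes g: "slow k g G" and h: "slow (k + 2) h H"
  shows "\<exists>T. slow (k + 1) (prim_rec g h) T"
proof -
  define R where "R s xs = rec_nat (G (s # xs)) (\<lambda>y r. if r = 0 then 0 else H (s # y # (r - 1) # xs))"
    for s xs
  have bound: "R s xs m \<le> s" if "length xs = k" for s xs m
    using slowD(2)[OF g that] slowD(2)[OF h, of "_ # _ # xs"] that by (cases m) (auto simp: R_def)
  have val: "R s xs m = Suc (rec_nat (g xs) (\<lambda>y r. h (y # r # xs)) m)" if "length xs = k" "R s xs m \<noteq> 0" for s xs m
    using that(2)
  proof (induction m)
    case 0
    then show ?case using slowD(1)[OF g that(1), of s] by (simp add: R_def)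
  next
    case (Suc m)
    then have nz: "R s xs m \<noteq> 0" by (simp add: R_def split: if_splits)
    then have "H (s # m # (R s xs m - 1) # xs) \<noteq> 0" using Suc.prems by (simp add: R_def)
    then have "R s xs (Suc m) = Suc (h (m # (R s xs m - 1) # xs))"
      using slowD(1)[OF h, of "m # (R s xs m - 1) # xs" s] nz that(1) by (simp add: R_def)
    then show ?case using Suc.IH[OF nz] by simp
  qed
  have mono: "R s' xs m \<noteq> 0" if "length xs = k" "R s xs m \<noteq> 0" "s \<le> s'" for s s' xs m
    using that(2)
  proof (induction m)
    case 0
    then show ?case using slowD(3)[OF g that(1)] that(3) by (simp add: R_def)
  next
    case (Suc m)
    then have nz: "R s xs m \<noteq> 0" by (simp add: R_def split: if_splits)
    then have nz': "R s' xs m \<noteq> 0" using Suc.IH by blast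
    have eq: "R s xs m = R s' xs m" using val[OF that(1) nz] val[OF that(1) nz'] by simp
    have "H (s # m # (R s xs m - 1) # xs) \<noteq> 0" using Suc.prems nz by (simp add: R_def)
    then have "H (s' # m # (R s xs m - 1) # xs) \<noteq> 0"
      using slowD(3)[OF h, of "m # (R s xs m - 1) # xs" s s'] that(1,3) by simp
    then show ?case using nz' unfolding eq by (simp add: R_def)
  qed
  have ev: "\<exists>s. R s xs m \<noteq> 0" if "length xs = k" for xs m
  proof (induction m)
    case 0
    then show ?case using slowD(4)[OF g that] by (simp add: R_def)
  next
    case (Suc m)
    then obtain s where s: "R s xs m \<noteq> 0" by blast
    obtain s2 where s2: "H (s2 # m # (R s xs m - 1) # xs) \<noteq> 0"
      using slowD(4)[OF h, of "m # (R s xs m - 1) # xs"] \<open>length xs = k\<close> by auto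
    define s' where "s' = max s s2"
    have nz: "R s' xs m \<noteq> 0" by (rule mono[OF that s]) (simp add: s'_def)
    have eq: "R s xs m = R s' xs m" using val[OF that nz] val[OF that s] by simp
    have "H (s' # m # (R s xs m - 1) # xs) \<noteq> 0"
      using slowD(3)[OF h, of "m # (R s xs m - 1) # xs" s2 s'] that s2 by (simp add: s'_def)
    then have "R s' xs (Suc m) \<noteq> 0" using nz unfolding eq by (simp add: R_def)
    then show ?case by blast
  qed
  define T where "T zs = R (hd zs) (drop 2 zs) (zs ! 1)" for zs
  have "grz 2 (k + 2) (\<lambda>zs. rec_nat (G (map (\<lambda>h. h zs) [hd] @ drop 2 zs))
     (\<lambda>y r. (\<lambda>us. if us ! 1 = 0 then 0 else
        H (map (\<lambda>h. h us) [\<lambda>us. us ! 2, \<lambda>us. us ! 0, \<lambda>us. us ! 1 - 1] @ drop 4 us)) (y # r # zs)) (zs ! 1))"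
  proof (rule grz_rec[where b = "\<lambda>us. us ! 1"])
    show "grz 2 (k + 2) (\<lambda>zs. G (map (\<lambda>h. h zs) [hd] @ drop 2 zs))"
      by (rule grz.fn_append_drop[where m = k])
        (use g in \<open>auto simp: slow_def intro!: grz.fn_hd\<close>)
    show "grz 2 (k + 2 + 2) (\<lambda>us. if us ! 1 = 0 then 0 else
        H (map (\<lambda>h. h us) [\<lambda>us. us ! 2, \<lambda>us. us ! 0, \<lambda>us. us ! 1 - 1] @ drop 4 us))"
    proof (rule grz_if0)
      show "grz 2 (k + 2 + 2) (\<lambda>us. H (map (\<lambda>h. h us) [\<lambda>us. us ! 2, \<lambda>us. us ! 0, \<lambda>us. us ! 1 - 1] @ drop 4 us))"
        by (rule grz.fn_append_drop[where m = k])
          (use h in \<open>auto simp: slow_def eval_nat_numeral intro!: grz.fn_proj grz_pred[simplified]\<close>)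
    qed (auto intro: grz.fn_proj grz.fn_const)
    show "rec_nat (G (map (\<lambda>h. h zs) [hd] @ drop 2 zs))
     (\<lambda>y r. (\<lambda>us. if us ! 1 = 0 then 0 else
        H (map (\<lambda>h. h us) [\<lambda>us. us ! 2, \<lambda>us. us ! 0, \<lambda>us. us ! 1 - 1] @ drop 4 us)) (y # r # zs)) m
      \<le> (m # zs) ! 1" if "length zs = k + 2" for m zs
      using bound[of "drop 2 zs" "hd zs" m] that
      by (cases zs) (auto simp: R_def eval_nat_numeral cong: if_cong)
  qed (auto intro: grz.fn_proj)
  then have "grz 2 (k + 2) T"
    by (rule grz.fn_cong) (auto simp: T_def R_def eval_nat_numeral length_Suc_conv cong: if_cong)
  then have "grz 2 (Suc (k + 1)) T" by simp
  then show ?thesis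
  proof (rule slowI)
    fix xs :: "nat list" and s assume "length xs = k + 1"
    then obtain y ys where xs: "xs = y # ys" "length ys = k" by (cases xs) auto
    then have T: "T (s # xs) = R s ys y" for s by (simp add: T_def eval_nat_numeral)
    show "T (s # xs) = Suc (prim_rec g h xs)" if "T (s # xs) \<noteq> 0"
      using val[OF xs(2)] that unfolding T by (simp add: prim_rec_def xs)
    show "\<exists>s. T (s # xs) \<noteq> 0" using ev[OF xs(2)] unfolding T .
    show "T (s' # xs) \<noteq> 0" if "T (s # xs) \<noteq> 0" "s \<le> s'" for s'
      using mono[OF xs(2)] that unfolding T by blast
  qed
qed

text \<open>
  The counter stays at the first number that fails the test, so it can be run for any larger
  number of rounds.
\<close>

lemma counter_stops:
  fixes L n :: nat
  assumes "\<And>j. j < L \<Longrightarrow> P j" "\<not> P L" "L \<le> n"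
  shows "rec_nat 0 (\<lambda>_ r. if P r then Suc r else r) n = L"
proof -
  have "rec_nat 0 (\<lambda>_ r. if P r then Suc r else r) n = min n L"
  proof (induction n)
    case (Suc n)
    then show ?case using assms(1)[of n] assms(2) by (cases "n < L") (auto simp: min_def)
  qed simp
  then show ?thesis using assms(3) by simp
qed

lemma counter_below:
  "j < rec_nat 0 (\<lambda>_ r. if P r then Suc r else r) n \<Longrightarrow> P j"
proof (induction n)
  case (Suc n)
  let ?r = "rec_nat 0 (\<lambda>_ r. if P r then Suc r else r) n"
  show ?case
  proof (cases "P ?r")
    case True
    then have "j < Suc ?r" using Suc.prems by simp
    then have "j < ?r \<or> j = ?r" by linarith
    then show ?thesis using Suc.IH True by metis
  next
    case False
    then have "j < ?r" using Suc.prems by simp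
    then show ?thesis by (rule Suc.IH)
  qed
qed simp

lemma counter_le: "rec_nat 0 (\<lambda>_ r. if P r then Suc r else r) n \<le> n"
  by (induction n) auto

text \<open>
  A counter runs through the candidates as long as the clocked function answers with a value
  other than zero. It stops at the first zero or at the first missing answer, and these two
  cases are told apart by one more evaluation.
\<close>

lemma slow_minim:
  assumes g: "slow (k + 1) g G" and ex: "\<forall>xs. length xs = k \<longrightarrow> (\<exists>y. g (y # xs) = 0)"
  shows "\<exists>T. slow k (\<lambda>xs. LEAST y. g (y # xs) = 0) T"
proof -
  define P where "P s xs j \<longleftrightarrow> 1 < G (s # j # xs)" for s j and xs :: "nat list"
  define R where "R s xs = rec_nat 0 (\<lambda>_ r. if P s xs r then Suc r else r) s" for s xs
  define T where "T zs = (if G (hd zs # R (hd zs) (tl zs) # tl zs) = 1 then Suc (R (hd zs) (tl zs)) else 0)" for zs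
  have "grz 2 (Suc k) (\<lambda>zs. rec_nat 0 (\<lambda>y r. (\<lambda>us. if 1 < G (map (\<lambda>h. h us) [\<lambda>us. us ! 2, \<lambda>us. us ! 1] @ drop 3 us)
        then Suc (us ! 1) else us ! 1) (y # r # zs)) (hd zs))"
  proof (rule grz_rec[where b = hd])
    show "grz 2 (Suc k + 2) (\<lambda>us. if 1 < G (map (\<lambda>h. h us) [\<lambda>us. us ! 2, \<lambda>us. us ! 1] @ drop 3 us)
        then Suc (us ! 1) else us ! 1)"
    proof (rule grz_if_less)
      show "grz 2 (Suc k + 2) (\<lambda>us. G (map (\<lambda>h. h us) [\<lambda>us. us ! 2, \<lambda>us. us ! 1] @ drop 3 us))"
        by (rule grz.fn_append_drop[where m = k])
          (use g in \<open>auto simp: slow_def eval_nat_numeral intro!: grz.fn_proj\<close>)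
    qed (auto intro!: grz.fn_proj grz.fn_const grz.fn_Suc)
    show "rec_nat 0 (\<lambda>y r. (\<lambda>us. if 1 < G (map (\<lambda>h. h us) [\<lambda>us. us ! 2, \<lambda>us. us ! 1] @ drop 3 us)
        then Suc (us ! 1) else us ! 1) (y # r # zs)) m \<le> hd (m # zs)" if "length zs = Suc k" for m zs
      using that counter_le[of "P (hd zs) (tl zs)" m]
      by (cases zs) (auto simp: P_def eval_nat_numeral cong: if_cong)
  qed (auto intro: grz.fn_const grz.fn_hd grz.fn_hd)
  then have R: "grz 2 (Suc k) (\<lambda>zs. R (hd zs) (tl zs))"
    by (rule grz.fn_cong) (auto simp: R_def P_def eval_nat_numeral length_Suc_conv cong: if_cong)
  have "grz 2 (Suc k) (\<lambda>zs. if G (map (\<lambda>h. h zs) [hd, \<lambda>zs. R (hd zs) (tl zs)] @ drop 1 zs) = 1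
      then Suc (R (hd zs) (tl zs)) else 0)"
  proof (rule grz_if_eq)
    show "grz 2 (Suc k) (\<lambda>zs. G (map (\<lambda>h. h zs) [hd, \<lambda>zs. R (hd zs) (tl zs)] @ drop 1 zs))"
      by (rule grz.fn_append_drop[where m = k]) (use g R in \<open>auto simp: slow_def intro!: grz.fn_hd\<close>)
  qed (auto intro!: grz.fn_const grz.fn_Suc R)
  then have "grz 2 (Suc k) T"
    by (rule grz.fn_cong) (auto simp: T_def drop_Suc)
  then show ?thesis
  proof (rule slowI)
    fix xs :: "nat list" and s assume len: "length xs = k"
    then have len': "length (j # xs) = k + 1" for j by simp
    define L where "L = (LEAST y. g (y # xs) = 0)"
    have "\<exists>y. g (y # xs) = 0" using ex len by blast
    then have L: "g (L # xs) = 0" unfolding L_def by (rule LeastI_ex)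
    have below: "g (j # xs) \<noteq> 0" if "j < L" for j
      using not_less_Least[OF that[unfolded L_def]] .
    have T: "T (s # xs) = Suc L" if "L \<le> s" and nz: "\<And>j. j \<le> L \<Longrightarrow> G (s # j # xs) \<noteq> 0" for s
    proof -
      have "R s xs = L" unfolding R_def
      proof (rule counter_stops)
        show "P s xs j" if "j < L" for j
          using slowD(1)[OF g len'[of j], of s] nz[of j] that below[OF that] by (simp add: P_def)
        show "\<not> P s xs L"
          using slowD(1)[OF g len'[of L], of s] nz[of L] L by (simp add: P_def)
      qed fact
      then show ?thesis
        using slowD(1)[OF g len'[of L], of s] nz[of L] L by (simp add: T_def)
    qed
    have R: "R s xs = L" "\<And>j. j \<le> L \<Longrightarrow> G (s # j # xs) \<noteq> 0" if nz: "T (s # xs) \<noteq> 0" for s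
    proof -
      have G1: "G (s # R s xs # xs) = 1" using nz by (auto simp: T_def split: if_splits)
      then have gR: "g (R s xs # xs) = 0" using slowD(1)[OF g len'[of "R s xs"], of s] by simp
      have *: "1 < G (s # j # xs)" if "j < R s xs" for j
        using counter_below[of j "P s xs" s] that by (simp add: R_def P_def)
      have gj: "g (j # xs) \<noteq> 0" if "j < R s xs" for j
        using slowD(1)[OF g len'[of j], of s] *[OF that] by auto
      show RL: "R s xs = L"
        unfolding L_def
      proof (rule Least_equality[symmetric])
        show "g (R s xs # xs) = 0" by (fact gR)
        show "R s xs \<le> y" if "g (y # xs) = 0" for y
          using gj[of y] that by (meson not_le)
      qed
      show "G (s # j # xs) \<noteq> 0" if "j \<le> L" for j
        using *[of j] G1 that unfolding RL by (cases "j = L") auto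
    qed
    show "T (s # xs) = Suc (LEAST y. g (y # xs) = 0)" if "T (s # xs) \<noteq> 0"
      using R(1)[OF that] that by (auto simp: T_def L_def split: if_splits)
    show "T (s' # xs) \<noteq> 0" if "T (s # xs) \<noteq> 0" "s \<le> s'" for s'
    proof -
      have "L \<le> s'" using R(1)[OF that(1)] counter_le[of "P s xs" s] that(2) by (simp add: R_def)
      moreover have "G (s' # j # xs) \<noteq> 0" if "j \<le> L" for j
        using slowD(3)[OF g len'] R(2)[OF \<open>T (s # xs) \<noteq> 0\<close> that] \<open>s \<le> s'\<close> by blast
      ultimately show ?thesis using T by simp
    qed
    have "\<exists>s. \<forall>j < m. G (s # j # xs) \<noteq> 0" for m
    proof (induction m)
      case (Suc m)
      then obtain s where s: "\<forall>j < m. G (s # j # xs) \<noteq> 0" by blast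
      obtain s2 where s2: "G (s2 # m # xs) \<noteq> 0" using slowD(4)[OF g len'] by blast
      have "\<forall>j < Suc m. G (max s s2 # j # xs) \<noteq> 0"
      proof (intro allI impI)
        fix j assume "j < Suc m"
        then have "j < m \<or> j = m" by linarith
        then show "G (max s s2 # j # xs) \<noteq> 0"
          using slowD(3)[OF g len', of s j "max s s2"] slowD(3)[OF g len', of s2 j "max s s2"] s s2
          by fastforce
      qed
      then show ?case by blast
    qed auto
    then obtain s where s: "\<forall>j < Suc L. G (s # j # xs) \<noteq> 0" by blast
    have "G (max s L # j # xs) \<noteq> 0" if "j \<le> L" for j
      using slowD(3)[OF g len', of s j "max s L"] s that by simp
    then have "T (max s L # xs) = Suc L" by (intro T) auto
    then have "T (max s L # xs) \<noteq> 0" by simp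
    then show "\<exists>s. T (s # xs) \<noteq> 0" by blast
  qed
qed

theorem slow_exists:
  assumes "computable k F" shows "\<exists>T. slow k F T"
  using assms
proof induction
  case (zero k)
  show ?case by (rule slowI[of _ "\<lambda>_. 1"]) (auto intro: grz.fn_const[of _ _ 1, simplified])
next
  case succ
  have "grz 2 (Suc 1) (\<lambda>zs. Suc (Suc (zs ! 1)))" by (intro grz.fn_Suc grz.fn_proj) auto
  then show ?case by (rule slowI) auto
next
  case (proj i k)
  then have "grz 2 (Suc k) (\<lambda>zs. Suc (zs ! Suc i))" by (intro grz.fn_Suc grz.fn_proj) auto
  then show ?case by (rule slowI) auto
next
  case (comp hs g k)
  then show ?case using slow_comp by blast
next
  case (prec k g h)
  then show ?case using slow_prec by blast
next
  case (minim k g)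
  then show ?case using slow_minim by blast
qed

section \<open>Signed binary expansions\<close>

lemma grzegorczyk_unary_iff: "f \<in> grzegorczyk_unary n \<longleftrightarrow> grz n 1 (\<lambda>xs. f (xs ! 0))"
proof
  assume "f \<in> grzegorczyk_unary n"
  then obtain F where F: "grzegorczyk n 1 F" "\<And>x. f x = F [x]" by (auto simp: grzegorczyk_unary_def)
  show "grz n 1 (\<lambda>xs. f (xs ! 0))"
    by (rule grz.fn_cong[OF grz.fnI[OF F(1)]]) (auto simp: F(2) length_Suc_conv)
next
  assume "grz n 1 (\<lambda>xs. f (xs ! 0))"
  then obtain F where "grzegorczyk n 1 F" "\<And>xs. length xs = 1 \<Longrightarrow> F xs = f (xs ! 0)"
    by (auto simp: grz.fn_def)
  then show "f \<in> grzegorczyk_unary n"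
    unfolding grzegorczyk_unary_def by (auto intro!: exI[of _ F])
qed

lemma summable_digits:
  assumes "range f \<subseteq> {0, 1, 2::nat}"
  shows "summable (\<lambda>i. (real (f i) - 1) / 2 ^ (i + 1))"
proof (rule summable_comparison_test')
  show "summable (\<lambda>i. (1/2::real) ^ (i + 1))"
    by (subst summable_Suc_iff[of "\<lambda>i. (1/2::real) ^ i", unfolded Suc_eq_plus1]) (simp add: summable_geometric)
  show "norm ((real (f i) - 1) / 2 ^ (i + 1)) \<le> (1/2) ^ (i + 1)" if "i \<ge> 0" for i
  proof -
    have "f i \<in> {0, 1, 2}" using assms by blast
    then show ?thesis by (auto simp: power_divide)
  qed
qed

lemma abs_real_of_digits_le:
  assumes "range f \<subseteq> {0, 1, 2}"
  shows "\<bar>real_of_digits f\<bar> \<le> 1"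
proof -
  have s: "(\<lambda>i. (1/2::real) ^ (i + 1)) sums 1"
    using power_half_series by simp
  have "norm ((real (f i) - 1) / 2 ^ (i + 1)) \<le> (1/2) ^ (i + 1)" for i
  proof -
    have "f i \<in> {0, 1, 2}" using assms by blast
    then show ?thesis by (auto simp: power_divide)
  qed
  then have "norm (\<Sum>i. (real (f i) - 1) / 2 ^ (i + 1)) \<le> (\<Sum>i. (1/2::real) ^ (i + 1))"
    using s by (intro norm_suminf_le) (auto simp: sums_iff)
  then show ?thesis
    using s by (simp add: real_of_digits_def sums_iff)
qed

lemma range_shift: "range f \<subseteq> A \<Longrightarrow> range (\<lambda>i. f (i + n :: nat)) \<subseteq> A"
  by (erule subset_trans[rotated]) (intro image_subsetI rangeI)

lemma real_of_digits_split:
  assumes "range f \<subseteq> {0, 1, 2}"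
  shows "real_of_digits f = (\<Sum>i<n. (real (f i) - 1) / 2 ^ (i + 1)) + real_of_digits (\<lambda>i. f (i + n)) / 2 ^ n"
proof -
  have "real_of_digits f = (\<Sum>i. (real (f (i + n)) - 1) / 2 ^ (i + n + 1)) + (\<Sum>i<n. (real (f i) - 1) / 2 ^ (i + 1))"
    unfolding real_of_digits_def using suminf_split_initial_segment[OF summable_digits[OF assms], of n] by simp
  also have "(\<Sum>i. (real (f (i + n)) - 1) / 2 ^ (i + n + 1)) = (\<Sum>i. (real (f (i + n)) - 1) / 2 ^ (i + 1) / 2 ^ n)"
    by (simp add: power_add field_simps)
  also have "\<dots> = real_of_digits (\<lambda>i. f (i + n)) / 2 ^ n"
    unfolding real_of_digits_def
    by (rule suminf_divide) (rule summable_digits range_shift assms)+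
  finally show ?thesis by simp
qed

text \<open>
  This quadratic pairing needs no division, and the root of the code recovers the sum of the
  components.
\<close>

definition pair_code :: "nat \<Rightarrow> nat \<Rightarrow> nat" where "pair_code a b = (a + b) * (a + b) + a"
definition pair_root :: "nat \<Rightarrow> nat" where "pair_root p = (LEAST s. Suc p - (s + 1) * (s + 1) = 0)"
definition pair_fst :: "nat \<Rightarrow> nat" where "pair_fst p = p - pair_root p * pair_root p"
definition pair_snd :: "nat \<Rightarrow> nat" where "pair_snd p = pair_root p - pair_fst p"

lemma pair_root_pr: "pair_root (pair_code a b) = a + b"
  unfolding pair_root_def
proof (rule Least_equality)
  show "Suc (pair_code a b) - (a + b + 1) * (a + b + 1) = 0" by (simp add: pair_code_def algebra_simps)
next
  fix s assume *: "Suc (pair_code a b) - (s + 1) * (s + 1) = 0"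
  show "a + b \<le> s"
  proof (rule ccontr)
    assume "\<not> a + b \<le> s"
    then have "(s + 1) * (s + 1) \<le> (a + b) * (a + b)" by (intro mult_mono) auto
    then show False using * by (simp add: pair_code_def)
  qed
qed

lemma pair_fst_snd [simp]: "pair_fst (pair_code a b) = a" "pair_snd (pair_code a b) = b"
  by (simp_all add: pair_fst_def pair_snd_def pair_root_pr) (simp_all add: pair_code_def)

lemma pair_code_ge: "b \<le> pair_code a b"
  by (cases b) (auto simp: pair_code_def algebra_simps)

lemma pair_code_mono: "a \<le> a' \<Longrightarrow> b \<le> b' \<Longrightarrow> pair_code a b \<le> pair_code a' b'"
  by (auto simp: pair_code_def intro!: add_mono mult_mono)

lemma grz_pair_code: "2 \<le> n \<Longrightarrow> grz n k a \<Longrightarrow> grz n k b \<Longrightarrow> grz n k (\<lambda>xs. pair_code (a xs) (b xs))"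
  unfolding pair_code_def by (intro grz_add grz_mult) auto

lemma cmp_app2_grz: "grz 2 2 (\<lambda>ys. p (ys ! 0) (ys ! 1)) \<Longrightarrow> cmp k a \<Longrightarrow> cmp k b \<Longrightarrow> cmp k (\<lambda>xs. p (a xs) (b xs))"
  by (rule cmp.fn_app2[OF cmp_of_grz2])

lemma cmp_add: "cmp k a \<Longrightarrow> cmp k b \<Longrightarrow> cmp k (\<lambda>xs. a xs + b xs)"
  by (rule cmp_app2_grz) (auto intro!: grz_add grz.fn_proj)

lemma cmp_mult: "cmp k a \<Longrightarrow> cmp k b \<Longrightarrow> cmp k (\<lambda>xs. a xs * b xs)"
  by (rule cmp_app2_grz) (auto intro!: grz_mult grz.fn_proj)

lemma cmp_diff: "cmp k a \<Longrightarrow> cmp k b \<Longrightarrow> cmp k (\<lambda>xs. a xs - b xs)"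
  by (rule cmp_app2_grz) (auto intro!: grz_diff grz.fn_proj)

lemma cmp_pair_code: "cmp k a \<Longrightarrow> cmp k b \<Longrightarrow> cmp k (\<lambda>xs. pair_code (a xs) (b xs))"
  by (rule cmp_app2_grz) (auto intro!: grz_pair_code grz.fn_proj)

lemma cmp_mod2: "cmp k a \<Longrightarrow> cmp k (\<lambda>xs. a xs mod 2)"
  by (rule cmp.fn_app1[OF cmp_of_grz2]) (auto intro!: grz_mod2 grz.fn_proj)

lemma cmp_if0:
  assumes "cmp k c" "cmp k a" "cmp k b"
  shows "cmp k (\<lambda>xs. if c xs = 0 then a xs else b xs)"
  by (rule cmp.fn_app3[where p = "\<lambda>c a b. if c = 0 then a else b"], rule cmp_of_grz2)
    (auto intro!: grz_if0 grz.fn_proj assms)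

lemma cmp_pair_root: "cmp k a \<Longrightarrow> cmp k (\<lambda>xs. pair_root (a xs))"
proof (rule cmp.fn_app1[where p = pair_root])
  have "cmp 1 (\<lambda>xs. LEAST s. (\<lambda>us. Suc (us ! 1) - (us ! 0 + 1) * (us ! 0 + 1)) (s # xs) = 0)"
  proof (rule cmp_minim)
    show "cmp (1 + 1) (\<lambda>us. Suc (us ! 1) - (us ! 0 + 1) * (us ! 0 + 1))"
      by (intro cmp_diff cmp_mult cmp_add cmp.fn_Suc cmp.fn_proj cmp.fn_const) auto
    show "\<exists>s. (\<lambda>us. Suc (us ! 1) - (us ! 0 + 1) * (us ! 0 + 1)) (s # xs) = 0" for xs :: "nat list"
      by (rule exI[of _ "xs ! 0"]) simp
  qed
  then show "cmp 1 (\<lambda>xs. pair_root (xs ! 0))" by (simp add: pair_root_def)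
qed

lemma cmp_pair_fst: "cmp k a \<Longrightarrow> cmp k (\<lambda>xs. pair_fst (a xs))"
  unfolding pair_fst_def by (intro cmp_diff cmp_mult cmp_pair_root)

lemma cmp_pair_snd: "cmp k a \<Longrightarrow> cmp k (\<lambda>xs. pair_snd (a xs))"
  unfolding pair_snd_def by (intro cmp_diff cmp_pair_root cmp_pair_fst)

lemma cmp_div2:
  assumes "cmp k a" shows "cmp k (\<lambda>xs. a xs div 2)"
proof -
  have "cmp 1 (\<lambda>xs. LEAST s. (\<lambda>us. us ! 1 - (2 * us ! 0 + 1)) (s # xs) = 0)"
  proof (rule cmp_minim)
    show "cmp (1 + 1) (\<lambda>us. us ! 1 - (2 * us ! 0 + 1))"
      by (intro cmp_diff cmp_mult cmp_add cmp.fn_proj cmp.fn_const) auto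
    show "\<exists>s. (\<lambda>us. us ! 1 - (2 * us ! 0 + 1)) (s # xs) = 0" for xs :: "nat list"
      by (rule exI[of _ "xs ! 0"]) simp
  qed
  moreover have "(LEAST s. x - (2 * s + 1) = 0) = x div 2" for x :: nat
    by (rule Least_equality) auto
  ultimately have "cmp 1 (\<lambda>xs. xs ! 0 div 2)" by simp
  then show ?thesis using assms by (rule cmp.fn_app1)
qed

lemma cmp_computable2:
  assumes "computable2 g" "cmp k a" "cmp k b"
  shows "cmp k (\<lambda>xs. g (a xs) (b xs))"
proof -
  obtain G where G: "computable 2 G" "\<And>x y. g x y = G [x, y]"
    using assms(1) unfolding computable2_def by blast
  have "cmp 2 (\<lambda>xs. g (xs ! 0) (xs ! 1))"
    by (rule cmp.fn_cong[OF cmp.fnI[OF G(1)]]) (auto simp: G(2) length_Suc_conv eval_nat_numeral)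
  then show ?thesis using assms(2,3) by (rule cmp.fn_app2)
qed

section \<open>Diagonalization against a computable copy\<close>

text \<open>
  A computable copy makes the order of F decidable: the sign of a difference x - y is found
  by searching the field for a nonzero z and a w with (x - y) z^2 = w^2 or (y - x) z^2 = w^2,
  and the hypothesis says that the search succeeds. Given this, a real r different from all
  \<open>\<nu> k\<close> is built digit by digit. While the comparison of \<open>\<nu>
  k\<close> with the current partial sum a is being computed, the digits are 1, which have
  weight zero, so a does not change. The comparison therefore concerns a fixed rational
  number and ends after finitely many steps. Then one digit 0 or 2 moves the number away from
  \<open>\<nu> k\<close>, the next digit is again 1 to make the inequality strict, and k + 1
  is treated. The slow simulation lets the digit at position n use only n steps of the
  comparison, which puts the digit sequence into the second Grzegorczyk class, and hence r
  into F.
\<close>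

theorem no_computable_copy:
  fixes F :: "real set"
  assumes E2: "digit_reals (grzegorczyk_unary 2) \<subseteq> F"
    and sq: "\<And>x. x \<in> F \<Longrightarrow> 0 < x \<Longrightarrow> \<exists>z\<in>F. \<exists>w\<in>F. z \<noteq> 0 \<and> x * (z * z) = w * w"
  shows "\<not> computable_copy F \<nu>"
proof
  assume copy: "computable_copy F \<nu>"
  obtain gp where gp: "computable2 gp" "\<And>a b. \<nu> (gp a b) = \<nu> a + \<nu> b"
    using copy unfolding computable_copy_def by blast
  obtain gm where gm: "computable2 gm" "\<And>a b. \<nu> (gm a b) = \<nu> a * \<nu> b"
    using copy unfolding computable_copy_def by blast
  define ne where "ne a b = 1 - (of_bool (\<nu> a = \<nu> b) :: nat)" for a b
  have F: "range \<nu> = F" and eq: "computable2 (\<lambda>a b. of_bool (\<nu> a = \<nu> b))"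
    using copy unfolding computable_copy_def by auto
  have ne0: "ne a b = 0 \<longleftrightarrow> \<nu> a = \<nu> b" for a b by (simp add: ne_def)
  have cgp: "cmp k (\<lambda>xs. gp (a xs) (b xs))" and cgm: "cmp k (\<lambda>xs. gm (a xs) (b xs))"
    and cne: "cmp k (\<lambda>xs. ne (a xs) (b xs))" if "cmp k a" "cmp k b" for k a b
    unfolding ne_def using that gp(1) gm(1) eq
    by (auto intro!: cmp_diff cmp.fn_const cmp_computable2[where g = "\<lambda>a b. of_bool (\<nu> a = \<nu> b)"] 
        intro: cmp_computable2 simp del: One_nat_def)
  have digits_F: "of_int m + real_of_digits f \<in> F"
    if "grz 2 1 (\<lambda>xs. f (xs ! 0))" "range f \<subseteq> {0, 1, 2}" for f m
  proof -
    have "f \<in> grzegorczyk_unary 2"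
      using that(1) unfolding grzegorczyk_unary_iff .
    then show ?thesis using that(2) E2 unfolding digit_reals_def by blast
  qed
  have int_F: "of_int m \<in> F" for m
    using digits_F[of "\<lambda>_. 1" m] grz.fn_const[of _ 1 1] by (simp add: real_of_digits_def)
  have index: "\<exists>i. \<nu> i = x" if "x \<in> F" for x
    using that unfolding F[symmetric] by (metis rangeE)
  obtain iz where iz: "\<nu> iz = 0" using index[OF int_F[of 0]] by auto
  obtain im where im: "\<nu> im = -1" using index[OF int_F[of "-1"]] by auto
  obtain ih where ih: "\<nu> ih = 1 / 2"
  proof -
    let ?f = "\<lambda>i::nat. if i = 0 then 2 else 1 :: nat"
    have r: "range ?f \<subseteq> {0, 1, 2}" by auto
    have "real_of_digits (\<lambda>i. ?f (i + 1)) = 0" by (simp add: real_of_digits_def)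
    then have f: "real_of_digits ?f = 1 / 2"
      using real_of_digits_split[OF r, of 1] by simp
    have "grz 2 1 (\<lambda>xs. ?f (xs ! 0))"
      by (intro grz_if0 grz.fn_proj grz.fn_const) auto
    then have "of_int 0 + real_of_digits ?f \<in> F" by (rule digits_F[OF _ r])
    then have "1 / 2 \<in> F" unfolding f by simp
    then show ?thesis using that index by blast
  qed
  define hp where "hp i = rec_nat ih (\<lambda>_ r. gm ih r) i" for i
  have hp: "\<nu> (hp i) = 1 / 2 ^ (i + 1)" for i
    by (induction i) (simp_all add: hp_def ih gm)
  have chp: "cmp k (\<lambda>xs. hp (a xs))" if "cmp k a" for k a
  proof (rule cmp.fn_app1[OF _ that])
    have "cmp 1 (\<lambda>xs. rec_nat ih (\<lambda>y r. (\<lambda>us. gm ih (us ! 1)) (y # r # xs)) (xs ! 0))"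
      by (rule cmp_rec) (auto intro!: cgm cmp.fn_proj cmp.fn_const)
    then show "cmp 1 (\<lambda>xs. hp (xs ! 0))" by (simp add: hp_def)
  qed

  \<comment> \<open>If s codes a pair whose first component is an index of a nonzero element,
     then lhs s k a = 0 certifies that the k-th element is at most the a-th.\<close>
  define lhs where "lhs s k a = ne (gm a (gm (pair_fst s) (pair_fst s))) (gp (gm k (gm (pair_fst s) (pair_fst s))) (gm (pair_snd s) (pair_snd s)))" for s k a
  define test where "test s k a = (if ne (pair_fst s) iz = 0 then 1 else lhs s k a * lhs s a k)" for s k a
  define found where "found k a = (LEAST s. test s k a = 0)" for k a
  have clhs: "cmp k (\<lambda>xs. lhs (s xs) (x xs) (y xs))" if "cmp k s" "cmp k x" "cmp k y" for k s x y
    unfolding lhs_def by (intro cne cgp cgm cmp_pair_fst cmp_pair_snd that)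
  have lhs0: "lhs s k a = 0 \<longleftrightarrow> \<nu> a * (\<nu> (pair_fst s) * \<nu> (pair_fst s)) = \<nu> k * (\<nu> (pair_fst s) * \<nu> (pair_fst s)) + \<nu> (pair_snd s) * \<nu> (pair_snd s)" for s k a
    by (simp add: lhs_def ne0 gm gp)
  have ex_lhs: "\<exists>s. \<nu> (pair_fst s) \<noteq> 0 \<and> lhs s k a = 0" if le: "\<nu> k \<le> \<nu> a" for k a
  proof (cases "\<nu> k = \<nu> a")
    case True
    have "lhs (pair_code im iz) k a = 0" by (simp add: lhs0 iz True)
    then show ?thesis by (intro exI[of _ "pair_code im iz"]) (simp add: im)
  next
    case False
    have "\<nu> a - \<nu> k = \<nu> (gp a (gm im k))" by (simp add: gp gm im)
    then have "\<nu> a - \<nu> k \<in> F" using F by auto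
    with sq[of "\<nu> a - \<nu> k"] False le obtain z w where
      "z \<in> F" "w \<in> F" "z \<noteq> 0" "(\<nu> a - \<nu> k) * (z * z) = w * w" by auto
    moreover from this obtain iz' iw where "\<nu> iz' = z" "\<nu> iw = w" using index by blast
    ultimately show ?thesis by (intro exI[of _ "pair_code iz' iw"]) (simp add: lhs0 algebra_simps)
  qed
  have ex_test: "\<exists>s. test s k a = 0" for k a
  proof (cases "\<nu> k \<le> \<nu> a")
    case True
    then show ?thesis using ex_lhs[of k a] by (auto simp: test_def ne0 iz)
  next
    case False
    then show ?thesis using ex_lhs[of a k] by (auto simp: test_def ne0 iz)
  qed
  have test_found: "test (found k a) k a = 0" for k a
    unfolding found_def using ex_test by (rule LeastI_ex)
  have lhs_iff: "lhs (found k a) k a = 0 \<longleftrightarrow> \<nu> k \<le> \<nu> a" for k a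
  proof -
    let ?s = "found k a"
    let ?z = "\<nu> (pair_fst ?s)" let ?w = "\<nu> (pair_snd ?s)"
    have z: "?z \<noteq> 0" and or: "lhs ?s k a = 0 \<or> lhs ?s a k = 0"
      using test_found[of k a] by (auto simp: test_def ne0 iz split: if_splits)
    have zz: "0 < ?z * ?z" using z by (metis not_real_square_gt_zero)
    have ww: "0 \<le> ?w * ?w" by simp
    show ?thesis
    proof
      assume "lhs ?s k a = 0"
      then have "\<nu> k * (?z * ?z) \<le> \<nu> a * (?z * ?z)" unfolding lhs0 using ww by linarith
      then show "\<nu> k \<le> \<nu> a" using zz by (metis mult_le_cancel_right_pos)
    next
      assume le: "\<nu> k \<le> \<nu> a"
      show "lhs ?s k a = 0"
      proof (rule ccontr)
        assume neq: "lhs ?s k a \<noteq> 0"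
        with or have *: "lhs ?s a k = 0" by blast
        have "\<nu> k * (?z * ?z) \<le> \<nu> a * (?z * ?z)" using le zz by (intro mult_right_mono) auto
        then have "?w * ?w = 0" using * ww unfolding lhs0 by linarith
        then show False using * neq unfolding lhs0 by simp
      qed
    qed
  qed
  have cfound: "cmp 2 (\<lambda>xs. found (xs ! 0) (xs ! 1))"
  proof -
    have "cmp 2 (\<lambda>xs. LEAST s. (\<lambda>us. test (us ! 0) (us ! 1) (us ! 2)) (s # xs) = 0)"
    proof (rule cmp_minim)
      show "cmp (2 + 1) (\<lambda>us. test (us ! 0) (us ! 1) (us ! 2))"
        unfolding test_def by (intro cmp_if0 clhs cne cmp_pair_fst cmp_mult cmp.fn_proj cmp.fn_const) auto
      show "\<exists>s. (\<lambda>us. test (us ! 0) (us ! 1) (us ! 2)) (s # xs) = 0" for xs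
        using ex_test by simp
    qed
    then show ?thesis by (simp add: found_def eval_nat_numeral)
  qed

  \<comment> \<open>The state x is a pair of the last answer y and the position i at which it
     came. The half of y is a pair of the number k of the element to be treated next and an index
     of a partial sum, and its parity is the last decision: 1 for the digit 2, and 0 for the
     digit 0 at position i. Thus kk x is k, and aa x is an index of the partial sum that includes
     this digit.\<close>
  define kk where "kk x = pair_fst (pair_fst x div 2)" for x
  define aa where "aa x = gp (pair_snd (pair_fst x div 2)) (if pair_fst x mod 2 = 0 then gm im (hp (pair_snd x)) else hp (pair_snd x))" for x
  define G where "G x = 2 * pair_code (Suc (kk x)) (aa x) +
     (if lhs (found (kk x) (aa x)) (kk x) (aa x) = 0 then 1 else 0)" for x
  have ckk: "cmp 1 (\<lambda>xs. kk (xs ! 0))"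
    unfolding kk_def by (intro cmp_pair_fst cmp_div2 cmp.fn_proj) auto
  have caa: "cmp 1 (\<lambda>xs. aa (xs ! 0))"
    unfolding aa_def
    by (intro cmp_pair_fst cmp_pair_snd cmp_div2 cgp cgm chp cmp_if0 cmp_mod2 cmp.fn_proj cmp.fn_const) auto
  have "cmp 1 (\<lambda>xs. G (xs ! 0))"
    unfolding G_def
    by (intro cmp_add cmp_mult cmp_pair_code cmp.fn_Suc cmp_if0 clhs ckk caa cmp.fn_const cmp.fn_app2[OF cfound])
  then obtain G' where G': "computable 1 G'" "\<And>xs. length xs = 1 \<Longrightarrow> G' xs = G (xs ! 0)"
    unfolding cmp.fn_def by blast
  obtain T' where T': "slow 1 G' T'" using slow_exists[OF G'(1)] by blast
  define T where "T s x = T' [s, x]" for s x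
  have T1: "T s x = Suc (G x)" if "T s x \<noteq> 0" for s x
    using slowD(1)[OF T', of "[x]" s] that G'(2)[of "[x]"] by (simp add: T_def)
  have T2: "T s x \<le> s" for s x
    using slowD(2)[OF T', of "[x]" s] by (simp add: T_def)
  have T3: "T s' x \<noteq> 0" if "T s x \<noteq> 0" "s \<le> s'" for s s' x
    using slowD(3)[OF T', of "[x]" s s'] that by (simp add: T_def)
  have T4: "\<exists>s. T s x \<noteq> 0" for x
    using slowD(4)[OF T', of "[x]"] by (simp add: T_def)
  have gT: "grz 2 k (\<lambda>xs. T (a xs) (b xs))" if "grz 2 k a" "grz 2 k b" for k a b
  proof (rule grz.fn_app2[OF _ that])
    have "grz 2 2 T'" using T' by (simp add: slow_def numeral_2_eq_2)
    then show "grz 2 2 (\<lambda>ys. T (ys ! 0) (ys ! 1))"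
      by (rule grz.fn_cong) (auto simp: T_def length_Suc_conv eval_nat_numeral)
  qed

  \<comment> \<open>A decision is taken when the answer has arrived. The clock must also exceed
     the successor of the state: since a new state is at least the current position, two
     decisions never fall on consecutive positions.\<close>
  define act where "act s x \<longleftrightarrow> T s x \<noteq> 0 \<and> Suc x < s" for s x
  define x0 where "x0 = pair_code (2 * pair_code 0 iz + 1) 0"
  define X where "X n = rec_nat x0 (\<lambda>s x. if act s x then pair_code (T s x - 1) s else x) n" for n
  have X_simps: "X 0 = x0" "X (Suc n) = (if act n (X n) then pair_code (T n (X n) - 1) n else X n)" for n
    by (simp_all add: X_def)
  \<comment> \<open>Decoded answers are at most the clock, so the states are bounded by a
     quadratic polynomial.\<close>
  have X_bound: "X n \<le> pair_code n n + x0" for n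
  proof (induction n)
    case (Suc n)
    have "T n (X n) - 1 \<le> Suc n" using T2[of n "X n"] by simp
    then have "pair_code (T n (X n) - 1) n \<le> pair_code (Suc n) (Suc n)" by (intro pair_code_mono) auto
    moreover have "pair_code n n \<le> pair_code (Suc n) (Suc n)" by (intro pair_code_mono) auto
    ultimately show ?case using Suc by (auto simp: X_simps)
  qed (simp add: X_simps)
  have gif: "grz 2 k (\<lambda>xs. if act (s xs) (x xs) then a xs else b xs)"
    if "grz 2 k s" "grz 2 k x" "grz 2 k a" "grz 2 k b" for k s x a b
  proof -
    have "grz 2 k (\<lambda>xs. if T (s xs) (x xs) = 0 then b xs else if Suc (x xs) < s xs then a xs else b xs)"
      by (intro grz_if0 grz_if_less gT grz.fn_Suc that) auto
    then show ?thesis by (rule grz.fn_cong) (auto simp: act_def)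
  qed
  have gX: "grz 2 1 (\<lambda>xs. X (xs ! 0))"
  proof -
    have "grz 2 1 (\<lambda>xs. rec_nat x0 (\<lambda>s x. (\<lambda>us. if act (us ! 0) (us ! 1) then pair_code (T (us ! 0) (us ! 1) - 1) (us ! 0)
       else us ! 1) (s # x # xs)) (xs ! 0))"
    proof (rule grz_rec[where b = "\<lambda>us. pair_code (us ! 0) (us ! 0) + x0"])
      show "grz 2 (1 + 2) (\<lambda>us. if act (us ! 0) (us ! 1) then pair_code (T (us ! 0) (us ! 1) - 1) (us ! 0) else us ! 1)"
        by (intro gif grz_pair_code grz_pred gT grz.fn_proj) auto
      show "grz 2 (1 + 1) (\<lambda>us. pair_code (us ! 0) (us ! 0) + x0)"
        by (intro grz_add grz_pair_code grz.fn_proj grz.fn_const) auto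
      show "rec_nat x0 (\<lambda>s x. (\<lambda>us. if act (us ! 0) (us ! 1) then pair_code (T (us ! 0) (us ! 1) - 1) (us ! 0)
       else us ! 1) (s # x # xs)) m \<le> pair_code ((m # xs) ! 0) ((m # xs) ! 0) + x0" for m and xs :: "nat list"
        using X_bound[of m] by (simp add: X_def cong: if_cong)
    qed (auto intro: grz.fn_const grz.fn_proj)
    then show ?thesis by (simp add: X_def cong: if_cong)
  qed
  define d where "d n = (if act n (X n) then 2 * ((T n (X n) - 1) mod 2) else 1)" for n
  have gd: "grz 2 1 (\<lambda>xs. d (xs ! 0))"
    unfolding d_def by (intro gif gX grz_mult grz_mod2 grz_pred gT grz.fn_proj grz.fn_const) auto
  have rd: "range d \<subseteq> {0, 1, 2}"
  proof -
    have "d n \<in> {0, 1, 2}" for n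
    proof -
      have "(T n (X n) - 1) mod 2 = 0 \<or> (T n (X n) - 1) mod 2 = 1" by linarith
      then show ?thesis by (auto simp: d_def)
    qed
    then show ?thesis by (intro image_subsetI)
  qed
  define A where "A x = \<nu> (aa x)" for x
  have A: "A (pair_code (2 * pair_code k a + b) i) = \<nu> a + (if b = 0 then - 1 else 1) / 2 ^ (i + 1)" if "b < 2" for k a b i
  proof -
    have "b = 0 \<or> b = 1" using that by linarith
    then show ?thesis by (elim disjE) (simp_all add: A_def aa_def gp gm im hp)
  qed
  have kk: "kk (pair_code (2 * pair_code k a + b) i) = k" if "b < 2" for k a b i
    using that by (simp add: kk_def)
  \<comment> \<open>The summand in front accounts for the digit that the initial state pretends
     to have emitted.\<close>
  define r where "r = A (X 0) + real_of_digits d"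
  have "real_of_digits d \<in> F" using digits_F[OF gd rd, of 0] by simp
  then obtain id where "\<nu> id = real_of_digits d" using index by blast
  then have "\<nu> (gp (aa (X 0)) id) = r" by (simp add: gp r_def A_def)
  then obtain ir where ir: "\<nu> ir = r" by blast

  have G_act: "\<exists>b<2. X (Suc n) = pair_code (2 * pair_code (Suc (kk (X n))) (aa (X n)) + b) n \<and> d n = 2 * b \<and>
      (b = 1 \<longleftrightarrow> \<nu> (kk (X n)) \<le> A (X n))" if "act n (X n)" for n
  proof -
    have "T n (X n) = Suc (G (X n))" using that T1 by (simp add: act_def)
    then show ?thesis using that
      by (intro exI[of _ "if lhs (found (kk (X n)) (aa (X n))) (kk (X n)) (aa (X n)) = 0 then 1 else 0"])
        (simp add: X_simps d_def G_def A_def lhs_iff)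
  qed
  have AX: "A (X n) = A (X 0) + (\<Sum>i<n. (real (d i) - 1) / 2 ^ (i + 1))" for n
  proof (induction n)
    case (Suc n)
    show ?case
    proof (cases "act n (X n)")
      case True
      obtain b where b: "b < 2" "X (Suc n) = pair_code (2 * pair_code (Suc (kk (X n))) (aa (X n)) + b) n" "d n = 2 * b"
        using G_act[OF True] by blast
      have "A (X (Suc n)) = A (X n) + (if b = 0 then - 1 else 1) / 2 ^ (n + 1)"
        unfolding b(2) using A[OF b(1)] by (simp add: A_def)
      moreover have "real (d n) - 1 = (if b = 0 then - 1 else 1)" using b(1,3) by auto
      ultimately show ?thesis using Suc by simp
    qed (use Suc in \<open>simp add: X_simps d_def\<close>)
  qed simp
  have next_act: "\<exists>m\<ge>n. act m (X m) \<and> X m = X n" for n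
  proof -
    obtain s where s: "T s (X n) \<noteq> 0" using T4 by blast
    define m where "m = max n (max s (X n + 2))"
    have am: "act m (X n)" using T3[OF s, of m] by (auto simp: act_def m_def)
    have ex: "\<exists>m. n \<le> m \<and> act m (X n)" using am by (intro exI[of _ m]) (simp add: m_def)
    define l where "l = (LEAST m. n \<le> m \<and> act m (X n))"
    have "n \<le> l \<and> act l (X n)" unfolding l_def using ex by (rule LeastI_ex)
    then have l: "n \<le> l" "act l (X n)" by blast+
    have nl: "\<not> act j (X n)" if "n \<le> j" "j < l" for j
      using not_less_Least[of j "\<lambda>m. n \<le> m \<and> act m (X n)", folded l_def] that by blast
    have "n + j \<le> l \<Longrightarrow> X (n + j) = X n" for j
      by (induction j) (auto simp: X_simps nl)
    from this[of "l - n"] have "X l = X n" using l by simp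
    then show ?thesis using l by (intro exI[of _ l]) simp
  qed
  have reach: "\<exists>n. kk (X n) = k" for k
  proof (induction k)
    case 0
    show ?case by (rule exI[of _ 0], unfold X_simps x0_def, rule kk) simp
  next
    case (Suc k)
    then obtain n where n: "kk (X n) = k" by blast
    obtain m where m: "act m (X m)" "X m = X n" using next_act by blast
    obtain b where "b < 2" "X (Suc m) = pair_code (2 * pair_code (Suc (kk (X m))) (aa (X m)) + b) m"
      using G_act[OF m(1)] by blast
    then have "kk (X (Suc m)) = Suc k" using n m by (simp only: kk)
    then show ?case by blast
  qed
  have "\<nu> k \<noteq> r" for k
  proof -
    obtain n where n: "kk (X n) = k" using reach by blast
    obtain m where m: "act m (X m)" "X m = X n" using next_act by blast
    obtain b where b: "b < 2" "X (Suc m) = pair_code (2 * pair_code (Suc (kk (X m))) (aa (X m)) + b) m" "d m = 2 * b"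
       "b = 1 \<longleftrightarrow> \<nu> k \<le> A (X m)"
      using G_act[OF m(1)] n m(2) by metis
    have "\<not> act (Suc m) (X (Suc m))" using pair_code_ge[of m] unfolding b(2) by (auto simp: act_def not_less le_Suc_eq)
    then have d1: "d (Suc m) = 1" by (simp add: d_def)
    define u where "u = real_of_digits (\<lambda>i. d (i + (m + 2)))"
    define P where "P = (2::real) ^ (m + 1)"
    have P: "0 < P" by (simp add: P_def)
    have "\<bar>u\<bar> \<le> 1" unfolding u_def
      by (rule abs_real_of_digits_le range_shift rd)+
    moreover have "r = A (X m) + (real (d m) - 1) / P + u / (2 * P)"
      using real_of_digits_split[OF rd, of "m + 2"] d1 by (simp add: r_def AX[of m] u_def P_def)
    then have "r = A (X m) + ((real (d m) - 1) + u / 2) / P" using P by (simp add: field_simps)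
    moreover have "0 < ((real (d m) - 1) + u / 2) / P" if "b = 1"
      using that b(3) \<open>\<bar>u\<bar> \<le> 1\<close> P by (intro divide_pos_pos) (auto simp: abs_le_iff)
    moreover have "((real (d m) - 1) + u / 2) / P < 0" if "b = 0"
      using that b(3) \<open>\<bar>u\<bar> \<le> 1\<close> P by (intro divide_neg_pos) (auto simp: abs_le_iff)
    moreover have "b = 0 \<or> b = 1" using b(1) by linarith
    ultimately show ?thesis using b(4) by (elim disjE) simp_all
  qed
  then show False using ir by blast
qed

section \<open>Signed digits of square roots\<close>

text \<open>
  If x = M + \<open>real_of_digits d\<close>, then \<open>scaled d M n\<close> is the integer
  that approximates 4^n x by the first 2n digits. The subtraction of 3 turns the digits 0, 1,
  2 into -1, 0, 1, and under the invariant below the difference is never negative.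
\<close>

definition scaled :: "(nat \<Rightarrow> nat) \<Rightarrow> nat \<Rightarrow> nat \<Rightarrow> nat" where
  "scaled d M = rec_nat M (\<lambda>n r. 4 * r + (2 * d (2 * n) + d (2 * n + 1)) - 3)"

lemma scaled_simps [simp]:
  "scaled d M 0 = M"
  "scaled d M (Suc n) = 4 * scaled d M n + (2 * d (2 * n) + d (2 * n + 1)) - 3"
  by (simp_all add: scaled_def)

text \<open>
  The new approximation of the root is 2 Y + e with e in {-1, 0, 1}, so the numbers e are
  signed digits of the root. The thresholds are chosen such that the remainder Z - Y^2 never
  exceeds Y in absolute value.
\<close>

definition root_step :: "nat \<Rightarrow> nat \<Rightarrow> nat" where
  "root_step Z Y = (if 4 * (Y * Y) + 2 * Y < Z then 2 * Y + 1 else if Z + 2 * Y < 4 * (Y * Y) then 2 * Y - 1 else 2 * Y)"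

definition root :: "(nat \<Rightarrow> nat) \<Rightarrow> nat \<Rightarrow> nat \<Rightarrow> nat \<Rightarrow> nat" where
  "root d M Y = rec_nat Y (\<lambda>n r. root_step (scaled d M (Suc n)) r)"

lemma root_simps [simp]:
  "root d M Y 0 = Y"
  "root d M Y (Suc n) = root_step (scaled d M (Suc n)) (root d M Y n)"
  by (simp_all add: root_def)

definition root_digit :: "(nat \<Rightarrow> nat) \<Rightarrow> nat \<Rightarrow> nat \<Rightarrow> nat \<Rightarrow> nat" where
  "root_digit d M Y n = root d M Y (Suc n) + 1 - 2 * root d M Y n"

definition near_square :: "nat \<Rightarrow> nat \<Rightarrow> bool" where
  "near_square Z Y \<longleftrightarrow> 3 \<le> Y \<and> Z \<le> Y * Y + Y \<and> Y * Y \<le> Z + Y"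

text \<open>
  With R = Z - Y^2 the remainder before the correction is V = 4 R + s - 3, taken with respect
  to 2 Y. If |V| is at most 2 Y, then e = 0 works. Otherwise V lies between 2 Y and 4 Y + 3
  in absolute value, and subtracting 4 Y + 1 or adding 4 Y - 1 brings it back. The condition
  \<open>3 \<le> Y\<close> absorbs the additive constants.
\<close>

lemma root_step_near:
  assumes near: "near_square Z Y" and s: "s \<le> 6"
  shows "near_square (4 * Z + s - 3) (root_step (4 * Z + s - 3) Y)"
proof -
  define Q where "Q = Y * Y"
  have Y: "3 \<le> Y" "Z \<le> Q + Y" "Q \<le> Z + Y" using near by (auto simp: near_square_def Q_def)
  have Q: "3 * Y \<le> Q" unfolding Q_def using Y(1) by (intro mult_right_mono) auto
  have Z: "6 \<le> Z" using Y Q by linarith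
  obtain Y' where Y': "Y = Suc Y'" using Y(1) by (cases Y) auto
  have sq: "(2 * Y) * (2 * Y) = 4 * Q" "(2 * Y + 1) * (2 * Y + 1) = 4 * Q + 4 * Y + 1"
    "(2 * Y - 1) * (2 * Y - 1) + 4 * Y = 4 * Q + 1"
    by (simp_all add: Q_def Y' algebra_simps)
  show ?thesis
    unfolding near_square_def root_step_def Q_def[symmetric]
    using Y Q Z s sq by (auto split: if_splits)
qed

lemma root_near:
  assumes "near_square M Y" "range d \<subseteq> {0, 1, 2}"
  shows "near_square (scaled d M n) (root d M Y n)"
proof (induction n)
  case (Suc n)
  have "d i \<le> 2" for i
  proof -
    have "d i \<in> {0, 1, 2}" using assms(2) by (rule subsetD) (rule rangeI)
    then show ?thesis by auto
  qed
  from this[of "2 * n"] this[of "2 * n + 1"] have "2 * d (2 * n) + d (2 * n + 1) \<le> 6"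
    by linarith
  from root_step_near[OF Suc this] show ?case by simp
qed (use assms in simp)

lemma root_digit_range: 
  assumes "near_square M Y" "range d \<subseteq> {0, 1, 2}"
  shows "range (root_digit d M Y) \<subseteq> {0, 1, 2}"
proof (intro image_subsetI)
  fix n
  have "3 \<le> root d M Y n" using root_near[OF assms, of n] by (simp add: near_square_def)
  then show "root_digit d M Y n \<in> {0, 1, 2}"
    by (auto simp: root_digit_def root_step_def)
qed

lemma digit_partial_sums:
  assumes "range f \<subseteq> {0, 1, 2}"
  shows "(\<lambda>n. \<Sum>i<n. (real (f i) - 1) / 2 ^ (i + 1)) \<longlonglongrightarrow> real_of_digits f"
  using summable_LIMSEQ[OF summable_digits[OF assms]] by (simp add: real_of_digits_def)

text \<open>
  Scaled by 4^n, the invariant says that the square of the partial sums of the root differs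
  from those of the radicand by a quantity that tends to zero.
\<close>

theorem root_digits:
  assumes near: "near_square M Y" and d: "range d \<subseteq> {0, 1, 2}"
  shows "(real Y + real_of_digits (root_digit d M Y))\<^sup>2 = real M + real_of_digits d"
proof -
  let ?Z = "scaled d M" let ?Y = "root d M Y" let ?e = "root_digit d M Y"
  note inv = root_near[OF near d, unfolded near_square_def]
  have e: "range ?e \<subseteq> {0, 1, 2}" by (rule root_digit_range[OF near d])
  have Y: "real (?Y n) / 2 ^ n = real Y + (\<Sum>i<n. (real (?e i) - 1) / 2 ^ (i + 1))" for n
  proof (induction n)
    case (Suc n)
    have "2 * ?Y n \<le> ?Y (Suc n) + 1" using inv[of n] by (auto simp: root_step_def)
    then have "real (?Y (Suc n)) = 2 * real (?Y n) + (real (?e n) - 1)"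
      by (simp add: root_digit_def of_nat_diff del: root_simps)
    then have "real (?Y (Suc n)) / 2 ^ Suc n = real (?Y n) / 2 ^ n + (real (?e n) - 1) / 2 ^ (n + 1)"
      by (simp add: field_simps del: root_simps)
    then show ?case using Suc by (simp del: root_simps)
  qed simp
  have Z: "real (?Z n) / 4 ^ n = real M + (\<Sum>i<2 * n. (real (d i) - 1) / 2 ^ (i + 1))" for n
  proof (induction n)
    case (Suc n)
    have "6 \<le> ?Z n"
    proof -
      have "3 * ?Y n \<le> ?Y n * ?Y n" using inv[of n] by (intro mult_right_mono) auto
      then show ?thesis using inv[of n] by linarith
    qed
    then have Z_Suc: "real (?Z (Suc n)) = 4 * real (?Z n) + 2 * (real (d (2 * n)) - 1) + (real (d (2 * n + 1)) - 1)"
      by (simp add: of_nat_diff)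
    have powers: "(2::real) ^ (2 * n + 1) = 2 * 4 ^ n" "(2::real) ^ (2 * n + 2) = 4 * 4 ^ n"
      "(4::real) ^ Suc n = 4 * 4 ^ n"
      by (simp_all add: power_mult)
    have "real (?Z (Suc n)) / 4 ^ Suc n = real (?Z n) / 4 ^ n + (real (d (2 * n)) - 1) / 2 ^ (2 * n + 1)
        + (real (d (2 * n + 1)) - 1) / 2 ^ (2 * n + 2)"
      unfolding powers Z_Suc by (simp add: field_simps del: scaled_simps)
    then show ?case using Suc by (simp del: scaled_simps)
  qed simp
  have limY: "(\<lambda>n. real (?Y n) / 2 ^ n) \<longlonglongrightarrow> real Y + real_of_digits ?e"
    unfolding Y by (intro tendsto_add tendsto_const digit_partial_sums e)
  have "(\<lambda>n. \<Sum>i<2 * n. (real (d i) - 1) / 2 ^ (i + 1)) \<longlonglongrightarrow> real_of_digits d"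
    using LIMSEQ_subseq_LIMSEQ[OF digit_partial_sums[OF d], of "\<lambda>n. 2 * n"]
    by (simp add: strict_mono_def comp_def)
  then have limZ: "(\<lambda>n. real (?Z n) / 4 ^ n) \<longlonglongrightarrow> real M + real_of_digits d"
    unfolding Z by (intro tendsto_add tendsto_const)
  have "(\<lambda>n. real (?Y n) / 2 ^ n * (1 / 2) ^ n) \<longlonglongrightarrow> (real Y + real_of_digits ?e) * 0"
    by (intro tendsto_mult limY LIMSEQ_realpow_zero) auto
  then have lim0: "(\<lambda>n. real (?Y n) / 2 ^ n * (1 / 2) ^ n) \<longlonglongrightarrow> 0" by simp
  have bound: "\<bar>real (?Z n) / 4 ^ n - (real (?Y n) / 2 ^ n)\<^sup>2\<bar> \<le> real (?Y n) / 2 ^ n * (1 / 2) ^ n" for n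
  proof -
    have "real (?Z n) \<le> real (?Y n) * real (?Y n) + real (?Y n)"
      "real (?Y n) * real (?Y n) \<le> real (?Z n) + real (?Y n)"
      using inv[of n] unfolding of_nat_mult[symmetric] of_nat_add[symmetric] of_nat_le_iff by auto
    then have "\<bar>real (?Z n) - (real (?Y n))\<^sup>2\<bar> \<le> real (?Y n)" by (simp add: power2_eq_square abs_le_iff)
    then have "\<bar>real (?Z n) - (real (?Y n))\<^sup>2\<bar> / 4 ^ n \<le> real (?Y n) / 4 ^ n" by (intro divide_right_mono) auto
    moreover have "(4::real) ^ n = 2 ^ n * 2 ^ n" by (simp add: power_mult_distrib[symmetric])
    ultimately show ?thesis
      by (simp add: power_divide power2_eq_square diff_divide_distrib[symmetric])
  qed
  have "(\<lambda>n. real (?Z n) / 4 ^ n - (real (?Y n) / 2 ^ n)\<^sup>2) \<longlonglongrightarrow> 0"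
  proof (rule tendsto_0_le[OF lim0, of _ 1], rule always_eventually, rule allI)
    fix n
    have "\<bar>real (?Z n) / 4 ^ n - (real (?Y n) / 2 ^ n)\<^sup>2\<bar> \<le> \<bar>real (?Y n) / 2 ^ n * (1 / 2) ^ n\<bar>"
      using bound[of n] abs_ge_self order_trans by blast
    then show "norm (real (?Z n) / 4 ^ n - (real (?Y n) / 2 ^ n)\<^sup>2) \<le> norm (real (?Y n) / 2 ^ n * (1 / 2) ^ n) * 1"
      by (simp only: real_norm_def mult_1_right)
  qed
  moreover have "(\<lambda>n. real (?Z n) / 4 ^ n - (real (?Y n) / 2 ^ n)\<^sup>2) \<longlonglongrightarrow>
      (real M + real_of_digits d) - (real Y + real_of_digits ?e)\<^sup>2"
    by (intro tendsto_diff limZ tendsto_power limY)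
  ultimately have "0 = (real M + real_of_digits d) - (real Y + real_of_digits ?e)\<^sup>2"
    by (rule LIMSEQ_unique)
  then show ?thesis by simp
qed

lemma ex_near_square:
  assumes "9 \<le> M" shows "\<exists>Y. near_square M Y"
proof -
  have "\<exists>Y. Y * Y \<le> M \<and> M < Suc Y * Suc Y"
  proof (induction M)
    case (Suc M)
    then obtain Y where "Y * Y \<le> M" "M < Suc Y * Suc Y" by blast
    then show ?case
      by (intro exI[of _ "if Suc M = Suc Y * Suc Y then Suc Y else Y"]) auto
  qed simp
  then obtain Y where le: "Y * Y \<le> M" and less: "M < Suc Y * Suc Y" by blast
  have "3 \<le> Y"
  proof (rule ccontr)
    assume "\<not> 3 \<le> Y"
    then have "Suc Y * Suc Y \<le> 3 * 3" by (intro mult_mono) auto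
    then show False using less assms by linarith
  qed
  then show ?thesis
    using le less
    by (intro exI[of _ "if M \<le> Y * Y + Y then Y else Suc Y"]) (auto simp: near_square_def)
qed

lemma scale_digit_real:
  assumes f: "range f \<subseteq> {0, 1, 2}"
  shows "\<exists>M. 2 ^ n * (of_int m + real_of_digits f) = of_int M + real_of_digits (\<lambda>i. f (i + n))"
proof (induction n)
  case (Suc n)
  then obtain M where M: "2 ^ n * (of_int m + real_of_digits f) = of_int M + real_of_digits (\<lambda>i. f (i + n))"
    by blast
  have "real_of_digits (\<lambda>i. f (i + n)) = (real (f n) - 1) / 2 + real_of_digits (\<lambda>i. f (i + Suc n)) / 2"
    using real_of_digits_split[OF range_shift[OF f, of n], of 1] by (simp add: add.commute)
  then have "2 ^ Suc n * (of_int m + real_of_digits f)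
      = of_int (2 * M + int (f n) - 1) + real_of_digits (\<lambda>i. f (i + Suc n))"
    using M by (simp add: field_simps)
  then show ?case by blast
qed auto

text \<open>
  Multiplication by a power of four makes x large enough to have an approximate root that is
  at least 3 without changing whether it is a square, and shifts the digits by an even
  amount. The digits of the root of the scaled number are those defined above.
\<close>

theorem positive_times_square:
  assumes root: "\<And>f c M Y. f \<in> C \<Longrightarrow> range f \<subseteq> {0, 1, 2} \<Longrightarrow> near_square M Y \<Longrightarrow>
      root_digit (\<lambda>i. f (i + c)) M Y \<in> C"
    and one: "(\<lambda>_. 1) \<in> C"
    and x: "x \<in> digit_reals C" "0 < x"
  shows "\<exists>z\<in>digit_reals C. \<exists>w\<in>digit_reals C. z \<noteq> 0 \<and> x * (z * z) = w * w"
proof -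
  obtain m f where f: "f \<in> C" "range f \<subseteq> {0, 1, 2}" "x = of_int m + real_of_digits f"
    using x(1) unfolding digit_reals_def by blast
  obtain N where N: "11 / x < (2::real) ^ N" using real_arch_pow[of 2 "11 / x"] by auto
  then have "11 < 2 ^ N * x" using x(2) by (simp add: field_simps)
  also have "2 ^ N * x \<le> 2 ^ N * (2 ^ N * x)" using x(2) by simp
  also have "\<dots> = 2 ^ (2 * N) * x" by (simp add: power_add mult_2 mult.assoc)
  finally have large: "11 < 2 ^ (2 * N) * x" .
  obtain M where M: "2 ^ (2 * N) * x = of_int M + real_of_digits (\<lambda>i. f (i + 2 * N))"
    using scale_digit_real[OF f(2)] f(3) by metis
  let ?d = "\<lambda>i. f (i + 2 * N)"
  have d: "range ?d \<subseteq> {0, 1, 2}" by (rule range_shift[OF f(2)])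
  have "10 \<le> M" using large M abs_real_of_digits_le[OF d] by linarith
  then have "9 \<le> nat M" by linarith
  then obtain Y where Y: "near_square (nat M) Y" using ex_near_square by blast
  define w where "w = of_int (int Y) + real_of_digits (root_digit ?d (nat M) Y)"
  have "w \<in> digit_reals C"
    unfolding w_def digit_reals_def using root[OF f(1,2) Y] root_digit_range[OF Y d] by blast
  moreover have "of_int (2 ^ N) + real_of_digits (\<lambda>_. 1) \<in> digit_reals C"
    unfolding digit_reals_def using one by force
  then have "2 ^ N \<in> digit_reals C" by (simp add: real_of_digits_def)
  moreover have "x * (2 ^ N * 2 ^ N) = w * w"
  proof -
    have "real (nat M) = of_int M" using \<open>10 \<le> M\<close> by simp
    then have "w * w = 2 ^ (2 * N) * x"
      using root_digits[OF Y d] unfolding M w_def power2_eq_square by simp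
    moreover have "(2::real) ^ (2 * N) = 2 ^ N * 2 ^ N" by (simp only: mult_2 power_add)
    ultimately show ?thesis by (simp only: mult.commute)
  qed
  ultimately show ?thesis by (metis power_not_zero zero_neq_numeral)
qed

section \<open>The Grzegorczyk classes from index three on\<close>

text \<open>
  The generator with index 2 dominates the powers of two and bounds their recursive
  definition.
\<close>

lemma grz_power2:
  assumes n: "3 \<le> n" and a: "grz n k a"
  shows "grz n k (\<lambda>xs. 2 ^ a xs)"
proof -
  have gen: "2 ^ m \<le> grz_gen 1 m" for m
  proof (induction m)
    case (Suc m)
    have "2 * x \<le> x\<^sup>2 + 2" for x :: nat
    proof (cases "2 \<le> x")
      case True
      then have "2 * x \<le> x * x" by (rule mult_right_mono) simp
      then show ?thesis unfolding power2_eq_square by linarith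
    next
      case False
      then have "x = 0 \<or> x = 1" by linarith
      then show ?thesis by auto
    qed
    from this[of "grz_gen 1 m"] Suc show ?case by simp
  qed simp
  have "grz n 1 (\<lambda>xs. rec_nat 1 (\<lambda>y r. (y # r # xs) ! 1 + (y # r # xs) ! 1) (xs ! 0))"
  proof (rule grz_rec[where b = "\<lambda>us. grz_gen 1 (us ! 0)"])
    show "grz n (1 + 1) (\<lambda>us. grz_gen 1 (us ! 0))"
      by (rule grz.fn_app1[where p = "grz_gen 1"], rule grz.fnI, rule grzegorczyk.gen)
        (use n in \<open>auto intro: grz.fn_proj\<close>)
    show "rec_nat 1 (\<lambda>y r. (y # r # xs) ! 1 + (y # r # xs) ! 1) m \<le> grz_gen 1 ((m # xs) ! 0)" for m and xs :: "nat list"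
    proof -
      have "rec_nat 1 (\<lambda>y r. r + r) m = (2::nat) ^ m" by (induction m) auto
      then show ?thesis using gen[of m] by simp
    qed
  qed (use n in \<open>auto intro!: grz_add grz.fn_proj grz.fn_const\<close>)
  moreover have "rec_nat 1 (\<lambda>y r. r + r) m = (2::nat) ^ m" for m by (induction m) auto
  ultimately have "grz n 1 (\<lambda>xs. 2 ^ (xs ! 0))" by simp
  then show ?thesis using a by (rule grz.fn_app1)
qed

lemma scaled_le:
  assumes "range d \<subseteq> {0, 1, 2}" shows "scaled d M n \<le> Suc M * (2 ^ n * 2 ^ n)"
proof -
  have "scaled d M n + 1 \<le> Suc M * (2 ^ n * 2 ^ n)"
  proof (induction n)
    case (Suc n)
    have "d i \<le> 2" for i
    proof -
      have "d i \<in> {0, 1, 2}" using assms(1) by (rule subsetD) (rule rangeI)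
      then show ?thesis by auto
    qed
    from this[of "2 * n"] this[of "2 * n + 1"]
    have "scaled d M (Suc n) + 1 \<le> 4 * (scaled d M n + 1)" by simp
    also have "\<dots> \<le> 4 * (Suc M * (2 ^ n * 2 ^ n))" using Suc by (intro mult_left_mono) auto
    finally show ?case by (simp add: algebra_simps)
  qed simp
  then show ?thesis by simp
qed

lemma root_le: "root d M Y n \<le> Suc Y * 2 ^ n"
proof -
  have "root d M Y n + 1 \<le> Suc Y * 2 ^ n"
  proof (induction n)
    case (Suc n)
    have "root_step Z y + 1 \<le> 2 * (y + 1)" for Z y by (auto simp: root_step_def)
    then have "root d M Y (Suc n) + 1 \<le> 2 * (root d M Y n + 1)" unfolding root_simps .
    also have "\<dots> \<le> 2 * (Suc Y * 2 ^ n)" using Suc by (intro mult_left_mono) auto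
    finally show ?case by simp
  qed simp
  then show ?thesis by simp
qed

text \<open>
  Both the scaled radicand and its approximate root are natural numbers of exponential size,
  so from index three on the class contains them directly by bounded recursion.
\<close>

lemma grz_root_digit:
  assumes n: "3 \<le> n" and f: "f \<in> grzegorczyk_unary n" and d: "range f \<subseteq> {0, 1, 2}"
  shows "root_digit (\<lambda>i. f (i + c)) M Y \<in> grzegorczyk_unary n"
proof -
  let ?d = "\<lambda>i. f (i + c)"
  have n': "0 < n" "2 \<le> n" using n by auto
  have "grz n 1 (\<lambda>xs. f (xs ! 0))"
    using f unfolding grzegorczyk_unary_iff .
  then have gf: "grz n k (\<lambda>xs. f (a xs))" if "grz n k a" for k a
    using that by (rule grz.fn_app1)
  have gd: "grz n k (\<lambda>xs. ?d (a xs))" if "grz n k a" for k a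
    by (intro gf grz_add grz.fn_const that n')
  have "grz n 1 (\<lambda>xs. rec_nat M (\<lambda>y r. (\<lambda>us. 4 * us ! 1 + (2 * ?d (2 * us ! 0) + ?d (2 * us ! 0 + 1)) - 3)
      (y # r # xs)) (xs ! 0))"
  proof (rule grz_rec[where b = "\<lambda>us. Suc M * (2 ^ (us ! 0) * 2 ^ (us ! 0))"])
    show "grz n (1 + 2) (\<lambda>us. 4 * us ! 1 + (2 * ?d (2 * us ! 0) + ?d (2 * us ! 0 + 1)) - 3)"
      by (intro grz_diff grz_add grz_mult gd grz.fn_const grz.fn_proj n') auto
    show "grz n (1 + 1) (\<lambda>us. Suc M * (2 ^ (us ! 0) * 2 ^ (us ! 0)))"
      by (intro grz_mult grz_power2 grz.fn_const grz.fn_proj n n') auto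
    show "rec_nat M (\<lambda>y r. (\<lambda>us. 4 * us ! 1 + (2 * ?d (2 * us ! 0) + ?d (2 * us ! 0 + 1)) - 3)
      (y # r # xs)) m \<le> Suc M * (2 ^ ((m # xs) ! 0) * 2 ^ ((m # xs) ! 0))" for m and xs :: "nat list"
      using scaled_le[OF range_shift[OF d, of c], of M m] by (simp add: scaled_def)
  qed (auto intro: grz.fn_const grz.fn_proj)
  then have "grz n 1 (\<lambda>xs. scaled ?d M (xs ! 0))" by (simp add: scaled_def)
  then have gZ: "grz n k (\<lambda>xs. scaled ?d M (a xs))" if "grz n k a" for k a
    using that by (rule grz.fn_app1)
  have step: "grz n k (\<lambda>xs. root_step (z xs) (y xs))" if "grz n k z" "grz n k y" for k z y
    unfolding root_step_def
    by (intro grz_if_less grz_add grz_diff grz_mult grz.fn_const that n')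
  have "grz n 1 (\<lambda>xs. rec_nat Y (\<lambda>y r. (\<lambda>us. root_step (scaled ?d M (Suc (us ! 0))) (us ! 1))
      (y # r # xs)) (xs ! 0))"
  proof (rule grz_rec[where b = "\<lambda>us. Suc Y * 2 ^ (us ! 0)"])
    show "grz n (1 + 2) (\<lambda>us. root_step (scaled ?d M (Suc (us ! 0))) (us ! 1))"
      by (intro step gZ grz.fn_Suc grz.fn_proj) auto
    show "grz n (1 + 1) (\<lambda>us. Suc Y * 2 ^ (us ! 0))"
      by (intro grz_mult grz_power2 grz.fn_const grz.fn_proj n n') auto
    show "rec_nat Y (\<lambda>y r. (\<lambda>us. root_step (scaled ?d M (Suc (us ! 0))) (us ! 1))
      (y # r # xs)) m \<le> Suc Y * 2 ^ ((m # xs) ! 0)" for m and xs :: "nat list"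
      using root_le[of ?d M Y m] by (simp add: root_def)
  qed (auto intro: grz.fn_const grz.fn_proj)
  then have "grz n 1 (\<lambda>xs. root ?d M Y (xs ! 0))" by (simp add: root_def)
  then have gY: "grz n k (\<lambda>xs. root ?d M Y (a xs))" if "grz n k a" for k a
    using that by (rule grz.fn_app1)
  show ?thesis
    unfolding root_digit_def grzegorczyk_unary_iff
    by (intro grz_diff grz_add grz_mult gY grz.fn_Suc grz.fn_const grz.fn_proj n') auto
qed

theorem no_computable_copy_E_numbers:
  assumes n: "3 \<le> n" shows "\<not> computable_copy (E_numbers n) \<nu>"
  unfolding E_numbers_def
proof (rule no_computable_copy)
  show "digit_reals (grzegorczyk_unary 2) \<subseteq> digit_reals (grzegorczyk_unary n)"
  proof -
    have "grzegorczyk_unary 2 \<subseteq> grzegorczyk_unary n"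
      unfolding grzegorczyk_unary_def using grz_mono[of 2 _ _ n] n by auto
    then show ?thesis unfolding digit_reals_def by blast
  qed
  have one: "(\<lambda>_. 1) \<in> grzegorczyk_unary n"
    unfolding grzegorczyk_unary_iff by (rule grz.fn_const)
  show "\<exists>z\<in>digit_reals (grzegorczyk_unary n). \<exists>w\<in>digit_reals (grzegorczyk_unary n). z \<noteq> 0 \<and> x * (z * z) = w * w"
    if "x \<in> digit_reals (grzegorczyk_unary n)" "0 < x" for x
    by (rule positive_times_square[OF grz_root_digit[OF n] one that])
qed

section \<open>Structured programs for Turing machines\<close>

type_synonym tape_file = "nat \<Rightarrow> tape"

text \<open>
  A program acts on infinitely many tapes, of which it touches finitely many; thus programs
  compose without renaming or counting tapes. The number of tapes and symbols is chosen only
  when a program is turned into a machine.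
\<close>

datatype com =
    Act "(nat \<Rightarrow> nat) \<Rightarrow> nat \<Rightarrow> nat \<times> move"
  | Seq com com
  | Cond nat "nat set" com com
  | While nat "nat set" com

definition reads :: "tape_file \<Rightarrow> nat \<Rightarrow> nat" where
  "reads ts = (\<lambda>i. read_tape (ts i))"

inductive exec :: "com \<Rightarrow> tape_file \<Rightarrow> nat \<Rightarrow> tape_file \<Rightarrow> bool" where
  Act: "exec (Act f) ts 1 (\<lambda>i. act_tape (f (reads ts) i) (ts i))"
| Seq: "exec c ts a ts' \<Longrightarrow> exec d ts' b ts'' \<Longrightarrow> exec (Seq c d) ts (a + b) ts''"
| CondT: "reads ts r \<in> A \<Longrightarrow> exec c ts a ts' \<Longrightarrow> exec (Cond r A c d) ts (Suc a) ts'"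
| CondF: "reads ts r \<notin> A \<Longrightarrow> exec d ts a ts' \<Longrightarrow> exec (Cond r A c d) ts (Suc a) ts'"
| WhileF: "reads ts r \<notin> A \<Longrightarrow> exec (While r A c) ts 1 ts"
| WhileT: "reads ts r \<in> A \<Longrightarrow> exec c ts a ts' \<Longrightarrow> exec (While r A c) ts' b ts'' \<Longrightarrow>
    exec (While r A c) ts (Suc (a + b)) ts''"

text \<open>
  An action may depend on and change only the tapes below K. It may only write symbols below
  each bound from S on that bounds the symbols present; this form is stable under increasing
  S and allows actions that copy symbols.
\<close>

primrec fits :: "nat \<Rightarrow> nat \<Rightarrow> com \<Rightarrow> bool" where
  "fits K S (Act f) \<longleftrightarrow> (\<forall>a. \<forall>i\<ge>K. f a i = (a i, Stay)) \<and>
     (\<forall>a b. (\<forall>i<K. a i = b i) \<longrightarrow> (\<forall>i<K. f a i = f b i)) \<and>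
     (\<forall>S'\<ge>S. \<forall>a. (\<forall>i. a i < S') \<longrightarrow> (\<forall>i. fst (f a i) < S'))"
| "fits K S (Seq c d) \<longleftrightarrow> fits K S c \<and> fits K S d"
| "fits K S (Cond r A c d) \<longleftrightarrow> r < K \<and> fits K S c \<and> fits K S d"
| "fits K S (While r A c) \<longleftrightarrow> r < K \<and> fits K S c"

lemma fits_mono: "fits K S c \<Longrightarrow> K \<le> K' \<Longrightarrow> S \<le> S' \<Longrightarrow> fits K' S' c"
proof (induction c)
  case (Act f)
  have f1: "f a i = (a i, Stay)" if "K \<le> i" for a i using Act.prems that by simp
  have f2: "f a i = f b i" if "\<forall>i<K. a i = b i" "i < K" for a b i using Act.prems that by simp
  have f3: "fst (f a i) < T" if "S \<le> T" "\<forall>i. a i < T" for T a i using Act.prems that by simp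
  have "f a i = f b i" if "\<forall>i<K'. a i = b i" "i < K'" for a b i
  proof (cases "i < K")
    case True
    then show ?thesis using f2[of a b i] that Act.prems(2) by simp
  next
    case False
    then show ?thesis using f1 that by simp
  qed
  then show ?case using f1 f3 Act.prems by simp
qed auto

primrec csize :: "com \<Rightarrow> nat" where
  "csize (Act f) = 1"
| "csize (Seq c d) = csize c + csize d"
| "csize (Cond r A c d) = Suc (csize c + csize d)"
| "csize (While r A c) = Suc (csize c)"

lemma csize_pos: "0 < csize c"
  by (induction c) auto

definition of_list :: "nat list \<Rightarrow> nat \<Rightarrow> nat" where
  "of_list as i = (if i < length as then as ! i else 0)"

definition stay :: "nat list \<Rightarrow> (nat \<times> move) list" where
  "stay as = map (\<lambda>a. (a, Stay)) as"

text \<open>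
  The code of c occupies the states from q on, q is its entry, and e is the state to be
  entered afterwards.
\<close>

primrec delta_of :: "com \<Rightarrow> nat \<Rightarrow> nat \<Rightarrow> nat \<Rightarrow> nat list \<Rightarrow> nat \<times> (nat \<times> move) list" where
  "delta_of (Act f) q e s as = (e, map (f (of_list as)) [0..<length as])"
| "delta_of (Seq c d) q e s as = (if s < q + csize c then delta_of c q (q + csize c) s as
     else delta_of d (q + csize c) e s as)"
| "delta_of (Cond r A c d) q e s as = (if s = q then (if of_list as r \<in> A then q + 1 else q + 1 + csize c, stay as)
     else if s < q + 1 + csize c then delta_of c (q + 1) e s as
     else delta_of d (q + 1 + csize c) e s as)"
| "delta_of (While r A c) q e s as = (if s = q then (if of_list as r \<in> A then q + 1 else e, stay as)
     else delta_of c (q + 1) q s as)"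

definition machine :: "nat \<Rightarrow> nat \<Rightarrow> com \<Rightarrow> tm" where
  "machine K S c = \<lparr>tapes = K, states = Suc (csize c), symbols = S, start_state = 0,
     halt_state = csize c, delta = delta_of c 0 (csize c)\<rparr>"

definition tape_list :: "nat \<Rightarrow> tape_file \<Rightarrow> tape list" where
  "tape_list K ts = map ts [0..<K]"

lemma of_list_tape_list: "i < K \<Longrightarrow> of_list (map read_tape (tape_list K ts)) i = reads ts i"
  by (simp add: of_list_def tape_list_def reads_def)

lemma act_tape_stay: "act_tape (read_tape t, Stay) t = t"
  by (cases t) simp

lemma map2_stay: "map2 act_tape (stay (map read_tape ts)) ts = ts"
  by (induction ts) (auto simp: stay_def act_tape_stay)

text \<open>
  Each test takes one step, in which the tapes are left as they are, so machine and program
  take exactly the same time.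
\<close>

lemma exec_trans:
  assumes "exec c ts t ts'" "fits K S c" "q + csize c \<le> halt_state M \<or> halt_state M < q"
    and "\<And>s as. q \<le> s \<Longrightarrow> s < q + csize c \<Longrightarrow> delta M s as = delta_of c q e s as"
  shows "(step M ^^ t) (q, tape_list K ts) = (e, tape_list K ts')"
  using assms
proof (induction arbitrary: q e)
  case (Act f ts)
  have q: "q \<noteq> halt_state M" using Act.prems(2) by auto
  have len: "length (tape_list K ts) = K" by (simp add: tape_list_def)
  have f: "f (of_list (map read_tape (tape_list K ts))) i = f (reads ts) i" if "i < K" for i
  proof -
    have "\<forall>i<K. of_list (map read_tape (tape_list K ts)) i = reads ts i" by (simp add: of_list_tape_list)
    then show ?thesis using Act.prems(1) that unfolding fits.simps by blast
  qed
  have eq: "map2 act_tape (map (f (of_list (map read_tape (tape_list K ts)))) [0..<K]) (tape_list K ts)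
      = tape_list K (\<lambda>i. act_tape (f (reads ts) i) (ts i))"
    by (rule nth_equalityI) (simp_all add: f len, simp_all add: tape_list_def)
  have "delta M q (map read_tape (tape_list K ts)) = delta_of (Act f) q e q (map read_tape (tape_list K ts))"
    by (rule Act.prems(3)) simp_all
  then show ?case using q eq len by (simp add: step_def)
next
  case (Seq c ts a ts' d b ts'')
  have 1: "(step M ^^ a) (q, tape_list K ts) = (q + csize c, tape_list K ts')"
  proof (rule Seq.IH(1))
    show "delta M s as = delta_of c q (q + csize c) s as" if "q \<le> s" "s < q + csize c" for s as
      using Seq.prems(3)[of s as] that by simp
  qed (use Seq.prems(1,2) in auto)
  have 2: "(step M ^^ b) (q + csize c, tape_list K ts') = (e, tape_list K ts'')"
  proof (rule Seq.IH(2))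
    show "delta M s as = delta_of d (q + csize c) e s as" if "q + csize c \<le> s" "s < q + csize c + csize d" for s as
      using Seq.prems(3)[of s as] that by simp
  qed (use Seq.prems(1,2) in auto)
  show ?case using 1 2 by (simp add: funpow_add add.commute[of a])
next
  case (CondT ts r A c a ts' d)
  have 1: "(step M ^^ a) (q + 1, tape_list K ts) = (e, tape_list K ts')"
  proof (rule CondT.IH)
    show "delta M s as = delta_of c (q + 1) e s as" if "q + 1 \<le> s" "s < q + 1 + csize c" for s as
      using CondT.prems(3)[of s as] that by simp
  qed (use CondT.prems(1,2) in auto)
  have "q \<noteq> halt_state M" "r < K" using CondT.prems(1,2) by auto
  then have "step M (q, tape_list K ts) = (q + 1, tape_list K ts)"
    using CondT.prems(3)[of q "map read_tape (tape_list K ts)"] CondT.hyps(1)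
    by (simp add: step_def of_list_tape_list map2_stay)
  then show ?case using 1 by (simp add: funpow_Suc_right del: funpow.simps)
next
  case (CondF ts r A d a ts' c)
  have 1: "(step M ^^ a) (q + 1 + csize c, tape_list K ts) = (e, tape_list K ts')"
  proof (rule CondF.IH)
    show "delta M s as = delta_of d (q + 1 + csize c) e s as"
      if "q + 1 + csize c \<le> s" "s < q + 1 + csize c + csize d" for s as
      using CondF.prems(3)[of s as] that by simp
  qed (use CondF.prems(1,2) in auto)
  have "q \<noteq> halt_state M" "r < K" using CondF.prems(1,2) by auto
  then have "step M (q, tape_list K ts) = (q + 1 + csize c, tape_list K ts)"
    using CondF.prems(3)[of q "map read_tape (tape_list K ts)"] CondF.hyps(1)
    by (simp add: step_def of_list_tape_list map2_stay)
  then show ?case using 1 by (simp add: funpow_Suc_right del: funpow.simps)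
next
  case (WhileF ts r A c)
  have "q \<noteq> halt_state M" "r < K" using WhileF.prems(1,2) by auto
  then show ?case
    using WhileF.prems(3)[of q "map read_tape (tape_list K ts)"] WhileF.hyps(1)
    by (simp add: step_def of_list_tape_list map2_stay)
next
  case (WhileT ts r A c a ts' b ts'')
  have 1: "(step M ^^ a) (q + 1, tape_list K ts) = (q, tape_list K ts')"
  proof (rule WhileT.IH(1))
    show "delta M s as = delta_of c (q + 1) q s as" if "q + 1 \<le> s" "s < q + 1 + csize c" for s as
      using WhileT.prems(3)[of s as] that by simp
  qed (use WhileT.prems(1,2) in auto)
  have 2: "(step M ^^ b) (q, tape_list K ts') = (e, tape_list K ts'')"
    by (rule WhileT.IH(2)[OF WhileT.prems])
  have "q \<noteq> halt_state M" "r < K" using WhileT.prems(1,2) by auto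
  then have 3: "step M (q, tape_list K ts) = (q + 1, tape_list K ts)"
    using WhileT.prems(3)[of q "map read_tape (tape_list K ts)"] WhileT.hyps(1)
    by (simp add: step_def of_list_tape_list map2_stay)
  have "(step M ^^ Suc (a + b)) (q, tape_list K ts) = (step M ^^ b) ((step M ^^ a) (step M (q, tape_list K ts)))"
    by (simp add: funpow_add add.commute[of a] funpow_Suc_right del: funpow.simps)
  then show ?case using 1 2 3 by simp
qed

lemma trans_target: "q \<le> s \<Longrightarrow> s < q + csize c \<Longrightarrow> e < n \<Longrightarrow> q + csize c \<le> n \<Longrightarrow> fst (delta_of c q e s as) < n"
proof (induction c arbitrary: q e)
  case (Seq c d)
  then show ?case using csize_pos[of d] by (auto split: if_splits)
next
  case (Cond r A c d)
  then show ?case using csize_pos[of c] csize_pos[of d] by auto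
next
  case (While r A c)
  then show ?case using csize_pos[of c] by auto
qed auto

lemma trans_length: "length (snd (delta_of c q e s as)) = length as"
  by (induction c arbitrary: q e) (auto simp: stay_def)

lemma trans_symbols:
  assumes "fits K S c" "set as \<subseteq> {..<S}" "0 < S"
  shows "fst ` set (snd (delta_of c q e s as)) \<subseteq> {..<S}"
  using assms(1)
proof (induction c arbitrary: q e)
  case (Act f)
  have "of_list as i < S" for i using assms(2,3) by (auto simp: of_list_def subset_iff)
  then have "fst (f (of_list as) i) < S" for i using Act by simp
  then show ?case by auto
qed (use assms(2) in \<open>auto simp: stay_def\<close>)

lemma wf_machine:
  assumes "fits K S c" "0 < K" "3 \<le> S" shows "wf_tm (machine K S c)"
proof -
  have "fst (delta_of c 0 (csize c) s as) < Suc (csize c)" if "s < Suc (csize c)" for s as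
  proof (cases "s < csize c")
    case True
    then show ?thesis by (intro trans_target) auto
  next
    case False
    have "fst (delta_of c q e s as) < n" if "q + csize c = s" "e < n" "q + csize c < n" for q e n
      using that
    proof (induction c arbitrary: q e)
      case (While r A c)
      then show ?case using csize_pos[of c] by (auto)
    qed auto
    from this[of 0 "csize c" "Suc (csize c)"] show ?thesis using False that by simp
  qed
  then have "case delta_of c 0 (csize c) s as of (q', acts) \<Rightarrow>
      q' < Suc (csize c) \<and> length acts = K \<and> fst ` set acts \<subseteq> {..<S}"
    if "s < Suc (csize c)" "length as = K" "set as \<subseteq> {..<S}" for s as
  proof -
    have "0 < S" using assms(3) by simp
    note sym = trans_symbols[OF assms(1) that(3) this, of 0 "csize c" s]
    obtain q' acts where eq: "delta_of c 0 (csize c) s as = (q', acts)" by (meson surj_pair)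
    have "q' < Suc (csize c)"
      using \<open>\<And>s as. s < Suc (csize c) \<Longrightarrow> fst (delta_of c 0 (csize c) s as) < Suc (csize c)\<close>[OF that(1), of as]
      by (simp add: eq)
    moreover have "length acts = K"
      using trans_length[of c 0 "csize c" s as] that(2) by (simp add: eq)
    moreover have "fst ` set acts \<subseteq> {..<S}" using sym by (simp add: eq)
    ultimately show ?thesis by (simp add: eq)
  qed
  then show ?thesis
    using assms(2,3) by (simp add: wf_tm_def machine_def)
qed

lemma machine_run:
  assumes "exec c ts t ts'" "fits K S c"
  shows "(step (machine K S c) ^^ t) (start_state (machine K S c), tape_list K ts)
    = (halt_state (machine K S c), tape_list K ts')"
proof -
  have "(step (machine K S c) ^^ t) (0, tape_list K ts) = (csize c, tape_list K ts')"
    by (rule exec_trans[OF assms]) (simp_all add: machine_def)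
  then show ?thesis by (simp add: machine_def)
qed

text \<open>
  A family of monotone bounds with one parameter that is cofinal in all polynomials with
  natural coefficients.
\<close>

definition poly_bounded :: "(nat \<Rightarrow> nat) \<Rightarrow> bool" where
  "poly_bounded f \<longleftrightarrow> (\<exists>d. \<forall>n. f n \<le> (n + d) ^ d)"

lemma poly_bounded_le: "poly_bounded f \<Longrightarrow> (\<And>n. g n \<le> f n) \<Longrightarrow> poly_bounded g"
proof -
  assume "poly_bounded f" and le: "\<And>n. g n \<le> f n"
  then obtain d where "\<And>n. f n \<le> (n + d) ^ d" unfolding poly_bounded_def by blast
  then have "g n \<le> (n + d) ^ d" for n using le order_trans by blast
  then show "poly_bounded g" unfolding poly_bounded_def by blast
qed

lemma poly_bounded_const: "poly_bounded (\<lambda>_. c)"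
  unfolding poly_bounded_def
proof (intro exI allI)
  fix n
  have "c \<le> (n + Suc c) ^ 1" by simp
  also have "\<dots> \<le> (n + Suc c) ^ Suc c" by (rule power_increasing) auto
  finally show "c \<le> (n + Suc c) ^ Suc c" .
qed

lemma poly_bounded_id: "poly_bounded (\<lambda>n. n)"
  unfolding poly_bounded_def by (rule exI[of _ 1]) simp

lemma poly_bounded_mult:
  assumes "poly_bounded f" "poly_bounded g" shows "poly_bounded (\<lambda>n. f n * g n)"
proof -
  obtain a b where a: "\<And>n. f n \<le> (n + a) ^ a" and b: "\<And>n. g n \<le> (n + b) ^ b"
    using assms unfolding poly_bounded_def by blast
  have "f n * g n \<le> (n + (a + b)) ^ (a + b)" for n
  proof -
    have "f n * g n \<le> (n + a) ^ a * (n + b) ^ b" using a b by (rule mult_mono) auto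
    also have "\<dots> \<le> (n + (a + b)) ^ a * (n + (a + b)) ^ b"
      by (intro mult_mono power_mono) auto
    finally show ?thesis by (simp add: power_add)
  qed
  then show ?thesis unfolding poly_bounded_def by blast
qed

lemma poly_bounded_add:
  assumes "poly_bounded f" "poly_bounded g" shows "poly_bounded (\<lambda>n. f n + g n)"
proof -
  have "poly_bounded (\<lambda>n. 2 * ((f n + 1) * (g n + 1)))" if "poly_bounded (\<lambda>n. f n + 1)" "poly_bounded (\<lambda>n. g n + 1)"
    by (intro poly_bounded_mult poly_bounded_const that)
  moreover have "poly_bounded (\<lambda>n. f n + 1)" if f: "poly_bounded f" for f
  proof -
    obtain a where a: "\<And>n. f n \<le> (n + a) ^ a" using f unfolding poly_bounded_def by blast
    have "f n + 1 \<le> (n + (a + 2)) ^ (a + 2)" for n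
    proof -
      have "f n \<le> (n + (a + 2)) ^ a" using a[of n] power_mono[of "n + a" "n + (a + 2)" a] by simp
      moreover have "1 \<le> (n + (a + 2)) ^ a" by simp
      ultimately have "f n + 1 \<le> 2 * (n + (a + 2)) ^ a" by linarith
      also have "\<dots> \<le> (n + (a + 2)) * (n + (a + 2)) ^ a" by (rule mult_right_mono) auto
      also have "\<dots> = (n + (a + 2)) ^ Suc a" by simp
      also have "\<dots> \<le> (n + (a + 2)) ^ (a + 2)" by (rule power_increasing) auto
      finally show ?thesis .
    qed
    then show ?thesis unfolding poly_bounded_def by blast
  qed
  ultimately have "poly_bounded (\<lambda>n. 2 * ((f n + 1) * (g n + 1)))" using assms by blast
  then show ?thesis by (rule poly_bounded_le) simp
qed

lemma poly_bounded_power: "poly_bounded f \<Longrightarrow> poly_bounded (\<lambda>n. f n ^ d)"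
  by (induction d) (auto intro: poly_bounded_mult poly_bounded_const[of 1, simplified])

lemma poly_bounded_poly: "poly_bounded (poly p)"
proof (induction p)
  case 0
  show ?case using poly_bounded_const[of 0] by simp
next
  case (pCons a p)
  have "poly_bounded (\<lambda>n. a + n * poly p n)" by (intro poly_bounded_add poly_bounded_mult poly_bounded_const poly_bounded_id pCons)
  then show ?case by simp
qed

section \<open>Stacks on tapes\<close>

type_synonym stacks = "nat \<Rightarrow> nat list"

text \<open>
  The top is under the head and the rest extends to the right. In this orientation the input
  of a machine is a stack whose top is the most significant digit, and a stack is read off as
  the result.
\<close>

definition is_stack :: "tape \<Rightarrow> nat list \<Rightarrow> bool" where
  "is_stack t xs \<longleftrightarrow> 0 \<notin> set xs \<and>
     (\<forall>z. snd t z = (if fst t \<le> z \<and> z < fst t + int (length xs) then xs ! nat (z - fst t) else 0))"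

definition represents :: "tape_file \<Rightarrow> stacks \<Rightarrow> bool" where
  "represents ts \<sigma> \<longleftrightarrow> (\<forall>r. is_stack (ts r) (\<sigma> r))"

definition top_symbol :: "nat list \<Rightarrow> nat" where
  "top_symbol xs = (case xs of [] \<Rightarrow> 0 | x # _ \<Rightarrow> x)"

lemma top_symbol_simps [simp]: "top_symbol [] = 0" "top_symbol (x # xs) = x"
  by (simp_all add: top_symbol_def)

definition size_upto :: "nat \<Rightarrow> stacks \<Rightarrow> nat" where
  "size_upto K \<sigma> = (\<Sum>r<K. length (\<sigma> r))"

lemma size_upto_mono: "K \<le> K' \<Longrightarrow> size_upto K \<sigma> \<le> size_upto K' \<sigma>"
  unfolding size_upto_def by (rule sum_mono2) auto

lemma length_le_size_upto: "r < K \<Longrightarrow> length (\<sigma> r) \<le> size_upto K \<sigma>"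
  unfolding size_upto_def by (rule member_le_sum) auto

lemma size_upto_le: "(\<And>r. length (\<sigma>' r) \<le> length (\<sigma> r) + b) \<Longrightarrow> size_upto K \<sigma>' \<le> size_upto K \<sigma> + K * b"
proof -
  assume "\<And>r. length (\<sigma>' r) \<le> length (\<sigma> r) + b"
  then have "(\<Sum>r<K. length (\<sigma>' r)) \<le> (\<Sum>r<K. length (\<sigma> r) + b)" by (intro sum_mono)
  then show ?thesis by (simp add: size_upto_def sum.distrib)
qed

lemma read_stack: "is_stack t xs \<Longrightarrow> read_tape t = top_symbol xs"
  by (cases t; cases xs) (auto simp: is_stack_def)

lemma is_stack_cells: "is_stack t xs \<Longrightarrow> {z. snd t z \<noteq> 0} = {fst t..<fst t + int (length xs)}"
proof -
  assume *: "is_stack t xs"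
  have "xs ! nat (z - fst t) \<noteq> 0" if "fst t \<le> z" "z < fst t + int (length xs)" for z
  proof -
    have "nat (z - fst t) < length xs" using that by linarith
    then have "xs ! nat (z - fst t) \<in> set xs" by (rule nth_mem)
    then show ?thesis using * by (metis is_stack_def)
  qed
  then show ?thesis using * by (auto simp: is_stack_def)
qed

lemma stack_push:
  assumes "is_stack t xs" "x \<noteq> 0"
  shows "is_stack (act_tape (x, Stay) (act_tape (read_tape t, MoveLeft) t)) (x # xs)"
proof (cases t)
  case (Pair p c)
  have "c z = (if p \<le> z \<and> z < p + int (length xs) then xs ! nat (z - p) else 0)" for z
    using assms(1) by (simp add: is_stack_def Pair)
  moreover have "nat (z - (p - 1)) = Suc (nat (z - p))" if "p \<le> z" for z
    using that by linarith
  ultimately show ?thesis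
    using assms by (auto simp: is_stack_def Pair nth_Cons')
qed

lemma stack_pop:
  assumes "is_stack t xs"
  shows "is_stack (act_tape (0, MoveRight) t) (tl xs)"
proof (cases t)
  case (Pair p c)
  have c: "c z = (if p \<le> z \<and> z < p + int (length xs) then xs ! nat (z - p) else 0)" for z
    using assms(1) by (simp add: is_stack_def Pair)
  show ?thesis
  proof (cases xs)
    case Nil
    then show ?thesis using c by (simp add: is_stack_def Pair)
  next
    case (Cons x ys)
    have "xs ! nat (z - p) = ys ! nat (z - (p + 1))" if "p + 1 \<le> z" for z
    proof -
      have "nat (z - p) = Suc (nat (z - (p + 1)))" using that by linarith
      then show ?thesis by (simp add: Cons)
    qed
    then show ?thesis using c assms by (auto simp: is_stack_def Pair Cons)
  qed
qed

lemma stack_set_top: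
  assumes "is_stack t xs" "xs \<noteq> []" "x \<noteq> 0"
  shows "is_stack (act_tape (x, Stay) t) (x # tl xs)"
proof (cases t)
  case (Pair p c)
  have c: "c z = (if p \<le> z \<and> z < p + int (length xs) then xs ! nat (z - p) else 0)" for z
    using assms(1) by (simp add: is_stack_def Pair)
  obtain y ys where xs: "xs = y # ys" using assms(2) by (cases xs) auto
  show ?thesis using assms(1,3) unfolding xs
    by (auto simp: is_stack_def Pair c nth_Cons' xs)
qed

text \<open>
  A step makes at most one further cell of each tape nonblank; so the running time bounds the
  growth of all stacks.
\<close>

lemma exec_cells:
  assumes "exec c ts t ts'"
  shows "finite {z. snd (ts r) z \<noteq> 0} \<Longrightarrow>
    finite {z. snd (ts' r) z \<noteq> 0} \<and> card {z. snd (ts' r) z \<noteq> 0} \<le> card {z. snd (ts r) z \<noteq> 0} + t"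
  using assms
proof (induction)
  case (Act f ts)
  have "{z. snd (act_tape x (ts r)) z \<noteq> 0} \<subseteq> insert (fst (ts r)) {z. snd (ts r) z \<noteq> 0}" for x
    by (cases "ts r"; cases x) auto
  from this[of "f (reads ts) r"] have sub: "{z. snd (act_tape (f (reads ts) r) (ts r)) z \<noteq> 0} \<subseteq> insert (fst (ts r)) {z. snd (ts r) z \<noteq> 0}" .
  have fin: "finite (insert (fst (ts r)) {z. snd (ts r) z \<noteq> 0})" using Act by simp
  have "card (insert (fst (ts r)) {z. snd (ts r) z \<noteq> 0}) \<le> card {z. snd (ts r) z \<noteq> 0} + 1"
    using Act by (simp add: card_insert_if)
  then show ?case using finite_subset[OF sub fin] card_mono[OF fin sub] by simp
qed auto

section \<open>Polynomial-time stack transformers\<close>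

definition runs :: "com \<Rightarrow> stacks \<Rightarrow> stacks \<Rightarrow> nat \<Rightarrow> bool" where
  "runs c \<sigma> \<sigma>' b \<longleftrightarrow> (\<forall>ts. represents ts \<sigma> \<longrightarrow> (\<exists>t ts'. t \<le> b \<and> exec c ts t ts' \<and> represents ts' \<sigma>'))"

text \<open>
  Programs are reasoned about as functions on stacks. The bound is polynomial in the total
  height of the stacks that the program can touch and in a parameter N, which counts the
  unary value of the input while it is only present as a numeral.
\<close>

definition polytime :: "(nat \<Rightarrow> stacks \<Rightarrow> bool) \<Rightarrow> (stacks \<Rightarrow> stacks) \<Rightarrow> bool" where
  "polytime I \<Phi> \<longleftrightarrow> (\<exists>c K S d. fits K S c \<and>
     (\<forall>N \<sigma>. I N \<sigma> \<longrightarrow> runs c \<sigma> (\<Phi> \<sigma>) ((N + size_upto K \<sigma> + d) ^ d)))"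

lemma runs_mono: "runs c \<sigma> \<sigma>' b \<Longrightarrow> b \<le> b' \<Longrightarrow> runs c \<sigma> \<sigma>' b'"
  unfolding runs_def by (elim all_forward imp_forward ex_forward conj_forward) auto

lemma runs_growth:
  assumes "runs c \<sigma> \<sigma>' b" "represents ts \<sigma>" shows "length (\<sigma>' r) \<le> length (\<sigma> r) + b"
proof -
  obtain t ts' where t: "t \<le> b" "exec c ts t ts'" "represents ts' \<sigma>'"
    using assms unfolding runs_def by blast
  have 1: "{z. snd (ts r) z \<noteq> 0} = {fst (ts r)..<fst (ts r) + int (length (\<sigma> r))}"
    using assms(2) by (intro is_stack_cells) (simp add: represents_def)
  have 2: "{z. snd (ts' r) z \<noteq> 0} = {fst (ts' r)..<fst (ts' r) + int (length (\<sigma>' r))}"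
    using t(3) by (intro is_stack_cells) (simp add: represents_def)
  have "finite {z. snd (ts r) z \<noteq> 0}" unfolding 1 by simp
  from conjunct2[OF exec_cells[OF t(2) this]] show ?thesis
    unfolding 1 2 using t(1) by simp
qed

lemma runs_Seq:
  assumes "runs c \<sigma> \<sigma>' a" "runs d \<sigma>' \<sigma>'' b" shows "runs (Seq c d) \<sigma> \<sigma>'' (a + b)"
  unfolding runs_def
proof (intro allI impI)
  fix ts assume "represents ts \<sigma>"
  then obtain t ts' where 1: "t \<le> a" "exec c ts t ts'" "represents ts' \<sigma>'"
    using assms(1) unfolding runs_def by blast
  then obtain u ts'' where 2: "u \<le> b" "exec d ts' u ts''" "represents ts'' \<sigma>''"
    using assms(2) unfolding runs_def by blast
  show "\<exists>t ts'. t \<le> a + b \<and> exec (Seq c d) ts t ts' \<and> represents ts' \<sigma>''"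
    using exec.Seq[OF 1(2) 2(2)] 1(1) 2(1,3) add_mono by blast
qed

lemma reads_represents: "represents ts \<sigma> \<Longrightarrow> reads ts = (\<lambda>i. top_symbol (\<sigma> i))"
  by (auto simp: reads_def represents_def read_stack)

lemma runs_Cond:
  assumes "top_symbol (\<sigma> r) \<in> A \<Longrightarrow> runs c \<sigma> \<sigma>' b" "top_symbol (\<sigma> r) \<notin> A \<Longrightarrow> runs d \<sigma> \<sigma>' b"
  shows "runs (Cond r A c d) \<sigma> \<sigma>' (Suc b)"
  unfolding runs_def
proof (intro allI impI)
  fix ts assume represents: "represents ts \<sigma>"
  show "\<exists>t ts'. t \<le> Suc b \<and> exec (Cond r A c d) ts t ts' \<and> represents ts' \<sigma>'"
  proof (cases "top_symbol (\<sigma> r) \<in> A")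
    case True
    then obtain t ts' where "t \<le> b" "exec c ts t ts'" "represents ts' \<sigma>'"
      using assms(1) represents unfolding runs_def by blast
    then show ?thesis using exec.CondT[of ts r A] True reads_represents[OF represents] by (metis Suc_le_mono)
  next
    case False
    then obtain t ts' where "t \<le> b" "exec d ts t ts'" "represents ts' \<sigma>'"
      using assms(2) represents unfolding runs_def by blast
    then show ?thesis using exec.CondF[of ts r A] False reads_represents[OF represents] by (metis Suc_le_mono)
  qed
qed

lemma runs_While:
  assumes "\<And>i. i < n \<Longrightarrow> top_symbol (s i r) \<in> A" "\<And>i. i < n \<Longrightarrow> runs c (s i) (s (Suc i)) b" "top_symbol (s n r) \<notin> A"
  shows "runs (While r A c) (s 0) (s n) (n * Suc b + 1)"
  using assms
proof (induction n arbitrary: s)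
  case 0
  show ?case unfolding runs_def
  proof (intro allI impI)
    fix ts assume represents: "represents ts (s 0)"
    then have "exec (While r A c) ts 1 ts" using 0(3) by (intro exec.WhileF) (simp add: reads_represents)
    then show "\<exists>t ts'. t \<le> 0 * Suc b + 1 \<and> exec (While r A c) ts t ts' \<and> represents ts' (s 0)"
      using represents by (intro exI[of _ 1] exI[of _ ts]) simp
  qed
next
  case (Suc n)
  have IH: "runs (While r A c) (s (Suc 0)) (s (Suc n)) (n * Suc b + 1)"
    by (rule Suc.IH[of "\<lambda>i. s (Suc i)"]) (use Suc.prems in simp_all)
  have first: "runs c (s 0) (s (Suc 0)) b" "top_symbol (s 0 r) \<in> A" using Suc.prems by simp_all
  show ?case unfolding runs_def
  proof (intro allI impI)
    fix ts assume represents: "represents ts (s 0)"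
    then obtain t ts' where 1: "t \<le> b" "exec c ts t ts'" "represents ts' (s (Suc 0))"
      using first(1) unfolding runs_def by blast
    then obtain u ts'' where 2: "u \<le> n * Suc b + 1" "exec (While r A c) ts' u ts''" "represents ts'' (s (Suc n))"
      using IH unfolding runs_def by blast
    have "exec (While r A c) ts (Suc (t + u)) ts''"
      using 1 2 represents first(2) by (intro exec.WhileT) (simp_all add: reads_represents)
    moreover have "Suc (t + u) \<le> Suc n * Suc b + 1" using 1(1) 2(1) by simp
    ultimately show "\<exists>t ts'. t \<le> Suc n * Suc b + 1 \<and> exec (While r A c) ts t ts' \<and> represents ts' (s (Suc n))"
      using 2(3) by blast
  qed
qed

lemma PTI:
  assumes fits: "fits K S c" and p: "poly_bounded p"
    and run: "\<And>N \<sigma> ts. I N \<sigma> \<Longrightarrow> represents ts \<sigma> \<Longrightarrow> runs c \<sigma> (\<Phi> \<sigma>) (p (N + size_upto K' \<sigma>))"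
  shows "polytime I \<Phi>"
proof -
  obtain d where d: "\<And>n. p n \<le> (n + d) ^ d" using p unfolding poly_bounded_def by blast
  have "runs c \<sigma> (\<Phi> \<sigma>) ((N + size_upto (max K K') \<sigma> + d) ^ d)" if I: "I N \<sigma>" for N \<sigma>
    unfolding runs_def
  proof (intro allI impI)
    fix ts assume represents: "represents ts \<sigma>"
    have "p (N + size_upto K' \<sigma>) \<le> (N + size_upto K' \<sigma> + d) ^ d" by (rule d)
    also have "\<dots> \<le> (N + size_upto (max K K') \<sigma> + d) ^ d"
      using size_upto_mono[of K' "max K K'" \<sigma>] by (intro power_mono) auto
    finally have "runs c \<sigma> (\<Phi> \<sigma>) ((N + size_upto (max K K') \<sigma> + d) ^ d)"
      using run[OF I represents] runs_mono by blast
    then show "\<exists>t ts'. t \<le> (N + size_upto (max K K') \<sigma> + d) ^ d \<and> exec c ts t ts' \<and> represents ts' (\<Phi> \<sigma>)"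
      using represents unfolding runs_def by blast
  qed
  moreover have "fits (max K K') S c" by (rule fits_mono[OF fits]) auto
  ultimately show ?thesis unfolding polytime_def by blast
qed

lemma polytime_weaken: "polytime I \<Phi> \<Longrightarrow> (\<And>N \<sigma>. J N \<sigma> \<Longrightarrow> I N \<sigma>) \<Longrightarrow> (\<And>N \<sigma>. J N \<sigma> \<Longrightarrow> \<Phi> \<sigma> = \<Psi> \<sigma>) \<Longrightarrow> polytime J \<Psi>"
proof -
  assume "polytime I \<Phi>" and J: "\<And>N \<sigma>. J N \<sigma> \<Longrightarrow> I N \<sigma>" "\<And>N \<sigma>. J N \<sigma> \<Longrightarrow> \<Phi> \<sigma> = \<Psi> \<sigma>"
  then obtain c K S d where *: "fits K S c"
     "\<And>N \<sigma>. I N \<sigma> \<Longrightarrow> runs c \<sigma> (\<Phi> \<sigma>) ((N + size_upto K \<sigma> + d) ^ d)"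
    unfolding polytime_def by blast
  have "runs c \<sigma> (\<Psi> \<sigma>) ((N + size_upto K \<sigma> + d) ^ d)" if "J N \<sigma>" for N \<sigma>
    using *(2)[OF J(1)[OF that]] J(2)[OF that] by simp
  then show "polytime J \<Psi>" using *(1) unfolding polytime_def by blast
qed

text \<open>
  The second program runs on stacks that are larger by at most the running time of the first.
\<close>

lemma polytime_seq:
  assumes "polytime I \<Phi>" "polytime J \<Psi>" and J: "\<And>N \<sigma>. I N \<sigma> \<Longrightarrow> J N (\<Phi> \<sigma>)" and eq: "\<And>N \<sigma>. I N \<sigma> \<Longrightarrow> \<Psi> (\<Phi> \<sigma>) = \<Theta> \<sigma>"
  shows "polytime I \<Theta>"
proof -
  obtain c K S d where c: "fits K S c"
     "\<And>N \<sigma>. I N \<sigma> \<Longrightarrow> runs c \<sigma> (\<Phi> \<sigma>) ((N + size_upto K \<sigma> + d) ^ d)"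
    using assms(1) unfolding polytime_def by blast
  obtain c' K' S' d' where c': "fits K' S' c'"
     "\<And>N \<sigma>. J N \<sigma> \<Longrightarrow> runs c' \<sigma> (\<Psi> \<sigma>) ((N + size_upto K' \<sigma> + d') ^ d')"
    using assms(2) unfolding polytime_def by blast
  define L where "L = max K K'"
  define p where "p m = (m + d) ^ d" for m
  define q where "q m = p m + (m + K' * p m + d') ^ d'" for m
  have p: "poly_bounded p" unfolding p_def by (intro poly_bounded_power poly_bounded_add poly_bounded_id poly_bounded_const)
  have q: "poly_bounded q" unfolding q_def by (intro poly_bounded_power poly_bounded_add poly_bounded_mult poly_bounded_id poly_bounded_const p)
  show ?thesis
  proof (rule PTI[OF _ q])
    show "fits L (max S S') (Seq c c')"
      using fits_mono[OF c(1), of L "max S S'"] fits_mono[OF c'(1), of L "max S S'"] by (simp add: L_def)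
    fix N \<sigma> ts assume I: "I N \<sigma>" and represents: "represents ts \<sigma>"
    let ?m = "N + size_upto L \<sigma>"
    have 1: "runs c \<sigma> (\<Phi> \<sigma>) (p ?m)"
      unfolding p_def using size_upto_mono[of K L \<sigma>]
      by (intro runs_mono[OF c(2)[OF I]] power_mono) (auto simp: L_def)
    have "size_upto K' (\<Phi> \<sigma>) \<le> size_upto K' \<sigma> + K' * p ?m"
      by (rule size_upto_le) (rule runs_growth[OF 1 represents])
    then have "size_upto K' (\<Phi> \<sigma>) \<le> size_upto L \<sigma> + K' * p ?m"
      using size_upto_mono[of K' L \<sigma>] by (simp add: L_def)
    then have 2: "runs c' (\<Phi> \<sigma>) (\<Theta> \<sigma>) ((?m + K' * p ?m + d') ^ d')"
      unfolding eq[OF I, symmetric]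
      by (intro runs_mono[OF c'(2)[OF J[OF I]]] power_mono) auto
    show "runs (Seq c c') \<sigma> (\<Theta> \<sigma>) (q ?m)"
      unfolding q_def by (rule runs_Seq[OF 1 2])
  qed
qed

lemma polytime_if:
  assumes "polytime (\<lambda>N \<sigma>. I N \<sigma> \<and> top_symbol (\<sigma> r) \<in> A) \<Phi>" "polytime (\<lambda>N \<sigma>. I N \<sigma> \<and> top_symbol (\<sigma> r) \<notin> A) \<Psi>"
  shows "polytime I (\<lambda>\<sigma>. if top_symbol (\<sigma> r) \<in> A then \<Phi> \<sigma> else \<Psi> \<sigma>)"
proof -
  obtain c K S d where c: "fits K S c"
     "\<And>N \<sigma>. I N \<sigma> \<and> top_symbol (\<sigma> r) \<in> A \<Longrightarrow> runs c \<sigma> (\<Phi> \<sigma>) ((N + size_upto K \<sigma> + d) ^ d)"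
    using assms(1) unfolding polytime_def by blast
  obtain c' K' S' d' where c': "fits K' S' c'"
     "\<And>N \<sigma>. I N \<sigma> \<and> top_symbol (\<sigma> r) \<notin> A \<Longrightarrow> runs c' \<sigma> (\<Psi> \<sigma>) ((N + size_upto K' \<sigma> + d') ^ d')"
    using assms(2) unfolding polytime_def by blast
  define L where "L = max (Suc r) (max K K')"
  define q where "q m = 1 + ((m + d) ^ d + (m + d') ^ d')" for m
  have q: "poly_bounded q" unfolding q_def by (intro poly_bounded_power poly_bounded_add poly_bounded_id poly_bounded_const)
  show ?thesis
  proof (rule PTI[OF _ q])
    show "fits L (max S S') (Cond r A c c')"
      using fits_mono[OF c(1), of L "max S S'"] fits_mono[OF c'(1), of L "max S S'"] by (simp add: L_def)
    fix N \<sigma> ts assume I: "I N \<sigma>" and represents: "represents ts \<sigma>"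
    let ?m = "N + size_upto L \<sigma>"
    have 1: "(N + size_upto K \<sigma> + d) ^ d \<le> (?m + d) ^ d"
      using size_upto_mono[of K L \<sigma>] by (intro power_mono) (auto simp: L_def)
    have 2: "(N + size_upto K' \<sigma> + d') ^ d' \<le> (?m + d') ^ d'"
      using size_upto_mono[of K' L \<sigma>] by (intro power_mono) (auto simp: L_def)
    have "runs (Cond r A c c') \<sigma> (if top_symbol (\<sigma> r) \<in> A then \<Phi> \<sigma> else \<Psi> \<sigma>) (Suc ((?m + d) ^ d + (?m + d') ^ d'))"
    proof (rule runs_Cond)
      assume "top_symbol (\<sigma> r) \<in> A"
      then show "runs c \<sigma> (if top_symbol (\<sigma> r) \<in> A then \<Phi> \<sigma> else \<Psi> \<sigma>) ((?m + d) ^ d + (?m + d') ^ d')"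
        using runs_mono[OF c(2)] I 1 by (simp add: trans_le_add1)
    next
      assume "top_symbol (\<sigma> r) \<notin> A"
      then show "runs c' \<sigma> (if top_symbol (\<sigma> r) \<in> A then \<Phi> \<sigma> else \<Psi> \<sigma>) ((?m + d) ^ d + (?m + d') ^ d')"
        using runs_mono[OF c'(2)] I 2 by (simp add: trans_le_add2)
    qed
    then show "runs (Cond r A c c') \<sigma> (if top_symbol (\<sigma> r) \<in> A then \<Phi> \<sigma> else \<Psi> \<sigma>) (q ?m)"
      by (simp add: q_def)
  qed
qed

text \<open>
  The function s gives the state after each round. Polynomial bounds on the number of rounds
  and on the height of all intermediate stacks make the loop polynomial; without the second
  bound, iterating a polynomial-time body could produce exponential growth.
\<close>

lemma polytime_while:
  fixes n :: "stacks \<Rightarrow> nat" and s :: "stacks \<Rightarrow> nat \<Rightarrow> stacks"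
  assumes body: "polytime J \<Phi>"
    and start: "\<And>N \<sigma>. I N \<sigma> \<Longrightarrow> s \<sigma> 0 = \<sigma>"
    and inv: "\<And>N \<sigma> i. I N \<sigma> \<Longrightarrow> i < n \<sigma> \<Longrightarrow> J N (s \<sigma> i)"
    and step: "\<And>N \<sigma> i. I N \<sigma> \<Longrightarrow> i < n \<sigma> \<Longrightarrow> \<Phi> (s \<sigma> i) = s \<sigma> (Suc i)"
    and go: "\<And>N \<sigma> i. I N \<sigma> \<Longrightarrow> i < n \<sigma> \<Longrightarrow> top_symbol (s \<sigma> i r) \<in> A"
    and stop: "\<And>N \<sigma>. I N \<sigma> \<Longrightarrow> top_symbol (s \<sigma> (n \<sigma>) r) \<notin> A"
    and q: "poly_bounded q"
    and count: "\<And>N \<sigma>. I N \<sigma> \<Longrightarrow> n \<sigma> \<le> q (N + size_upto B \<sigma>)"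
    and growth: "\<And>N \<sigma> i r'. I N \<sigma> \<Longrightarrow> i < n \<sigma> \<Longrightarrow> length (s \<sigma> i r') \<le> length (\<sigma> r') + q (N + size_upto B \<sigma>)"
  shows "polytime I (\<lambda>\<sigma>. s \<sigma> (n \<sigma>))"
proof -
  obtain c K S d where c: "fits K S c"
     "\<And>N \<sigma>. J N \<sigma> \<Longrightarrow> runs c \<sigma> (\<Phi> \<sigma>) ((N + size_upto K \<sigma> + d) ^ d)"
    using body unfolding polytime_def by blast
  obtain e where e: "\<And>m. q m \<le> (m + e) ^ e" using q unfolding poly_bounded_def by blast
  define L where "L = max (Suc r) (max K B)"
  define p where "p m = (m + e) ^ e" for m
  define b where "b m = (m + L * p m + d) ^ d" for m
  define w where "w m = p m * (1 + b m) + 1" for m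
  have p: "poly_bounded p" unfolding p_def by (intro poly_bounded_power poly_bounded_add poly_bounded_id poly_bounded_const)
  have b: "poly_bounded b" unfolding b_def by (intro poly_bounded_power poly_bounded_add poly_bounded_mult poly_bounded_id poly_bounded_const p)
  have w: "poly_bounded w" unfolding w_def by (intro poly_bounded_add poly_bounded_mult poly_bounded_const p b)
  show ?thesis
  proof (rule PTI[OF _ w])
    show "fits L S (While r A c)"
      using fits_mono[OF c(1), of L S] by (simp add: L_def)
    fix N \<sigma> ts assume I: "I N \<sigma>" and represents: "represents ts \<sigma>"
    let ?m = "N + size_upto L \<sigma>"
    have qp: "q (N + size_upto B \<sigma>) \<le> p ?m"
    proof -
      have "q (N + size_upto B \<sigma>) \<le> (N + size_upto B \<sigma> + e) ^ e" by (rule e)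
      also have "\<dots> \<le> p ?m" unfolding p_def
        using size_upto_mono[of B L \<sigma>] by (intro power_mono) (auto simp: L_def)
      finally show ?thesis .
    qed
    have "runs (While r A c) (s \<sigma> 0) (s \<sigma> (n \<sigma>)) (n \<sigma> * Suc (b ?m) + 1)"
    proof (rule runs_While)
      show "top_symbol (s \<sigma> i r) \<in> A" if "i < n \<sigma>" for i by (rule go[OF I that])
      show "top_symbol (s \<sigma> (n \<sigma>) r) \<notin> A" by (rule stop[OF I])
      show "runs c (s \<sigma> i) (s \<sigma> (Suc i)) (b ?m)" if i: "i < n \<sigma>" for i
      proof -
        have "length (s \<sigma> i r') \<le> length (\<sigma> r') + p ?m" for r'
          using growth[OF I i, of r'] qp by simp
        then have "size_upto L (s \<sigma> i) \<le> size_upto L \<sigma> + L * p ?m" by (rule size_upto_le)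
        then have "N + size_upto K (s \<sigma> i) + d \<le> ?m + L * p ?m + d"
        proof -
          have "size_upto K (s \<sigma> i) \<le> size_upto L (s \<sigma> i)" by (rule size_upto_mono) (simp add: L_def)
          then show ?thesis using \<open>size_upto L (s \<sigma> i) \<le> _\<close> by linarith
        qed
        then have "(N + size_upto K (s \<sigma> i) + d) ^ d \<le> b ?m"
          unfolding b_def by (intro power_mono) auto
        moreover have "runs c (s \<sigma> i) (s \<sigma> (Suc i)) ((N + size_upto K (s \<sigma> i) + d) ^ d)"
          using c(2)[OF inv[OF I i]] step[OF I i] by simp
        ultimately show ?thesis using runs_mono by blast
      qed
    qed
    moreover have "n \<sigma> * Suc (b ?m) + 1 \<le> w ?m"
    proof -
      have "n \<sigma> \<le> p ?m" using count[OF I] qp by linarith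
      then have "n \<sigma> * Suc (b ?m) \<le> p ?m * Suc (b ?m)" by (rule mult_right_mono) simp
      then show ?thesis by (simp add: w_def)
    qed
    ultimately show "runs (While r A c) \<sigma> (s \<sigma> (n \<sigma>)) (w ?m)"
      using runs_mono start[OF I] by simp
  qed
qed

lemma represents_nonzero: "represents ts \<sigma> \<Longrightarrow> 0 \<notin> set (\<sigma> r)"
  by (auto simp: represents_def is_stack_def)

lemma polytime_assume_nonzero:
  assumes "polytime (\<lambda>N \<sigma>. I N \<sigma> \<and> (\<forall>r. 0 \<notin> set (\<sigma> r))) \<Phi>" shows "polytime I \<Phi>"
proof -
  obtain c K S d where c: "fits K S c"
     "\<And>N \<sigma>. I N \<sigma> \<and> (\<forall>r. 0 \<notin> set (\<sigma> r)) \<Longrightarrow> runs c \<sigma> (\<Phi> \<sigma>) ((N + size_upto K \<sigma> + d) ^ d)"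
    using assms unfolding polytime_def by blast
  show ?thesis
  proof (rule PTI[OF c(1), of "\<lambda>m. (m + d) ^ d"])
    show "poly_bounded (\<lambda>m. (m + d) ^ d)" by (intro poly_bounded_power poly_bounded_add poly_bounded_id poly_bounded_const)
    show "runs c \<sigma> (\<Phi> \<sigma>) ((N + size_upto K \<sigma> + d) ^ d)" if "I N \<sigma>" "represents ts \<sigma>" for N \<sigma> ts
      using that represents_nonzero by (intro c(2)) blast
  qed
qed

lemma polytime_foreach:
  fixes s :: "stacks \<Rightarrow> nat \<Rightarrow> stacks"
  assumes body: "polytime J \<Phi>"
    and start: "\<And>N \<sigma>. I N \<sigma> \<Longrightarrow> s \<sigma> 0 = \<sigma>"
    and inv: "\<And>N \<sigma> i. I N \<sigma> \<Longrightarrow> i < length (\<sigma> r) \<Longrightarrow> J N (s \<sigma> i)"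
    and step: "\<And>N \<sigma> i. I N \<sigma> \<Longrightarrow> i < length (\<sigma> r) \<Longrightarrow> \<Phi> (s \<sigma> i) = s \<sigma> (Suc i)"
    and pop: "\<And>N \<sigma> i. I N \<sigma> \<Longrightarrow> i \<le> length (\<sigma> r) \<Longrightarrow> s \<sigma> i r = drop i (\<sigma> r)"
    and q: "poly_bounded q"
    and growth: "\<And>N \<sigma> i r'. I N \<sigma> \<Longrightarrow> i < length (\<sigma> r) \<Longrightarrow>
      length (s \<sigma> i r') \<le> length (\<sigma> r') + q (N + size_upto B \<sigma>)"
  shows "polytime I (\<lambda>\<sigma>. s \<sigma> (length (\<sigma> r)))"
proof (rule polytime_assume_nonzero)
  obtain e where e: "\<And>m. q m \<le> (m + e) ^ e" using q unfolding poly_bounded_def by blast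
  define L where "L = max (Suc r) B"
  let ?p = "\<lambda>m. m + (m + e) ^ e"
  have p: "q (N + size_upto B \<sigma>) \<le> ?p (N + size_upto L \<sigma>)" for N \<sigma>
  proof -
    have "q (N + size_upto B \<sigma>) \<le> (N + size_upto B \<sigma> + e) ^ e" by (rule e)
    also have "\<dots> \<le> (N + size_upto L \<sigma> + e) ^ e"
      using size_upto_mono[of B L \<sigma>] by (intro power_mono) (auto simp: L_def)
    finally show ?thesis by simp
  qed
  show "polytime (\<lambda>N \<sigma>. I N \<sigma> \<and> (\<forall>r. 0 \<notin> set (\<sigma> r))) (\<lambda>\<sigma>. s \<sigma> (length (\<sigma> r)))"
  proof (rule polytime_while[where A = "- {0}" and r = r and J = J and \<Phi> = \<Phi> and q = ?p and B = L])
    show "poly_bounded ?p" by (intro poly_bounded_add poly_bounded_power poly_bounded_id poly_bounded_const)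
    fix N \<sigma> i assume I: "I N \<sigma> \<and> (\<forall>r. 0 \<notin> set (\<sigma> r))"
    show "s \<sigma> 0 = \<sigma>" using start I by blast
    show "top_symbol (s \<sigma> (length (\<sigma> r)) r) \<notin> - {0}" using pop[of N \<sigma> "length (\<sigma> r)"] I by simp
    show "length (\<sigma> r) \<le> ?p (N + size_upto L \<sigma>)"
    proof -
      have "length (\<sigma> r) \<le> size_upto L \<sigma>" by (rule length_le_size_upto) (simp add: L_def)
      then show ?thesis by linarith
    qed
    assume i: "i < length (\<sigma> r)"
    show "J N (s \<sigma> i)" "\<Phi> (s \<sigma> i) = s \<sigma> (Suc i)" using inv step I i by blast+
    have "s \<sigma> i r = (\<sigma> r ! i) # drop (Suc i) (\<sigma> r)"
      using pop[of N \<sigma> i] I i by (simp add: Cons_nth_drop_Suc)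
    moreover have "\<sigma> r ! i \<noteq> 0" using I nth_mem[OF i] by metis
    ultimately show "top_symbol (s \<sigma> i r) \<in> - {0}" by simp
    show "length (s \<sigma> i r') \<le> length (\<sigma> r') + ?p (N + size_upto L \<sigma>)" for r'
      using growth[of N \<sigma> i r'] I i p[of N \<sigma>] by simp
  qed (rule body)
qed

text \<open>
  Functions of the top symbols that an action can compute: finitely many tapes are read, and
  the result is bounded or a symbol that was read.
\<close>

definition admissible :: "((nat \<Rightarrow> nat) \<Rightarrow> nat) \<Rightarrow> bool" where
  "admissible h \<longleftrightarrow> (\<exists>K S. (\<forall>a b. (\<forall>i<K. a i = b i) \<longrightarrow> h a = h b) \<and>
     (\<forall>S'\<ge>S. \<forall>a. (\<forall>i. a i < S') \<longrightarrow> h a < S'))"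

lemma admissible_const: "admissible (\<lambda>_. c)"
  unfolding admissible_def by (intro exI[of _ 0] exI[of _ "Suc c"]) auto

lemma admissible_read: "admissible (\<lambda>a. a r)"
  unfolding admissible_def by (intro exI[of _ "Suc r"] exI[of _ 0]) auto

lemma admissible_bounded:
  assumes "\<And>a b. (\<And>i. i < K \<Longrightarrow> a i = b i) \<Longrightarrow> h a = h b" "\<And>a. h a \<le> c"
  shows "admissible h"
proof -
  have "\<forall>S'\<ge>Suc c. \<forall>a. (\<forall>i. a i < S') \<longrightarrow> h a < S'"
  proof (intro allI impI)
    fix S' a assume "Suc c \<le> S'"
    then show "h a < S'" using assms(2)[of a] by linarith
  qed
  moreover have "\<forall>a b. (\<forall>i<K. a i = b i) \<longrightarrow> h a = h b"
    by (intro allI impI, rule assms(1)) simp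
  ultimately show ?thesis unfolding admissible_def by blast
qed

lemma represents_update: "represents ts \<sigma> \<Longrightarrow> is_stack t xs \<Longrightarrow> represents (ts(r := t)) (\<sigma>(r := xs))"
  by (simp add: represents_def)

lemma exec_Act_single:
  "exec (Act (\<lambda>a i. if i = r then h a else (a i, Stay))) ts 1 (ts(r := act_tape (h (reads ts)) (ts r)))"
proof -
  have "(\<lambda>i. act_tape ((\<lambda>a i. if i = r then h a else (a i, Stay)) (reads ts) i) (ts i))
      = ts(r := act_tape (h (reads ts)) (ts r))"
    by (auto simp: fun_eq_iff reads_def act_tape_stay)
  then show ?thesis using exec.Act[of "\<lambda>a i. if i = r then h a else (a i, Stay)" ts] by simp
qed

lemma fits_Act_single:
  assumes "\<And>a b. (\<forall>i<K. a i = b i) \<Longrightarrow> h a = h b" "\<And>S' a. S \<le> S' \<Longrightarrow> (\<forall>i. a i < S') \<Longrightarrow> h a < S'"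
  shows "fits (max K (Suc r)) S (Act (\<lambda>a i. if i = r then (h a, m) else (a i, Stay)))"
proof -
  have "h a = h b" if "\<forall>i<max K (Suc r). a i = b i" for a b
    using that by (intro assms(1)) simp
  then show ?thesis using assms(2) by simp
qed

lemma polytime_pop: "polytime I (\<lambda>\<sigma>. \<sigma>(r := tl (\<sigma> r)))"
proof (rule PTI[OF fits_Act_single[of 0 "\<lambda>_. 0" 1 r MoveRight], of "\<lambda>_. 1"])
  fix N \<sigma> ts
  show "runs (Act (\<lambda>a i. if i = r then (0, MoveRight) else (a i, Stay))) \<sigma> (\<sigma>(r := tl (\<sigma> r))) 1"
    unfolding runs_def
  proof (intro allI impI)
    fix ts assume represents: "represents ts \<sigma>"
    have "represents (ts(r := act_tape (0, MoveRight) (ts r))) (\<sigma>(r := tl (\<sigma> r)))"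
      by (rule represents_update[OF represents stack_pop]) (use represents in \<open>simp add: represents_def\<close>)
    then show "\<exists>t ts'. t \<le> 1 \<and> exec (Act (\<lambda>a i. if i = r then (0, MoveRight) else (a i, Stay))) ts t ts' \<and>
        represents ts' (\<sigma>(r := tl (\<sigma> r)))"
      using exec_Act_single[of r "\<lambda>_. (0, MoveRight)" ts] by blast
  qed
qed (auto intro: poly_bounded_const)

lemma polytime_set_top:
  assumes h: "admissible h" and I: "\<And>N \<sigma>. I N \<sigma> \<Longrightarrow> \<sigma> r \<noteq> [] \<and> h (\<lambda>i. top_symbol (\<sigma> i)) \<noteq> 0"
  shows "polytime I (\<lambda>\<sigma>. \<sigma>(r := h (\<lambda>i. top_symbol (\<sigma> i)) # tl (\<sigma> r)))"
proof -
  obtain K S where h1: "\<And>a b. (\<forall>i<K. a i = b i) \<Longrightarrow> h a = h b"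
    and h2: "\<And>S' a. S \<le> S' \<Longrightarrow> (\<forall>i. a i < S') \<Longrightarrow> h a < S'"
    using h unfolding admissible_def by metis
  let ?c = "Act (\<lambda>a i. if i = r then (h a, Stay) else (a i, Stay))"
  show ?thesis
  proof (rule PTI[of _ _ ?c "\<lambda>_. 1"])
    show "fits (max K (Suc r)) S ?c" by (rule fits_Act_single) (erule h1, erule (1) h2)
    fix N \<sigma> and ts :: tape_file assume I': "I N \<sigma>"
    show "runs ?c \<sigma> (\<sigma>(r := h (\<lambda>i. top_symbol (\<sigma> i)) # tl (\<sigma> r))) 1"
      unfolding runs_def
    proof (intro allI impI)
      fix ts assume represents: "represents ts \<sigma>"
      have "represents (ts(r := act_tape (h (reads ts), Stay) (ts r))) (\<sigma>(r := h (\<lambda>i. top_symbol (\<sigma> i)) # tl (\<sigma> r)))"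
        unfolding reads_represents[OF represents]
        by (rule represents_update[OF represents stack_set_top]) (use represents I[OF I'] in \<open>simp_all add: represents_def\<close>)
      then show "\<exists>t ts'. t \<le> 1 \<and> exec ?c ts t ts' \<and> represents ts' (\<sigma>(r := h (\<lambda>i. top_symbol (\<sigma> i)) # tl (\<sigma> r)))"
        using exec_Act_single[of r "\<lambda>a. (h a, Stay)" ts] by blast
    qed
  qed (rule poly_bounded_const)
qed

text \<open>
  The function must not read the stack to be pushed on, since the head has already left its
  top when the symbol is chosen.
\<close>

lemma polytime_push:
  assumes h: "admissible h" and r: "\<And>a x. h (a(r := x)) = h a"
    and I: "\<And>N \<sigma>. I N \<sigma> \<Longrightarrow> h (\<lambda>i. top_symbol (\<sigma> i)) \<noteq> 0"
  shows "polytime I (\<lambda>\<sigma>. \<sigma>(r := h (\<lambda>i. top_symbol (\<sigma> i)) # \<sigma> r))"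
proof -
  obtain K S where h1: "\<And>a b. (\<forall>i<K. a i = b i) \<Longrightarrow> h a = h b"
    and h2: "\<And>S' a. S \<le> S' \<Longrightarrow> (\<forall>i. a i < S') \<Longrightarrow> h a < S'"
    using h unfolding admissible_def by metis
  let ?m = "Act (\<lambda>a i. if i = r then (a r, MoveLeft) else (a i, Stay))"
  let ?c = "Act (\<lambda>a i. if i = r then (h a, Stay) else (a i, Stay))"
  show ?thesis
  proof (rule PTI[of _ _ "Seq ?m ?c" "\<lambda>_. 2"])
    have "fits (max (Suc r) (Suc r)) 0 ?m"
      by (rule fits_Act_single) auto
    then have "fits (max K (Suc r)) S ?m" by (rule fits_mono) auto
    moreover have "fits (max K (Suc r)) S ?c" by (rule fits_Act_single) (erule h1, erule (1) h2)
    ultimately show "fits (max K (Suc r)) S (Seq ?m ?c)" by (simp only: fits.simps)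
    fix N \<sigma> and ts :: tape_file assume I': "I N \<sigma>"
    show "runs (Seq ?m ?c) \<sigma> (\<sigma>(r := h (\<lambda>i. top_symbol (\<sigma> i)) # \<sigma> r)) 2"
      unfolding runs_def
    proof (intro allI impI)
      fix ts assume represents: "represents ts \<sigma>"
      define ts1 where "ts1 = ts(r := act_tape (reads ts r, MoveLeft) (ts r))"
      have "reads ts1 = (reads ts)(r := read_tape (ts1 r))" by (auto simp: reads_def ts1_def)
      then have h: "h (reads ts1) = h (\<lambda>i. top_symbol (\<sigma> i))"
        using r reads_represents[OF represents] by simp
      have "represents (ts(r := act_tape (h (\<lambda>i. top_symbol (\<sigma> i)), Stay) (ts1 r))) (\<sigma>(r := h (\<lambda>i. top_symbol (\<sigma> i)) # \<sigma> r))"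
        unfolding ts1_def fun_upd_same reads_def
        by (rule represents_update[OF represents stack_push]) (use represents I[OF I'] in \<open>simp_all add: represents_def\<close>)
      moreover have "ts1(r := act_tape (h (reads ts1), Stay) (ts1 r)) = ts(r := act_tape (h (\<lambda>i. top_symbol (\<sigma> i)), Stay) (ts1 r))"
        by (simp add: h) (simp add: ts1_def)
      moreover have "exec (Seq ?m ?c) ts (1 + 1) (ts1(r := act_tape (h (reads ts1), Stay) (ts1 r)))"
        using exec_Act_single[of r "\<lambda>a. (a r, MoveLeft)" ts] exec_Act_single[of r "\<lambda>a. (h a, Stay)" ts1]
        unfolding ts1_def by (rule exec.Seq)
      ultimately show "\<exists>t ts'. t \<le> 2 \<and> exec (Seq ?m ?c) ts t ts' \<and> represents ts' (\<sigma>(r := h (\<lambda>i. top_symbol (\<sigma> i)) # \<sigma> r))"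
        by (intro exI[of _ 2] exI[of _ "ts1(r := act_tape (h (reads ts1), Stay) (ts1 r))"]) (simp add: numeral_2_eq_2)
    qed
  qed (rule poly_bounded_const)
qed

lemma polytime_push_const: "x \<noteq> 0 \<Longrightarrow> polytime I (\<lambda>\<sigma>. \<sigma>(r := x # \<sigma> r))"
  by (rule polytime_push[OF admissible_const]) auto

lemma polytime_push_top:
  assumes "r \<noteq> q" "\<And>N \<sigma>. I N \<sigma> \<Longrightarrow> \<sigma> q \<noteq> []"
  shows "polytime I (\<lambda>\<sigma>. \<sigma>(r := top_symbol (\<sigma> q) # \<sigma> r))"
proof (rule polytime_assume_nonzero, rule polytime_push[OF admissible_read])
  show "top_symbol (\<sigma> q) \<noteq> 0" if nz: "I N \<sigma> \<and> (\<forall>r. 0 \<notin> set (\<sigma> r))" for N \<sigma>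
  proof -
    obtain x xs where xs: "\<sigma> q = x # xs" using assms(2)[of N \<sigma>] nz by (cases "\<sigma> q") auto
    have "0 \<notin> set (\<sigma> q)" using nz by blast
    then show ?thesis by (simp add: xs)
  qed
qed (use assms(1) in simp)

lemma word_rec: "2 \<le> n \<Longrightarrow> word n = word (n div 2) @ [Suc (n mod 2)]"
  by (simp add: word_def) (subst binary.simps, simp)

lemma word_less_2: "n < 2 \<Longrightarrow> word n = [Suc n]"
  by (simp add: word_def binary.simps)

lemma length_word_le: "length (word n) \<le> n + 1"
proof (induction n rule: less_induct)
  case (less n)
  show ?case
  proof (cases "n < 2")
    case False
    then have "length (word (n div 2)) \<le> n div 2 + 1" by (intro less) auto
    then show ?thesis using False by (simp add: word_rec)
  qed (simp add: word_less_2)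
qed

theorem polytime_poly_time:
  assumes polytime: "polytime I \<Phi>"
    and I: "\<And>n. I n (\<lambda>r. if r = 0 then word n else [])"
    and result: "\<And>n. \<Phi> (\<lambda>r. if r = 0 then word n else []) 0 = word (f n)"
  shows "f \<in> poly_time_in_argument"
proof -
  let ?\<sigma> = "\<lambda>n r. if r = 0 then word n else []"
  obtain c K S d where c: "fits K S c"
     "\<And>N \<sigma>. I N \<sigma> \<Longrightarrow> runs c \<sigma> (\<Phi> \<sigma>) ((N + size_upto K \<sigma> + d) ^ d)"
    using polytime unfolding polytime_def by blast
  define K' where "K' = Suc K"
  define S' where "S' = max 3 S"
  have fits: "fits K' S' c" by (rule fits_mono[OF c(1)]) (auto simp: K'_def S'_def)
  have word: "0 \<notin> set (word n)" for n by (auto simp: word_def)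
  let ?ts = "\<lambda>n r. if r = 0 then input_tape (word n) else input_tape []"
  have stack: "is_stack (input_tape w) w" if "0 \<notin> set w" for w
    using that by (simp add: is_stack_def input_tape_def)
  have represents: "represents (?ts n) (?\<sigma> n)" for n
    using stack[OF word] stack[of "[]"] by (simp add: represents_def)
  have init: "initial_config (machine K' S' c) n = (start_state (machine K' S' c), tape_list K' (?ts n))" for n
    by (auto simp: initial_config_def machine_def tape_list_def K'_def intro!: nth_equalityI simp: nth_Cons' nth_append simp del: upt_Suc)
  have run: "\<exists>t \<le> (n + (n + 1) + d) ^ d. \<exists>ts. (step (machine K' S' c) ^^ t) (initial_config (machine K' S' c) n)
      = (halt_state (machine K' S' c), ts) \<and> tape_result (hd ts) (word (f n))" for n
  proof -
    have "size_upto K (?\<sigma> n) \<le> length (word n)"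
      unfolding size_upto_def by (cases K) (auto simp: sum.lessThan_Suc_shift simp del: sum.lessThan_Suc)
    then have "(n + size_upto K (?\<sigma> n) + d) ^ d \<le> (n + (n + 1) + d) ^ d"
      using length_word_le[of n] by (intro power_mono) auto
    then have "runs c (?\<sigma> n) (\<Phi> (?\<sigma> n)) ((n + (n + 1) + d) ^ d)"
      using c(2)[OF I] runs_mono by blast
    then obtain t ts' where t: "t \<le> (n + (n + 1) + d) ^ d" "exec c (?ts n) t ts'" "represents ts' (\<Phi> (?\<sigma> n))"
      using represents unfolding runs_def by blast
    have "is_stack (ts' 0) (word (f n))" using t(3) result[of n] by (metis represents_def)
    moreover have "hd (tape_list K' ts') = ts' 0" by (simp add: tape_list_def K'_def upt_rec[of 0])
    ultimately have "tape_result (hd (tape_list K' ts')) (word (f n))"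
      by (cases "ts' 0") (auto simp: tape_result_def is_stack_def)
    then show ?thesis using machine_run[OF t(2) fits] t(1) init by metis
  qed
  have "poly (([:1 + d, 2:] :: nat poly) ^ d) n = (n + (n + 1) + d) ^ d" for n
    by (simp add: poly_power algebra_simps)
  then have "computes_in_time (machine K' S' c) f (poly ([:1 + d, 2:] ^ d))"
    unfolding computes_in_time_def using run by metis
  moreover have "wf_tm (machine K' S' c)"
    by (rule wf_machine[OF fits]) (auto simp: K'_def S'_def)
  ultimately show ?thesis unfolding poly_time_in_argument_def by blast
qed

section \<open>The second Grzegorczyk class in polynomial time\<close>

abbreviation unary :: "nat \<Rightarrow> nat list" where "unary n \<equiv> replicate n 1"

definition empty_from :: "nat \<Rightarrow> nat \<Rightarrow> stacks \<Rightarrow> bool" where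
  "empty_from b N \<sigma> \<longleftrightarrow> (\<forall>r\<ge>b. \<sigma> r = [])"

lemma polytime_cong: "polytime I \<Phi> \<Longrightarrow> (\<And>N \<sigma>. I N \<sigma> \<Longrightarrow> \<Phi> \<sigma> = \<Psi> \<sigma>) \<Longrightarrow> polytime I \<Psi>"
  by (rule polytime_weaken)

lemma polytime_skip: "polytime I (\<lambda>\<sigma>. \<sigma>)"
  by (rule polytime_seq[OF polytime_push_const[of 1 I 0] polytime_pop[of "\<lambda>_ _. True" 0]]) auto

lemma drop_facts:
  assumes "i < length xs"
  shows "tl (drop i xs) = drop (Suc i) xs" "top_symbol (drop i xs) = xs ! i" "drop i xs \<noteq> []"
    "rev (take (Suc i) xs) = xs ! i # rev (take i xs)"
  using assms by (simp_all add: drop_Suc tl_drop take_Suc_conv_app_nth Cons_nth_drop_Suc[symmetric])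

lemma polytime_clear: "polytime I (\<lambda>\<sigma>. \<sigma>(r := []))"
proof (rule polytime_cong)
  show "polytime I (\<lambda>\<sigma>. \<sigma>(r := drop (length (\<sigma> r)) (\<sigma> r)))"
    by (rule polytime_foreach[where s = "\<lambda>\<sigma> i. \<sigma>(r := drop i (\<sigma> r))" and q = "\<lambda>m. m" and B = 0,
        OF polytime_pop[of "\<lambda>_ _. True" r]]) (auto simp: poly_bounded_id drop_facts)
qed simp

lemma polytime_move:
  assumes "q \<noteq> t"
  shows "polytime I (\<lambda>\<sigma>. \<sigma>(q := [], t := rev (\<sigma> q) @ \<sigma> t))"
proof (rule polytime_cong)
  let ?J = "\<lambda>N \<sigma>. \<sigma> q \<noteq> []"
  have body: "polytime ?J (\<lambda>\<sigma>. \<sigma>(t := top_symbol (\<sigma> q) # \<sigma> t, q := tl (\<sigma> q)))"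
    by (rule polytime_seq[OF polytime_push_top[of t q] polytime_pop[of "\<lambda>_ _. True" q]]) (use assms in auto)
  show "polytime I (\<lambda>\<sigma>. \<sigma>(q := drop (length (\<sigma> q)) (\<sigma> q), t := rev (take (length (\<sigma> q)) (\<sigma> q)) @ \<sigma> t))"
  proof (rule polytime_foreach[where s = "\<lambda>\<sigma> i. \<sigma>(q := drop i (\<sigma> q), t := rev (take i (\<sigma> q)) @ \<sigma> t)"
      and q = "\<lambda>m. m" and B = "Suc q", OF body])
    fix N :: nat and \<sigma> :: stacks and i r'
    assume i: "i < length (\<sigma> q)"
    show "length ((\<sigma>(q := drop i (\<sigma> q), t := rev (take i (\<sigma> q)) @ \<sigma> t)) r') \<le> length (\<sigma> r') + (N + size_upto (Suc q) \<sigma>)"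
      using i length_le_size_upto[of q "Suc q" \<sigma>] by (auto simp: trans_le_add1)
  qed (use assms in \<open>auto simp: poly_bounded_id drop_facts fun_eq_iff\<close>)
qed simp

text \<open>
  The copied stack is emptied onto t and restored from there.
\<close>

lemma polytime_add:
  assumes d: "q \<noteq> t" "q \<noteq> o'" "t \<noteq> o'" and t: "\<And>N \<sigma>. I N \<sigma> \<Longrightarrow> \<sigma> t = []"
  shows "polytime I (\<lambda>\<sigma>. \<sigma>(o' := unary (length (\<sigma> q)) @ \<sigma> o'))"
proof -
  let ?J = "\<lambda>N \<sigma>. \<sigma> q \<noteq> []"
  let ?s = "\<lambda>\<sigma> i. \<sigma>(q := drop i (\<sigma> q), t := rev (take i (\<sigma> q)), o' := unary i @ \<sigma> o')"
  have "polytime ?J (\<lambda>\<sigma>. \<sigma>(t := top_symbol (\<sigma> q) # \<sigma> t, q := tl (\<sigma> q)))"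
    by (rule polytime_seq[OF polytime_push_top[of t q] polytime_pop[of "\<lambda>_ _. True" q]]) (use d in auto)
  then have body: "polytime ?J (\<lambda>\<sigma>. \<sigma>(t := top_symbol (\<sigma> q) # \<sigma> t, q := tl (\<sigma> q), o' := 1 # \<sigma> o'))"
    by (rule polytime_seq[OF _ polytime_push_const[of 1 "\<lambda>_ _. True" o']]) (use d in auto)
  have 1: "polytime I (\<lambda>\<sigma>. ?s \<sigma> (length (\<sigma> q)))"
  proof (rule polytime_foreach[where s = ?s and q = "\<lambda>m. m" and B = "Suc q", OF body])
    fix N :: nat and \<sigma> :: stacks and i r'
    assume i: "i < length (\<sigma> q)"
    show "length (?s \<sigma> i r') \<le> length (\<sigma> r') + (N + size_upto (Suc q) \<sigma>)"
      using i length_le_size_upto[of q "Suc q" \<sigma>] by (auto simp: trans_le_add1)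
  qed (use d in \<open>auto simp: poly_bounded_id drop_facts fun_eq_iff dest: t\<close>)
  show ?thesis
    by (rule polytime_seq[OF 1 polytime_move[of t q "\<lambda>_ _. True"]]) (use d in \<open>auto simp: fun_eq_iff dest: t\<close>)
qed

text \<open>
  Arguments and result are in unary. The stacks from base on are scratch space, empty before
  and after, so that calls can be nested by increasing base.
\<close>

definition computes :: "nat \<Rightarrow> (nat list \<Rightarrow> nat) \<Rightarrow> bool" where
  "computes k F \<longleftrightarrow> (\<forall>ins out base. length ins = k \<longrightarrow> set ins \<subseteq> {..<base} \<longrightarrow> out < base \<longrightarrow> out \<notin> set ins \<longrightarrow>
     polytime (empty_from base) (\<lambda>\<sigma>. \<sigma>(out := unary (F (map (\<lambda>r. length (\<sigma> r)) ins)))))"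

lemma computesI:
  "(\<And>ins out base. length ins = k \<Longrightarrow> set ins \<subseteq> {..<base} \<Longrightarrow> out < base \<Longrightarrow> out \<notin> set ins \<Longrightarrow>
     polytime (empty_from base) (\<lambda>\<sigma>. \<sigma>(out := unary (F (map (\<lambda>r. length (\<sigma> r)) ins))))) \<Longrightarrow> computes k F"
  unfolding computes_def by simp

lemma computesD:
  "computes k F \<Longrightarrow> length ins = k \<Longrightarrow> set ins \<subseteq> {..<base} \<Longrightarrow> out < base \<Longrightarrow> out \<notin> set ins \<Longrightarrow>
     polytime (empty_from base) (\<lambda>\<sigma>. \<sigma>(out := unary (F (map (\<lambda>r. length (\<sigma> r)) ins))))"
  unfolding computes_def by simp

lemma lens_upd: "out \<notin> set ins \<Longrightarrow> map (\<lambda>r. length ((\<sigma>(out := xs)) r)) ins = map (\<lambda>r. length (\<sigma> r)) ins"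
  by auto

lemma polytime_copy:
  assumes "q < base" "out < base" "q \<noteq> out"
  shows "polytime (empty_from base) (\<lambda>\<sigma>. \<sigma>(out := unary (length (\<sigma> q))))"
  by (rule polytime_seq[OF polytime_clear[of "empty_from base" out] polytime_add[of q base out "empty_from base"]])
    (use assms in \<open>auto simp: empty_from_def\<close>)

lemma computes_square:
  "computes 1 (\<lambda>xs. (xs ! 0)\<^sup>2 + 2)"
proof (rule computesI)
  fix ins :: "nat list" and out base :: nat
  assume ins: "length ins = 1" "set ins \<subseteq> {..<base}" and out: "out < base" "out \<notin> set ins"
  obtain q where q: "ins = [q]" using ins(1) by (auto simp: length_Suc_conv)
  have d: "q < base" "out \<noteq> q" using ins out by (auto simp: q)
  have 1: "polytime (empty_from base) (\<lambda>\<sigma>. \<sigma>(base := unary (length (\<sigma> q))))"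
    by (rule polytime_weaken[OF polytime_copy[of q "Suc base" base]]) (use d in \<open>auto simp: empty_from_def\<close>)
  have 2: "polytime (empty_from base) (\<lambda>\<sigma>. \<sigma>(base := unary (length (\<sigma> q)), out := []))"
    by (rule polytime_seq[OF 1 polytime_clear[of "\<lambda>_ _. True" out]]) auto
  let ?s = "\<lambda>\<sigma> i. \<sigma>(base := drop i (\<sigma> base), out := unary (i * length (\<sigma> q)) @ \<sigma> out)"
  have 3: "polytime (empty_from (Suc base)) (\<lambda>\<sigma>. ?s \<sigma> (length (\<sigma> base)))"
  proof (rule polytime_foreach[where s = ?s and r = base and q = "\<lambda>m. m * m" and B = "Suc base" and J = "empty_from (Suc base)"
        and \<Phi> = "\<lambda>\<sigma>. \<sigma>(base := tl (\<sigma> base), out := unary (length (\<sigma> q)) @ \<sigma> out)"])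
    show "polytime (empty_from (Suc base)) (\<lambda>\<sigma>. \<sigma>(base := tl (\<sigma> base), out := unary (length (\<sigma> q)) @ \<sigma> out))"
      by (rule polytime_seq[OF polytime_pop[of _ base] polytime_add[of q "Suc base" out "empty_from (Suc base)"]])
        (use d out in \<open>auto simp: empty_from_def\<close>)
    show "poly_bounded (\<lambda>m. m * m)" by (intro poly_bounded_mult poly_bounded_id)
    fix N :: nat and \<sigma> :: stacks and i r'
    assume i: "i < length (\<sigma> base)"
    have "i * length (\<sigma> q) \<le> (N + size_upto (Suc base) \<sigma>) * (N + size_upto (Suc base) \<sigma>)"
      using i length_le_size_upto[of base "Suc base" \<sigma>] length_le_size_upto[of q "Suc base" \<sigma>] d
      by (intro mult_mono) auto
    then show "length (?s \<sigma> i r') \<le> length (\<sigma> r') + (N + size_upto (Suc base) \<sigma>) * (N + size_upto (Suc base) \<sigma>)"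
      by (simp add: trans_le_add1)
  qed (use d out in \<open>auto simp: empty_from_def drop_facts fun_eq_iff replicate_add\<close>)
  have 4: "polytime (empty_from base) (\<lambda>\<sigma>. \<sigma>(out := unary (length (\<sigma> q) * length (\<sigma> q))))"
    by (rule polytime_seq[OF 2 3]) (use d out in \<open>auto simp: empty_from_def fun_eq_iff\<close>)
  have 5: "polytime (\<lambda>_ _. True) (\<lambda>\<sigma>. \<sigma>(out := 1 # 1 # \<sigma> out))"
    by (rule polytime_seq[OF polytime_push_const[of 1 _ out] polytime_push_const[of 1 "\<lambda>_ _. True" out]]) auto
  show "polytime (empty_from base) (\<lambda>\<sigma>. \<sigma>(out := unary ((map (\<lambda>r. length (\<sigma> r)) ins ! 0)\<^sup>2 + 2)))"
    by (rule polytime_seq[OF 4 5]) (auto simp: q power2_eq_square)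
qed

lemma computes_comp:
  assumes g: "computes (length hs) g" and h: "\<forall>h \<in> set hs. computes k h"
  shows "computes k (\<lambda>xs. g (map (\<lambda>h. h xs) hs))"
proof (rule computesI)
  fix ins :: "nat list" and out base :: nat
  assume ins: "length ins = k" "set ins \<subseteq> {..<base}" and out: "out < base" "out \<notin> set ins"
  define m where "m = length hs"
  let ?L = "\<lambda>\<sigma>. map (\<lambda>r. length (\<sigma> r)) ins"
  let ?A = "\<lambda>j \<sigma> r. if base \<le> r \<and> r < base + j then unary ((hs ! (r - base)) (?L \<sigma>)) else \<sigma> r"
  have L: "?L (?A j \<sigma>) = ?L \<sigma>" for j \<sigma> using ins(2) by (auto simp: subset_iff)
  have A: "polytime (empty_from base) (?A j)" if "j \<le> m" for j
    using that
  proof (induction j)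
    case 0
    show ?case by (rule polytime_cong[OF polytime_skip]) (auto simp: fun_eq_iff)
  next
    case (Suc j)
    have step: "polytime (empty_from (base + m)) (\<lambda>\<sigma>. \<sigma>(base + j := unary ((hs ! j) (?L \<sigma>))))"
    proof (rule computesD)
      show "computes k (hs ! j)" using h Suc.prems by (simp add: m_def)
    qed (use ins out Suc.prems in auto)
    show ?case
    proof (rule polytime_seq[OF Suc.IH step])
      show "j \<le> m" using Suc.prems by simp
      fix N \<sigma> assume I: "empty_from base N \<sigma>"
      show "empty_from (base + m) N (?A j \<sigma>)" using I Suc.prems by (simp add: empty_from_def)
      show "(?A j \<sigma>)(base + j := unary ((hs ! j) (?L (?A j \<sigma>)))) = ?A (Suc j) \<sigma>"
        unfolding L by (auto simp: fun_eq_iff)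
    qed
  qed
  let ?C = "\<lambda>j \<sigma> r. if base \<le> r \<and> r < base + j then [] else (\<sigma> r :: nat list)"
  have C: "polytime (\<lambda>_ _. True) (?C j)" for j
  proof (induction j)
    case 0
    show ?case by (rule polytime_cong[OF polytime_skip]) (auto simp: fun_eq_iff)
  next
    case (Suc j)
    show ?case by (rule polytime_seq[OF Suc.IH polytime_clear[of "\<lambda>_ _. True" "base + j"]]) (auto simp: fun_eq_iff)
  qed
  let ?ins = "[base..<base + m]"
  have B: "polytime (empty_from (base + m)) (\<lambda>\<sigma>. \<sigma>(out := unary (g (map (\<lambda>r. length (\<sigma> r)) ?ins))))"
    by (rule computesD[OF g]) (use out in \<open>auto simp: m_def\<close>)
  have AB: "polytime (empty_from base) (\<lambda>\<sigma>. (?A m \<sigma>)(out := unary (g (map (\<lambda>h. h (?L \<sigma>)) hs))))"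
  proof (rule polytime_seq[OF A B])
    fix N \<sigma> assume I: "empty_from base N \<sigma>"
    show "empty_from (base + m) N (?A m \<sigma>)" using I by (simp add: empty_from_def)
    have "map (\<lambda>r. length (?A m \<sigma> r)) ?ins = map (\<lambda>h. h (?L \<sigma>)) hs"
      by (rule nth_equalityI) (auto simp: m_def)
    then show "(?A m \<sigma>)(out := unary (g (map (\<lambda>r. length (?A m \<sigma> r)) ?ins)))
        = (?A m \<sigma>)(out := unary (g (map (\<lambda>h. h (?L \<sigma>)) hs)))" by (simp only:)
  qed simp
  show "polytime (empty_from base) (\<lambda>\<sigma>. \<sigma>(out := unary (g (map (\<lambda>h. h (?L \<sigma>)) hs))))"
    by (rule polytime_seq[OF AB C[of m]]) (use out in \<open>auto simp: empty_from_def fun_eq_iff\<close>)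
qed

text \<open>
  The generators are polynomials, and bounded recursion does not leave the polynomially
  bounded functions. This is why unary numbers suffice.
\<close>

lemma grz2_bound:
  assumes "grzegorczyk 2 k F"
  shows "\<exists>d. \<forall>xs. length xs = k \<longrightarrow> F xs \<le> (sum_list xs + d) ^ d"
proof -
  have sum: "xs ! i \<le> sum_list xs" if "i < length xs" for xs :: "nat list" and i
    using that by (simp add: member_le_sum_list)
  have "\<exists>p. poly_bounded p \<and> (\<forall>xs. length xs = k \<longrightarrow> F xs \<le> p (sum_list xs))"
    using assms
  proof induction
    case (zero k)
    show ?case using poly_bounded_const[of 0] by auto
  next
    case succ
    have "poly_bounded (\<lambda>n. n + 1)" by (intro poly_bounded_add poly_bounded_id poly_bounded_const)
    then show ?case by (intro exI[of _ "\<lambda>n. n + 1"]) (auto simp: length_Suc_conv)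
  next
    case (proj i k)
    then show ?case using sum[of i] poly_bounded_id by (intro exI[of _ "\<lambda>n. n"]) simp
  next
    case add
    have "poly_bounded (\<lambda>n. n + n)" by (intro poly_bounded_add poly_bounded_id)
    then show ?case by (intro exI[of _ "\<lambda>n. n + n"]) (auto simp: length_Suc_conv numeral_2_eq_2)
  next
    case (gen m)
    have "poly_bounded (\<lambda>n. n\<^sup>2 + 2)" by (intro poly_bounded_add poly_bounded_power poly_bounded_id poly_bounded_const)
    moreover have "m = 0" using gen by simp
    ultimately show ?case by (intro exI[of _ "\<lambda>n. n\<^sup>2 + 2"]) (auto simp: length_Suc_conv)
  next
    case (comp hs g k)
    have "\<exists>p. poly_bounded p \<and> (\<forall>xs. length xs = k \<longrightarrow> sum_list (map (\<lambda>h. h xs) hs') \<le> p (sum_list xs))"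
      if "set hs' \<subseteq> set hs" for hs'
      using that
    proof (induction hs')
      case Nil
      show ?case using poly_bounded_const[of 0] by auto
    next
      case (Cons h hs')
      then obtain p where p: "poly_bounded p" "\<And>xs. length xs = k \<Longrightarrow> sum_list (map (\<lambda>h. h xs) hs') \<le> p (sum_list xs)"
        by auto
      obtain q where q: "poly_bounded q" "\<And>xs. length xs = k \<Longrightarrow> h xs \<le> q (sum_list xs)"
        using comp.IH(2) Cons.prems by auto
      have "poly_bounded (\<lambda>n. q n + p n)" by (intro poly_bounded_add p q)
      then show ?case using p(2) q(2) by (intro exI[of _ "\<lambda>n. q n + p n"]) (simp add: add_mono)
    qed
    then obtain p where p: "poly_bounded p" "\<And>xs. length xs = k \<Longrightarrow> sum_list (map (\<lambda>h. h xs) hs) \<le> p (sum_list xs)"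
      by blast
    obtain q where q: "poly_bounded q" "\<And>xs. length xs = length hs \<Longrightarrow> g xs \<le> q (sum_list xs)"
      using comp.IH(1) by blast
    obtain d where d: "\<And>n. q n \<le> (n + d) ^ d" using q(1) unfolding poly_bounded_def by blast
    have "g (map (\<lambda>h. h xs) hs) \<le> (p (sum_list xs) + d) ^ d" if "length xs = k" for xs
    proof -
      have "g (map (\<lambda>h. h xs) hs) \<le> q (sum_list (map (\<lambda>h. h xs) hs))" by (rule q(2)) simp
      also have "\<dots> \<le> (sum_list (map (\<lambda>h. h xs) hs) + d) ^ d" by (rule d)
      also have "\<dots> \<le> (p (sum_list xs) + d) ^ d" using p(2)[OF that] by (intro power_mono) auto
      finally show ?thesis .
    qed
    moreover have "poly_bounded (\<lambda>n. (p n + d) ^ d)" by (intro poly_bounded_power poly_bounded_add p poly_bounded_const)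
    ultimately show ?case by blast
  next
    case (bounded_rec k g h b)
    then obtain p where p: "poly_bounded p" "\<And>xs. length xs = k + 1 \<Longrightarrow> b xs \<le> p (sum_list xs)" by blast
    have "prim_rec g h xs \<le> p (sum_list xs)" if "length xs = k + 1" for xs
    proof -
      have "prim_rec g h xs \<le> b xs" using bounded_rec.hyps(4) that by blast
      then show ?thesis using p(2)[OF that] by (rule order_trans)
    qed
    then show ?case using p(1) by blast
  qed
  then obtain p where p: "poly_bounded p" "\<And>xs. length xs = k \<Longrightarrow> F xs \<le> p (sum_list xs)" by blast
  obtain d where d: "\<And>n. p n \<le> (n + d) ^ d" using p(1) unfolding poly_bounded_def by blast
  have "F xs \<le> (sum_list xs + d) ^ d" if "length xs = k" for xs
    using p(2)[OF that] d[of "sum_list xs"] by simp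
  then show ?thesis by blast
qed

text \<open>
  The loop keeps the counter, the current argument, the previous value and the new value on
  the four stacks from base on.
\<close>

lemma computes_prim_rec:
  assumes g: "computes k g" and h: "computes (k + 2) h"
    and bound: "\<And>xs. length xs = k + 1 \<Longrightarrow> prim_rec g h xs \<le> (sum_list xs + d) ^ d"
  shows "computes (k + 1) (prim_rec g h)"
proof (rule computesI)
  fix ins :: "nat list" and out base :: nat
  assume ins: "length ins = k + 1" "set ins \<subseteq> {..<base}" and out: "out < base" "out \<notin> set ins"
  obtain q rest where q: "ins = q # rest" "length rest = k" using ins(1) by (cases ins) auto
  have dist: "q < base" "set rest \<subseteq> {..<base}" "out \<noteq> q" "out \<notin> set rest" using ins out by (auto simp: q)
  have notin: "x \<notin> set rest" if "base \<le> x" for x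
    using subsetD[OF dist(2), of x] that by auto
  let ?L = "\<lambda>\<sigma>. map (\<lambda>r. length (\<sigma> r)) rest"
  let ?R = "\<lambda>\<sigma> i. rec_nat (g (?L \<sigma>)) (\<lambda>y r. h (y # r # ?L \<sigma>)) i"
  have 1: "polytime (empty_from base) (\<lambda>\<sigma>. \<sigma>(base := unary (length (\<sigma> q))))"
    by (rule polytime_weaken[OF polytime_copy[of q "Suc base" base]]) (use dist in \<open>auto simp: empty_from_def\<close>)
  have g': "polytime (empty_from (base + 4)) (\<lambda>\<sigma>. \<sigma>(base + 2 := unary (g (?L \<sigma>))))"
    by (rule computesD[OF g]) (use q dist notin in auto)
  have 2: "polytime (empty_from base) (\<lambda>\<sigma>. \<sigma>(base := unary (length (\<sigma> q)), base + 2 := unary (g (?L \<sigma>))))"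
    by (rule polytime_seq[OF 1 g'], simp add: empty_from_def, simp add: lens_upd notin del: fun_upd_apply)

  let ?J = "\<lambda>N \<sigma>. empty_from (base + 3) N \<sigma>"
  have h': "polytime (empty_from (base + 4)) (\<lambda>\<sigma>. \<sigma>(base + 3 := unary (h (map (\<lambda>r. length (\<sigma> r)) ((base + 1) # (base + 2) # rest)))))"
    by (rule computesD[OF h]) (use q dist notin in auto)
  have b1: "polytime ?J (\<lambda>\<sigma>. \<sigma>(base := tl (\<sigma> base), base + 3 := unary (h (length (\<sigma> (base + 1)) # length (\<sigma> (base + 2)) # ?L \<sigma>))))"
    by (rule polytime_seq[OF polytime_pop[of _ base] h'], simp add: empty_from_def)
      (simp add: lens_upd notin del: fun_upd_apply, simp)
  have b2: "polytime ?J (\<lambda>\<sigma>. \<sigma>(base := tl (\<sigma> base), base + 3 := unary (h (length (\<sigma> (base + 1)) # length (\<sigma> (base + 2)) # ?L \<sigma>)),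
      base + 2 := []))"
    by (rule polytime_seq[OF b1 polytime_clear[of "\<lambda>_ _. True" "base + 2"]]) auto
  have b3: "polytime ?J (\<lambda>\<sigma>. \<sigma>(base := tl (\<sigma> base), base + 2 := unary (h (length (\<sigma> (base + 1)) # length (\<sigma> (base + 2)) # ?L \<sigma>))))"
    by (rule polytime_seq[OF b2 polytime_move[of "base + 3" "base + 2" "\<lambda>_ _. True"]]) (auto simp: fun_eq_iff empty_from_def)
  have body: "polytime ?J (\<lambda>\<sigma>. \<sigma>(base := tl (\<sigma> base), base + 2 := unary (h (length (\<sigma> (base + 1)) # length (\<sigma> (base + 2)) # ?L \<sigma>)),
      base + 1 := 1 # \<sigma> (base + 1)))"
    by (rule polytime_seq[OF b3 polytime_push_const[of 1 "\<lambda>_ _. True" "base + 1"]]) (auto simp: fun_eq_iff)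

  let ?I = "\<lambda>N \<sigma>. empty_from (base + 3) N \<sigma> \<and> \<sigma> (base + 1) = [] \<and> \<sigma> (base + 2) = unary (g (?L \<sigma>))"
  let ?s = "\<lambda>\<sigma> i. \<sigma>(base := drop i (\<sigma> base), base + 1 := unary i, base + 2 := unary (?R \<sigma> i))"
  have Ls: "?L (?s \<sigma> i) = ?L \<sigma>" for \<sigma> i using notin by (simp add: lens_upd del: fun_upd_apply)
  have 3: "polytime ?I (\<lambda>\<sigma>. ?s \<sigma> (length (\<sigma> base)))"
  proof (rule polytime_foreach[where s = ?s and q = "\<lambda>m. m + (m + k * m + d) ^ d" and B = "Suc base" and r = base, OF body])
    show "poly_bounded (\<lambda>m. m + (m + k * m + d) ^ d)" by (intro poly_bounded_power poly_bounded_add poly_bounded_mult poly_bounded_id poly_bounded_const)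
    fix N :: nat and \<sigma> :: stacks and i r'
    assume I: "?I N \<sigma>"
    show "?s \<sigma> 0 = \<sigma>" using I by (auto simp: fun_eq_iff)
    assume i: "i < length (\<sigma> base)"
    show "empty_from (base + 3) N (?s \<sigma> i)" using I by (simp add: empty_from_def)
    show "(\<lambda>\<sigma>. \<sigma>(base := tl (\<sigma> base), base + 2 := unary (h (length (\<sigma> (base + 1)) # length (\<sigma> (base + 2)) # ?L \<sigma>)),
      base + 1 := 1 # \<sigma> (base + 1))) (?s \<sigma> i) = ?s \<sigma> (Suc i)"
      unfolding Ls by (auto simp: fun_eq_iff drop_facts[OF i])
    let ?m = "N + size_upto (Suc base) \<sigma>"
    have "?R \<sigma> i = prim_rec g h (i # ?L \<sigma>)" by (simp add: prim_rec_def)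
    also have "\<dots> \<le> (sum_list (i # ?L \<sigma>) + d) ^ d" by (rule bound) (simp add: q)
    also have "\<dots> \<le> (?m + k * ?m + d) ^ d"
    proof (intro power_mono add_mono)
      have "sum_list (?L \<sigma>) \<le> length rest * ?m"
      proof -
        have "sum_list (map (\<lambda>r. length (\<sigma> r)) rest) \<le> sum_list (map (\<lambda>_. ?m) rest)"
        proof (rule sum_list_mono)
          fix r assume "r \<in> set rest"
          then have "r < Suc base" using dist(2) by auto
          then show "length (\<sigma> r) \<le> ?m" using length_le_size_upto[of r "Suc base" \<sigma>] by simp
        qed
        then show ?thesis by (simp add: sum_list_triv)
      qed
      moreover have "i \<le> ?m" using i length_le_size_upto[of base "Suc base" \<sigma>] by simp
      ultimately show "sum_list (i # ?L \<sigma>) \<le> ?m + k * ?m" by (simp add: q(2))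
    qed auto
    finally have "?R \<sigma> i \<le> (?m + k * ?m + d) ^ d" .
    moreover have "i \<le> ?m" using i length_le_size_upto[of base "Suc base" \<sigma>] by simp
    ultimately show "length (?s \<sigma> i r') \<le> length (\<sigma> r') + (?m + (?m + k * ?m + d) ^ d)"
      by (auto simp: trans_le_add1 trans_le_add2)
  qed (auto simp: fun_eq_iff)
  have 4: "polytime (empty_from base) (\<lambda>\<sigma>. \<sigma>(base + 1 := unary (length (\<sigma> q)), base + 2 := unary (?R \<sigma> (length (\<sigma> q)))))"
  proof (rule polytime_seq[OF 2 3])
    fix N \<sigma> assume I: "empty_from base N \<sigma>"
    let ?t = "\<sigma>(base := unary (length (\<sigma> q)), base + 2 := unary (g (?L \<sigma>)))"
    have L: "?L ?t = ?L \<sigma>" by (simp add: lens_upd notin del: fun_upd_apply)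
    show "?I N ?t" unfolding L using I by (simp add: empty_from_def)
    show "?s ?t (length (?t base)) = \<sigma>(base + 1 := unary (length (\<sigma> q)), base + 2 := unary (?R \<sigma> (length (\<sigma> q))))"
      unfolding L using I by (auto simp: fun_eq_iff empty_from_def)
  qed
  have 5: "polytime (empty_from base) (\<lambda>\<sigma>. \<sigma>(base + 2 := unary (?R \<sigma> (length (\<sigma> q)))))"
    by (rule polytime_seq[OF 4 polytime_clear[of "\<lambda>_ _. True" "base + 1"]]) (auto simp: fun_eq_iff empty_from_def)
  have 6: "polytime (empty_from base) (\<lambda>\<sigma>. \<sigma>(base + 2 := unary (?R \<sigma> (length (\<sigma> q))), out := []))"
    by (rule polytime_seq[OF 5 polytime_clear[of "\<lambda>_ _. True" out]]) (auto simp: fun_eq_iff empty_from_def)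
  show "polytime (empty_from base) (\<lambda>\<sigma>. \<sigma>(out := unary (prim_rec g h (map (\<lambda>r. length (\<sigma> r)) ins))))"
    by (rule polytime_seq[OF 6 polytime_move[of "base + 2" out "\<lambda>_ _. True"]])
      (use out in \<open>auto simp: fun_eq_iff empty_from_def prim_rec_def q\<close>)
qed

text \<open>
  Every function of the second Grzegorczyk class runs in time polynomial in its arguments,
  since all intermediate values are polynomially bounded and the number of rounds of each
  loop is one of these values.
\<close>

theorem computes_grz2:
  assumes "grzegorczyk 2 k F" shows "computes k F"
  using assms
proof induction
  case (zero k)
  show ?case by (rule computesI) (simp add: polytime_clear)
next
  case succ
  show ?case
  proof (rule computesI)
    fix ins :: "nat list" and out base :: nat
    assume ins: "length ins = 1" "set ins \<subseteq> {..<base}" and out: "out < base" "out \<notin> set ins"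
    obtain q where q: "ins = [q]" using ins(1) by (auto simp: length_Suc_conv)
    show "polytime (empty_from base) (\<lambda>\<sigma>. \<sigma>(out := unary (Suc (map (\<lambda>r. length (\<sigma> r)) ins ! 0))))"
      by (rule polytime_seq[OF polytime_copy[of q base out] polytime_push_const[of 1 "\<lambda>_ _. True" out]])
        (use ins out in \<open>auto simp: q\<close>)
  qed
next
  case (proj i k)
  show ?case
  proof (rule computesI)
    fix ins :: "nat list" and out base :: nat
    assume ins: "length ins = k" "set ins \<subseteq> {..<base}" and out: "out < base" "out \<notin> set ins"
    have "ins ! i \<in> set ins" using proj ins(1) by simp
    then have "polytime (empty_from base) (\<lambda>\<sigma>. \<sigma>(out := unary (length (\<sigma> (ins ! i)))))"
      using ins out by (intro polytime_copy) auto
    then show "polytime (empty_from base) (\<lambda>\<sigma>. \<sigma>(out := unary (map (\<lambda>r. length (\<sigma> r)) ins ! i)))"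
      using proj ins(1) by simp
  qed
next
  case add
  show ?case
  proof (rule computesI)
    fix ins :: "nat list" and out base :: nat
    assume ins: "length ins = 2" "set ins \<subseteq> {..<base}" and out: "out < base" "out \<notin> set ins"
    obtain q r where q: "ins = [q, r]" using ins(1) by (auto simp: length_Suc_conv numeral_2_eq_2)
    show "polytime (empty_from base) (\<lambda>\<sigma>. \<sigma>(out := unary (map (\<lambda>r. length (\<sigma> r)) ins ! 0 + map (\<lambda>r. length (\<sigma> r)) ins ! 1)))"
      by (rule polytime_seq[OF polytime_copy[of q base out] polytime_add[of r base out "empty_from base"]])
        (use ins out in \<open>auto simp: q empty_from_def replicate_add[symmetric] add.commute\<close>)
  qed
next
  case (gen m)
  then have "m = 0" by simp
  then show ?case using computes_square by simp
next
  case (comp hs g k)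
  then show ?case by (intro computes_comp) auto
next
  case (bounded_rec k g h b)
  obtain d where d: "\<And>xs. length xs = k + 1 \<Longrightarrow> b xs \<le> (sum_list xs + d) ^ d"
    using grz2_bound[OF bounded_rec.hyps(3)] by blast
  show ?case
  proof (rule computes_prim_rec)
    show "prim_rec g h xs \<le> (sum_list xs + d) ^ d" if "length xs = k + 1" for xs
    proof -
      have "prim_rec g h xs \<le> b xs" using bounded_rec.hyps(4) that by blast
      then show ?thesis using d[OF that] by (rule order_trans)
    qed
  qed (use bounded_rec.IH in auto)
qed

section \<open>Numerals and unary numbers\<close>

text \<open>
  Horner evaluation of a numeral on a tape, whose digits are shifted by one.
\<close>

definition val :: "nat list \<Rightarrow> nat" where
  "val w = foldl (\<lambda>v s. 2 * v + (s - 1)) 0 w"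

lemma val_simps [simp]: "val [] = 0" "val (w @ [s]) = 2 * val w + (s - 1)"
  by (simp_all add: val_def)

lemma val_le_append: "val u \<le> val (u @ v)"
proof (induction v rule: rev_induct)
  case (snoc s v)
  then show ?case using val_simps(2)[of "u @ v" s] by simp
qed simp

lemma val_word: "val (word n) = n"
proof (induction n rule: less_induct)
  case (less n)
  show ?case
  proof (cases "n < 2")
    case True
    then show ?thesis using val_simps(2)[of "[]" "Suc n"] by (simp add: word_less_2)
  next
    case False
    then show ?thesis using less[of "n div 2"] by (simp add: word_rec)
  qed
qed

lemma set_word: "set (word n) \<subseteq> {1, 2}"
proof (induction n rule: less_induct)
  case (less n)
  show ?case
  proof (cases "n < 2")
    case True
    then show ?thesis by (simp add: word_less_2) linarith
  next
    case False
    have "n mod 2 < 2" by simp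
    then have "Suc (n mod 2) \<in> {1, 2}" by (cases "n mod 2 = 0") auto
    moreover have "set (word (n div 2)) \<subseteq> {1, 2}" using False by (intro less) simp
    moreover have "word n = word (n div 2) @ [Suc (n mod 2)]" using False by (intro word_rec) simp
    ultimately show ?thesis by (simp only: set_append) simp
  qed
qed

definition input_stacks :: "nat \<Rightarrow> stacks" where
  "input_stacks n = (\<lambda>r. if r = 0 then word n else [])"

text \<open>
  The unary value is exponential in the length of the numeral; this is the place where the
  parameter N is needed in the time bound.
\<close>

lemma polytime_to_unary:
  "polytime (\<lambda>N \<sigma>. \<sigma> = input_stacks N) (\<lambda>\<sigma>. \<sigma>(0 := [], 1 := unary (val (\<sigma> 0))))"
proof -
  let ?d = "\<lambda>\<sigma> i. \<sigma>(1 := drop i (\<sigma> 1), 2 := unary (2 * i) @ \<sigma> 2)"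
  have d0: "polytime (\<lambda>_ _. True) (\<lambda>\<sigma>. \<sigma>(1 := tl (\<sigma> 1), 2 := 1 # \<sigma> 2))"
    by (rule polytime_seq[OF polytime_pop[of _ 1] polytime_push_const[of 1 "\<lambda>_ _. True" 2]]) auto
  have d1: "polytime (\<lambda>_ _. True) (\<lambda>\<sigma>. \<sigma>(1 := tl (\<sigma> 1), 2 := 1 # 1 # \<sigma> 2))"
    by (rule polytime_seq[OF d0 polytime_push_const[of 1 "\<lambda>_ _. True" 2]]) auto
  have d2: "polytime (\<lambda>_ _. True) (\<lambda>\<sigma>. ?d \<sigma> (length (\<sigma> 1)))"
  proof (rule polytime_foreach[where s = ?d and q = "\<lambda>m. 2 * m" and B = 2, OF d1])
    show "poly_bounded (\<lambda>m. 2 * m)" by (intro poly_bounded_mult poly_bounded_id poly_bounded_const)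
    fix N :: nat and \<sigma> :: stacks and i r'
    assume "i < length (\<sigma> 1)"
    then show "length (?d \<sigma> i r') \<le> length (\<sigma> r') + 2 * (N + size_upto 2 \<sigma>)"
      using length_le_size_upto[of 1 2 \<sigma>] by auto
  qed (auto simp: drop_facts fun_eq_iff)
  let ?J = "\<lambda>N \<sigma>. \<sigma> 0 \<noteq> [] \<and> \<sigma> 2 = []"
  have d3: "polytime ?J (\<lambda>\<sigma>. \<sigma>(1 := [], 2 := unary (2 * length (\<sigma> 1))))"
    by (rule polytime_weaken[OF d2]) (auto simp: fun_eq_iff)
  have 1: "polytime ?J (\<lambda>\<sigma>. \<sigma>(1 := unary (2 * length (\<sigma> 1))))"
    by (rule polytime_seq[OF d3 polytime_move[of 2 1 "\<lambda>_ _. True"]]) (auto simp: fun_eq_iff)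
  have 2: "polytime (\<lambda>_ _. True) (\<lambda>\<sigma>. if top_symbol (\<sigma> 0) \<in> {2} then \<sigma>(1 := 1 # \<sigma> 1) else \<sigma>)"
    by (rule polytime_if[OF polytime_push_const polytime_skip]) simp
  have 3: "polytime ?J (\<lambda>\<sigma>. \<sigma>(1 := (if top_symbol (\<sigma> 0) = 2 then [1] else []) @ unary (2 * length (\<sigma> 1))))"
    by (rule polytime_seq[OF 1 2]) (auto simp: fun_eq_iff)
  have body: "polytime ?J (\<lambda>\<sigma>. \<sigma>(1 := (if top_symbol (\<sigma> 0) = 2 then [1] else []) @ unary (2 * length (\<sigma> 1)), 0 := tl (\<sigma> 0)))"
    by (rule polytime_seq[OF 3 polytime_pop[of "\<lambda>_ _. True" 0]]) auto
  let ?s = "\<lambda>\<sigma> i. \<sigma>(0 := drop i (\<sigma> 0), 1 := unary (val (take i (\<sigma> 0))))"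
  have "polytime (\<lambda>N \<sigma>. \<sigma> = input_stacks N) (\<lambda>\<sigma>. ?s \<sigma> (length (\<sigma> 0)))"
  proof (rule polytime_foreach[where s = ?s and q = "\<lambda>m. m" and B = 0, OF body])
    fix N \<sigma> and i r' :: nat
    assume \<sigma>: "\<sigma> = input_stacks N"
    show "?s \<sigma> 0 = \<sigma>" by (auto simp: \<sigma> input_stacks_def fun_eq_iff)
    assume i: "i < length (\<sigma> 0)"
    show "?s \<sigma> i 0 \<noteq> [] \<and> ?s \<sigma> i 2 = []" using i by (simp add: \<sigma> input_stacks_def)
    have take: "take (Suc i) (\<sigma> 0) = take i (\<sigma> 0) @ [\<sigma> 0 ! i]" using i by (rule take_Suc_conv_app_nth)
    have "\<sigma> 0 ! i \<in> {1, 2}" using set_word[of N] nth_mem[OF i] by (auto simp: \<sigma> input_stacks_def)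
    then have "(if \<sigma> 0 ! i = 2 then [1] else []) @ unary (2 * val (take i (\<sigma> 0))) = unary (val (take (Suc i) (\<sigma> 0)))"
      unfolding take by auto
    then show "(\<lambda>\<sigma>. \<sigma>(1 := (if top_symbol (\<sigma> 0) = 2 then [1] else []) @ unary (2 * length (\<sigma> 1)), 0 := tl (\<sigma> 0))) (?s \<sigma> i)
        = ?s \<sigma> (Suc i)"
      using drop_facts[OF i] by (auto simp: fun_eq_iff)
    have "val (take i (\<sigma> 0)) \<le> val (\<sigma> 0)" using val_le_append[of "take i (\<sigma> 0)" "drop i (\<sigma> 0)"] by simp
    also have "val (\<sigma> 0) = N" by (simp add: \<sigma> input_stacks_def val_word)
    finally show "length (?s \<sigma> i r') \<le> length (\<sigma> r') + (N + size_upto 0 \<sigma>)" by auto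
  qed (simp_all add: poly_bounded_id)
  then show ?thesis by (rule polytime_cong) simp
qed

lemma word_digits: "word 0 = [1]" "word 1 = [2]" "word 2 = [2, 1]"
  using word_rec[of 2] by (simp_all add: word_less_2)

lemma polytime_output:
  "polytime (\<lambda>N \<sigma>. \<sigma> 0 = [] \<and> (\<exists>k\<le>2. \<sigma> 2 = unary k)) (\<lambda>\<sigma>. \<sigma>(0 := word (length (\<sigma> 2)), 2 := tl (\<sigma> 2)))"
proof -
  let ?T = "\<lambda>_ _. True"
  have 21: "polytime ?T (\<lambda>\<sigma>. \<sigma>(0 := 2 # 1 # \<sigma> 0))"
    by (rule polytime_seq[OF polytime_push_const[of 1 _ 0] polytime_push_const[of 2 ?T 0]]) auto
  have in2: "polytime ?T (\<lambda>\<sigma>. if top_symbol (\<sigma> 2) \<in> {1} then \<sigma>(0 := 2 # 1 # \<sigma> 0) else \<sigma>(0 := 2 # \<sigma> 0))"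
    by (rule polytime_if) (rule polytime_weaken[OF 21], simp, simp, rule polytime_push_const, simp)
  have pop: "polytime ?T (\<lambda>\<sigma>. if top_symbol (tl (\<sigma> 2)) \<in> {1} then \<sigma>(2 := tl (\<sigma> 2), 0 := 2 # 1 # \<sigma> 0) else \<sigma>(2 := tl (\<sigma> 2), 0 := 2 # \<sigma> 0))"
    by (rule polytime_seq[OF polytime_pop[of _ 2] in2]) (simp, simp)
  have "polytime ?T (\<lambda>\<sigma>. if top_symbol (\<sigma> 2) \<in> {1} then
       (if top_symbol (tl (\<sigma> 2)) \<in> {1} then \<sigma>(2 := tl (\<sigma> 2), 0 := 2 # 1 # \<sigma> 0) else \<sigma>(2 := tl (\<sigma> 2), 0 := 2 # \<sigma> 0))
     else \<sigma>(0 := 1 # \<sigma> 0))"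
    by (rule polytime_if) (rule polytime_weaken[OF pop], simp, simp, rule polytime_push_const, simp)
  then show ?thesis
  proof (rule polytime_weaken)
    fix N :: nat and \<sigma> :: stacks
    assume "\<sigma> 0 = [] \<and> (\<exists>k\<le>2. \<sigma> 2 = unary k)"
    then obtain k where k: "\<sigma> 0 = []" "k \<le> 2" "\<sigma> 2 = unary k" by blast
    then have "k = 0 \<or> k = 1 \<or> k = 2" by linarith
    then show "(if top_symbol (\<sigma> 2) \<in> {1} then
       (if top_symbol (tl (\<sigma> 2)) \<in> {1} then \<sigma>(2 := tl (\<sigma> 2), 0 := 2 # 1 # \<sigma> 0) else \<sigma>(2 := tl (\<sigma> 2), 0 := 2 # \<sigma> 0))
     else \<sigma>(0 := 1 # \<sigma> 0)) = \<sigma>(0 := word (length (\<sigma> 2)), 2 := tl (\<sigma> 2))"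
      using k(1,3) word_digits
      by (elim disjE) (simp_all add: fun_upd_twist fun_eq_iff numeral_2_eq_2)
  qed simp
qed

definition unary_stacks :: "nat \<Rightarrow> stacks" where
  "unary_stacks n = (\<lambda>r. if r = 1 then unary n else [])"

theorem poly_time_of_unary:
  assumes polytime: "polytime (\<lambda>N \<sigma>. \<sigma> = unary_stacks N) \<Psi>"
    and result: "\<And>n. \<Psi> (unary_stacks n) 0 = []" "\<And>n. \<Psi> (unary_stacks n) 2 = unary (f n)"
    and range: "\<And>n. f n \<le> 2"
  shows "f \<in> poly_time_in_argument"
proof -
  have eq: "(input_stacks N)(0 := [], 1 := unary (val (input_stacks N 0))) = unary_stacks N" for N
    by (auto simp: fun_eq_iff input_stacks_def unary_stacks_def val_word)
  have 1: "polytime (\<lambda>N \<sigma>. \<sigma> = input_stacks N) (\<lambda>\<sigma>. \<Psi> (\<sigma>(0 := [], 1 := unary (val (\<sigma> 0)))))"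
    by (rule polytime_seq[OF polytime_to_unary polytime]) (simp_all only: eq)
  let ?\<Phi> = "\<lambda>\<sigma>. (\<lambda>\<tau>. \<tau>(0 := word (length (\<tau> 2)), 2 := tl (\<tau> 2))) (\<Psi> (\<sigma>(0 := [], 1 := unary (val (\<sigma> 0)))))"
  have 2: "polytime (\<lambda>N \<sigma>. \<sigma> = input_stacks N) ?\<Phi>"
  proof (rule polytime_seq[OF 1 polytime_output])
    fix N \<sigma> assume "\<sigma> = input_stacks N"
    then have "\<Psi> (\<sigma>(0 := [], 1 := unary (val (\<sigma> 0)))) = \<Psi> (unary_stacks N)" using eq by simp
    then show "\<Psi> (\<sigma>(0 := [], 1 := unary (val (\<sigma> 0)))) 0 = [] \<and> (\<exists>k\<le>2. \<Psi> (\<sigma>(0 := [], 1 := unary (val (\<sigma> 0)))) 2 = unary k)"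
      using result range by auto
  qed simp
  show ?thesis
  proof (rule polytime_poly_time[OF 2])
    show "(\<lambda>r. if r = 0 then word n else []) = input_stacks n" for n by (simp add: input_stacks_def)
    show "?\<Phi> (\<lambda>r. if r = 0 then word n else []) 0 = word (f n)" for n
    proof -
      have "?\<Phi> (input_stacks n) 0 = word (f n)" by (simp only: eq) (simp add: result)
      then show ?thesis by (simp only: input_stacks_def)
    qed
  qed
qed

lemma computes_poly_time:
  assumes "computes 1 (\<lambda>xs. f (xs ! 0))" "range f \<subseteq> {0, 1, 2}"
  shows "f \<in> poly_time_in_argument"
proof (rule poly_time_of_unary)
  have "polytime (empty_from 3) (\<lambda>\<sigma>. \<sigma>(2 := unary (f (map (\<lambda>r. length (\<sigma> r)) [1] ! 0))))"
    by (rule computesD[OF assms(1)]) auto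
  then show "polytime (\<lambda>N \<sigma>. \<sigma> = unary_stacks N) (\<lambda>\<sigma>. \<sigma>(2 := unary (f (length (\<sigma> 1)))))"
    by (rule polytime_weaken) (auto simp: empty_from_def unary_stacks_def)
  show "f n \<le> 2" for n
  proof -
    have "f n \<in> {0, 1, 2}" using assms(2) by (rule subsetD) (rule rangeI)
    then show ?thesis by auto
  qed
qed (simp_all add: unary_stacks_def)

lemma grz2_poly_time:
  assumes "f \<in> grzegorczyk_unary 2" "range f \<subseteq> {0, 1, 2}"
  shows "f \<in> poly_time_in_argument"
proof (rule computes_poly_time[OF _ assms(2)])
  obtain F where F: "grzegorczyk 2 1 F" "\<And>x. f x = F [x]"
    using assms(1) unfolding grzegorczyk_unary_def by blast
  have F': "F (map (\<lambda>r. length (\<sigma> r)) ins) = f (map (\<lambda>r. length (\<sigma> r)) ins ! 0)" if "length ins = 1" for \<sigma> :: stacks and ins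
    using that by (auto simp: F(2) length_Suc_conv)
  show "computes 1 (\<lambda>xs. f (xs ! 0))"
    by (rule computesI) (use computesD[OF computes_grz2[OF F(1)]] F' in \<open>simp del: One_nat_def\<close>)
qed

lemma computes_cong:
  assumes "computes k F" "\<And>xs. length xs = k \<Longrightarrow> F xs = G xs" shows "computes k G"
  unfolding computes_def
proof (intro allI impI)
  fix ins :: "nat list" and out base :: nat
  assume *: "length ins = k" "set ins \<subseteq> {..<base}" "out < base" "out \<notin> set ins"
  have "F (map (\<lambda>r. length (\<sigma> r)) ins) = G (map (\<lambda>r. length (\<sigma> r)) ins)" for \<sigma> :: stacks
    by (rule assms(2)) (simp add: *(1))
  then show "polytime (empty_from base) (\<lambda>\<sigma>. \<sigma>(out := unary (G (map (\<lambda>r. length (\<sigma> r)) ins))))"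
    using computesD[OF assms(1) *] by simp
qed

lemma computes_grz: "grz 2 k F \<Longrightarrow> computes k F"
  unfolding grz.fn_def using computes_cong[OF computes_grz2] by blast

lemma grz_div2:
  assumes "grz 2 k a" shows "grz 2 k (\<lambda>xs. a xs div 2)"
proof -
  have eq: "rec_nat 0 (\<lambda>y r. r + y mod 2) m = m div (2::nat)" for m
    by (induction m) (auto, presburger+)
  have "grz 2 1 (\<lambda>xs. rec_nat 0 (\<lambda>y r. (y # r # xs) ! 1 + (y # r # xs) ! 0 mod 2) (xs ! 0))"
  proof (rule grz_rec[where b = "\<lambda>us. us ! 0"])
    show "rec_nat 0 (\<lambda>y r. (y # r # xs) ! 1 + (y # r # xs) ! 0 mod 2) m \<le> (m # xs) ! 0" for m and xs :: "nat list"
      using eq[of m] by simp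
  qed (auto intro!: grz.fn_proj grz.fn_const grz_add grz_mod2)
  then have "grz 2 1 (\<lambda>xs. xs ! 0 div 2)" using eq by simp
  then show ?thesis using assms by (rule grz.fn_app1)
qed

text \<open>
  The last i digits of n as they are piled up by repeated halving. They are shifted by two:
  once for the encoding of digits on tapes, and once for the encoding of visited cells below.
\<close>

primrec digit_prefix :: "nat \<Rightarrow> nat \<Rightarrow> nat list" where
  "digit_prefix n 0 = []"
| "digit_prefix n (Suc i) = (2 + n div 2 ^ i mod 2) # digit_prefix n i"

lemma length_digit_prefix [simp]: "length (digit_prefix n i) = i"
  by (induction i) auto

lemma digit_prefix_Suc: "digit_prefix n (Suc i) = digit_prefix (n div 2) i @ [2 + n mod 2]"
  by (induction i) (simp_all add: div_mult2_eq)

lemma digit_prefix_word: "digit_prefix n (length (word n)) = map Suc (word n)"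
proof (induction n rule: less_induct)
  case (less n)
  show ?case
  proof (cases "n < 2")
    case True
    then show ?thesis by (simp add: word_less_2)
  next
    case False
    then have "length (word n) = Suc (length (word (n div 2)))" by (simp add: word_rec)
    then show ?thesis using less[of "n div 2"] False word_rec[of n] by (simp add: digit_prefix_Suc del: digit_prefix.simps)
  qed
qed

lemma div_power_word: "n div 2 ^ length (word n) = 0" "0 < i \<Longrightarrow> i < length (word n) \<Longrightarrow> n div 2 ^ i \<noteq> 0"
proof (induction n arbitrary: i rule: less_induct)
  case (less n)
  { case 1
    show ?case
    proof (cases "n < 2")
      case False
      then have "n div 2 div 2 ^ length (word (n div 2)) = 0" by (intro less) simp
      then show ?thesis using False by (simp add: word_rec div_mult2_eq)
    qed (simp add: word_less_2)
  next
    case 2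
    show ?case
    proof (cases "n < 2")
      case True
      then show ?thesis using 2 by (simp add: word_less_2)
    next
      case False
      obtain j where j: "i = Suc j" using 2 by (cases i) auto
      have "n div 2 div 2 ^ j \<noteq> 0"
      proof (cases "j = 0")
        case True
        then show ?thesis using False by simp
      next
        case nz: False
        then show ?thesis using False 2 j by (intro less(2)) (simp_all add: word_rec)
      qed
      then show ?thesis by (simp add: j div_mult2_eq)
    qed
  }
qed

text \<open>
  Halving produces the digits from the least significant one on, so the stack ends with the
  most significant one on top. The stack with the flag makes the loop run once even for the
  number 0, whose numeral has one digit.
\<close>

lemma polytime_word:
  assumes q: "q < b"
  shows "polytime (empty_from b) (\<lambda>\<sigma>. \<sigma>(b := map Suc (word (length (\<sigma> q)))))"
proof -
  let ?T = "\<lambda>_ _. True"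
  have cm: "computes 1 (\<lambda>xs. xs ! 0 mod 2)" and cd: "computes 1 (\<lambda>xs. xs ! 0 div 2)"
    by (intro computes_grz grz_mod2 grz_div2 grz.fn_proj; simp)+
  have m: "polytime (empty_from (b + 5)) (\<lambda>\<sigma>. \<sigma>(b + 3 := unary (length (\<sigma> (b + 1)) mod 2)))"
    using computesD[OF cm, of "[b + 1]" "b + 5" "b + 3"] by simp
  have d: "polytime (empty_from (b + 5)) (\<lambda>\<sigma>. \<sigma>(b + 4 := unary (length (\<sigma> (b + 1)) div 2)))"
    using computesD[OF cd, of "[b + 1]" "b + 5" "b + 4"] by simp
  have 1: "polytime (empty_from (b + 3)) (\<lambda>\<sigma>. \<sigma>(b + 3 := unary (length (\<sigma> (b + 1)) mod 2)))"
    by (rule polytime_weaken[OF m]) (auto simp: empty_from_def)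
  have 2: "polytime (empty_from (b + 3)) (\<lambda>\<sigma>. \<sigma>(b + 3 := unary (length (\<sigma> (b + 1)) mod 2), b + 4 := unary (length (\<sigma> (b + 1)) div 2)))"
    by (rule polytime_seq[OF 1 d]) (auto simp: empty_from_def)
  have br: "polytime ?T (\<lambda>\<sigma>. if top_symbol (\<sigma> (b + 3)) \<in> {1} then \<sigma>(b := 3 # \<sigma> b) else \<sigma>(b := 2 # \<sigma> b))"
    by (rule polytime_if; rule polytime_push_const) simp_all
  have top_symbol: "(if top_symbol (unary (x mod 2)) \<in> {1} then \<sigma>(b := 3 # \<sigma> b) else \<sigma>(b := 2 # \<sigma> b)) = \<sigma>(b := (2 + x mod 2) # \<sigma> b)"
    for x and \<sigma> :: stacks
  proof -
    have "x mod 2 < 2" by simp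
    then consider "x mod 2 = 0" | "x mod 2 = 1" by linarith
    then show ?thesis by cases simp_all
  qed
  have 3: "polytime (empty_from (b + 3)) (\<lambda>\<sigma>. \<sigma>(b + 3 := unary (length (\<sigma> (b + 1)) mod 2), b + 4 := unary (length (\<sigma> (b + 1)) div 2),
      b := (2 + length (\<sigma> (b + 1)) mod 2) # \<sigma> b))"
  proof (rule polytime_seq[OF 2 br])
    fix N :: nat and \<sigma> :: stacks
    let ?t = "\<sigma>(b + 3 := unary (length (\<sigma> (b + 1)) mod 2), b + 4 := unary (length (\<sigma> (b + 1)) div 2))"
    have "?t (b + 3) = unary (length (\<sigma> (b + 1)) mod 2)" "?t b = \<sigma> b" by simp_all
    then show "(if top_symbol (?t (b + 3)) \<in> {1} then ?t(b := 3 # ?t b) else ?t(b := 2 # ?t b))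
       = ?t(b := (2 + length (\<sigma> (b + 1)) mod 2) # \<sigma> b)"
      using top_symbol[of "length (\<sigma> (b + 1))" ?t] by (simp only:)
  qed simp
  have 4: "polytime (empty_from (b + 3)) (\<lambda>\<sigma>. \<sigma>(b + 4 := unary (length (\<sigma> (b + 1)) div 2),
      b := (2 + length (\<sigma> (b + 1)) mod 2) # \<sigma> b))"
    by (rule polytime_seq[OF 3 polytime_clear[of ?T "b + 3"]]) (auto simp: empty_from_def fun_eq_iff)
  have 5: "polytime (empty_from (b + 3)) (\<lambda>\<sigma>. \<sigma>(b + 4 := unary (length (\<sigma> (b + 1)) div 2),
      b := (2 + length (\<sigma> (b + 1)) mod 2) # \<sigma> b, b + 1 := []))"
    by (rule polytime_seq[OF 4 polytime_clear[of ?T "b + 1"]]) (auto simp: empty_from_def fun_eq_iff)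
  have 6: "polytime (empty_from (b + 3)) (\<lambda>\<sigma>. \<sigma>(b := (2 + length (\<sigma> (b + 1)) mod 2) # \<sigma> b,
      b + 1 := unary (length (\<sigma> (b + 1)) div 2)))"
    by (rule polytime_seq[OF 5 polytime_move[of "b + 4" "b + 1" ?T]]) (auto simp: empty_from_def fun_eq_iff)
  have flag: "polytime ?T (\<lambda>\<sigma>. if top_symbol (\<sigma> (b + 1)) \<in> {1} then \<sigma> else \<sigma>(b + 2 := tl (\<sigma> (b + 2))))"
    by (rule polytime_if[OF polytime_skip polytime_pop])
  have top1: "top_symbol (unary x) \<in> {1} \<longleftrightarrow> x \<noteq> 0" for x by (cases x) auto
  have body: "polytime (empty_from (b + 3)) (\<lambda>\<sigma>. \<sigma>(b := (2 + length (\<sigma> (b + 1)) mod 2) # \<sigma> b,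
      b + 1 := unary (length (\<sigma> (b + 1)) div 2), b + 2 := (if length (\<sigma> (b + 1)) div 2 = 0 then tl (\<sigma> (b + 2)) else \<sigma> (b + 2))))"
    by (rule polytime_seq[OF 6 flag]) (auto simp: top1[simplified] fun_eq_iff)
  let ?n = "\<lambda>\<sigma>. length (\<sigma> (b + 1))"
  let ?L = "\<lambda>\<sigma>. length (word (?n \<sigma>))"
  let ?s = "\<lambda>\<sigma> i. \<sigma>(b := digit_prefix (?n \<sigma>) i, b + 1 := unary (?n \<sigma> div 2 ^ i), b + 2 := (if i < ?L \<sigma> then [1] else []))"
  let ?I = "\<lambda>N \<sigma>. empty_from (b + 3) N \<sigma> \<and> \<sigma> b = [] \<and> \<sigma> (b + 1) = unary (?n \<sigma>) \<and> \<sigma> (b + 2) = [1]"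
  have pos: "0 < length (word n)" for n by (cases "n < 2") (simp_all add: word_less_2 word_rec)
  have loop: "polytime ?I (\<lambda>\<sigma>. ?s \<sigma> (?L \<sigma>))"
  proof (rule polytime_while[where s = ?s and r = "b + 2" and A = "{1}" and q = "\<lambda>m. m + 1" and B = "b + 2", OF body])
    show "poly_bounded (\<lambda>m. m + 1)" by (intro poly_bounded_add poly_bounded_id poly_bounded_const)
    fix N :: nat and \<sigma> :: stacks and i r' :: nat
    assume I: "?I N \<sigma>"
    show "?s \<sigma> 0 = \<sigma>" using I pos[of "?n \<sigma>"] by (auto simp: fun_eq_iff)
    show "top_symbol (?s \<sigma> (?L \<sigma>) (b + 2)) \<notin> {1}" by simp
    have n: "?n \<sigma> \<le> N + size_upto (b + 2) \<sigma>" using length_le_size_upto[of "b + 1" "b + 2" \<sigma>] by simp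
    then show "?L \<sigma> \<le> N + size_upto (b + 2) \<sigma> + 1" using length_word_le[of "?n \<sigma>"] by simp
    assume i: "i < ?L \<sigma>"
    show "top_symbol (?s \<sigma> i (b + 2)) \<in> {1}" using i by simp
    show "empty_from (b + 3) N (?s \<sigma> i)" using I by (simp add: empty_from_def)
    have "?n \<sigma> div 2 ^ i div 2 = ?n \<sigma> div 2 ^ Suc i"
      by (metis div_mult2_eq mult.commute power_Suc)
    moreover have "?n \<sigma> div 2 ^ Suc i = 0 \<longleftrightarrow> \<not> Suc i < ?L \<sigma>"
      using div_power_word(1)[of "?n \<sigma>"] div_power_word(2)[of "Suc i" "?n \<sigma>"] i
      by (metis Suc_lessI zero_less_Suc)
    ultimately show "(\<lambda>\<sigma>. \<sigma>(b := (2 + length (\<sigma> (b + 1)) mod 2) # \<sigma> b,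
      b + 1 := unary (length (\<sigma> (b + 1)) div 2), b + 2 := (if length (\<sigma> (b + 1)) div 2 = 0 then tl (\<sigma> (b + 2)) else \<sigma> (b + 2)))) (?s \<sigma> i)
      = ?s \<sigma> (Suc i)"
      using i by (simp add: fun_eq_iff del: power_Suc)
    show "length (?s \<sigma> i r') \<le> length (\<sigma> r') + (N + size_upto (b + 2) \<sigma> + 1)"
      using i n length_word_le[of "?n \<sigma>"] by (auto intro: order_trans[OF div_le_dividend])
  qed
  have a: "polytime (empty_from b) (\<lambda>\<sigma>. \<sigma>(b + 1 := unary (length (\<sigma> q))))"
    by (rule polytime_weaken[OF polytime_copy[of q "b + 3" "b + 1"]]) (use q in \<open>auto simp: empty_from_def\<close>)
  have b: "polytime (empty_from b) (\<lambda>\<sigma>. \<sigma>(b + 1 := unary (length (\<sigma> q)), b + 2 := [1]))"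
    by (rule polytime_seq[OF a polytime_push_const[of 1 ?T "b + 2"]]) (auto simp: empty_from_def fun_eq_iff)
  show ?thesis
  proof (rule polytime_seq[OF b loop])
    fix N \<sigma> assume "empty_from b N \<sigma>"
    then show "?I N (\<sigma>(b + 1 := unary (length (\<sigma> q)), b + 2 := [1]))"
      and "?s (\<sigma>(b + 1 := unary (length (\<sigma> q)), b + 2 := [1])) (?L (\<sigma>(b + 1 := unary (length (\<sigma> q)), b + 2 := [1])))
        = \<sigma>(b := map Suc (word (length (\<sigma> q))))"
      by (auto simp: empty_from_def fun_eq_iff digit_prefix_word div_power_word(1))
  qed
qed

section \<open>Running a machine inside a program\<close>

definition contiguous :: "int set \<Rightarrow> bool" where
  "contiguous A \<longleftrightarrow> (\<forall>x\<in>A. \<forall>y\<in>A. \<forall>z. x \<le> z \<longrightarrow> z \<le> y \<longrightarrow> z \<in> A)"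

definition visited :: "tape \<Rightarrow> int set" where
  "visited t = {z. snd t z \<noteq> 0}"

text \<open>
  A simulated machine leaves garbage that has to be erased before the next run. Its symbol a
  is represented by a + 1, so that visited cells are never blank; blank cells that were never
  visited also represent 0. The visited cells together with the head form an interval, which
  can be found and erased by sweeping.
\<close>

definition sim :: "tape \<Rightarrow> tape \<Rightarrow> bool" where
  "sim u t \<longleftrightarrow> contiguous (insert (fst t) (visited t)) \<and>
     (\<exists>s. fst t = fst u + s \<and> (\<forall>z. snd u z = snd t (z + s) - 1))"

lemma sim_read: "sim u t \<Longrightarrow> read_tape u = read_tape t - 1"
  by (cases u; cases t) (auto simp: sim_def)

lemma sim_act:
  assumes "sim u t" shows "sim (act_tape (a, d) u) (act_tape (a + 1, d) t)"
proof -
  obtain p c p' c' where u: "u = (p, c)" and t: "t = (p', c')" by (cases u, cases t) auto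
  obtain s where s: "p' = p + s" "\<And>z. c z = c' (z + s) - 1" and int: "contiguous (insert p' (visited t))"
    using assms by (auto simp: sim_def u t)
  define q where "q = (case d of MoveLeft \<Rightarrow> p' - 1 | Stay \<Rightarrow> p' | MoveRight \<Rightarrow> p' + 1)"
  have v: "visited (act_tape (a + 1, d) t) = insert p' (visited t)"
    by (auto simp: visited_def t)
  have q: "q = p' \<or> q = p' - 1 \<or> q = p' + 1" by (cases d) (auto simp: q_def)
  have "contiguous (insert q A)" if "contiguous A" "p' \<in> A" for A
    unfolding contiguous_def
  proof (intro ballI allI impI)
    fix x y z assume x: "x \<in> insert q A" and y: "y \<in> insert q A" and z: "x \<le> z" "z \<le> y"
    have A: "z \<in> A" if "x' \<in> A" "y' \<in> A" "x' \<le> z" "z \<le> y'" for x' y'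
      using \<open>contiguous A\<close> that unfolding contiguous_def by blast
    show "z \<in> insert q A"
    proof (rule ccontr)
      assume n: "z \<notin> insert q A"
      then have "z \<noteq> q" "z \<noteq> p'" "z \<notin> A" using \<open>p' \<in> A\<close> by auto
      then have "x = q \<Longrightarrow> p' \<le> z" "y = q \<Longrightarrow> z \<le> p'" using q z by auto
      then show False
        using x y z A[of x y] A[of p' y] A[of x p'] \<open>p' \<in> A\<close> n \<open>z \<noteq> p'\<close> by auto
    qed
  qed
  from this[OF int] have i: "contiguous (insert q (visited (act_tape (a + 1, d) t)))" unfolding v by simp
  have f: "fst (act_tape (a + 1, d) t) = q" by (simp add: t q_def)
  have e: "fst (act_tape (a + 1, d) t) = fst (act_tape (a, d) u) + s" by (cases d) (simp_all add: t u s)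
  have "snd (act_tape (a, d) u) z = snd (act_tape (a + 1, d) t) (z + s) - 1" for z
    using s by (simp add: t u)
  then show ?thesis using i e unfolding sim_def f[symmetric] by blast
qed

text \<open>
  The state is kept as a symbol on the tape after those of the machine. On symbols that do
  not occur in a run the action does nothing, which keeps the symbols bounded in all cases.
\<close>

definition simulate :: "tm \<Rightarrow> nat \<Rightarrow> (nat \<Rightarrow> nat) \<Rightarrow> nat \<Rightarrow> nat \<times> move" where
  "simulate M b a i = (let q = a (b + tapes M) - 1; as = map (\<lambda>j. a (b + j) - 1) [0..<tapes M] in
     if q < states M \<and> set as \<subseteq> {..<symbols M} then
       (if i = b + tapes M then (fst (delta M q as) + 1, Stay)
        else if b \<le> i \<and> i < b + tapes M then
          (fst (snd (delta M q as) ! (i - b)) + 1, snd (snd (delta M q as) ! (i - b)))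
        else (a i, Stay))
     else (a i, Stay))"

lemma wf_tmD:
  assumes "wf_tm M" "q < states M" "length as = tapes M" "set as \<subseteq> {..<symbols M}"
  shows "fst (delta M q as) < states M" "length (snd (delta M q as)) = tapes M"
    "j < tapes M \<Longrightarrow> fst (snd (delta M q as) ! j) < symbols M"
proof -
  have *: "case delta M q as of (q', acts) \<Rightarrow> q' < states M \<and> length acts = tapes M \<and> fst ` set acts \<subseteq> {..<symbols M}"
  proof -
    have "\<forall>q as. q < states M \<and> length as = tapes M \<and> set as \<subseteq> {..<symbols M} \<longrightarrow>
        (case delta M q as of (q', acts) \<Rightarrow> q' < states M \<and> length acts = tapes M \<and> fst ` set acts \<subseteq> {..<symbols M})"
      using assms(1) unfolding wf_tm_def by (elim conjE)
    from this[rule_format, of q as] show ?thesis using assms(2-4) by simp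
  qed
  obtain q' acts where d: "delta M q as = (q', acts)" by (cases "delta M q as")
  show "fst (delta M q as) < states M" and l: "length (snd (delta M q as)) = tapes M" using * d by auto
  assume "j < tapes M"
  then have "fst (acts ! j) \<in> fst ` set acts" using * d by simp
  then show "fst (snd (delta M q as) ! j) < symbols M" using * d by auto
qed

lemma fits_simulate:
  assumes M: "wf_tm M"
  shows "fits (b + tapes M + 1) (Suc (max (states M) (symbols M))) (Act (simulate M b))"
proof -
  have 1: "simulate M b a i = (a i, Stay)" if "b + tapes M + 1 \<le> i" for a i
    using that by (simp add: simulate_def Let_def)
  have 2: "simulate M b a i = simulate M b a' i" if "\<forall>i<b + tapes M + 1. a i = a' i" "i < b + tapes M + 1" for a a' i
  proof -
    have "map (\<lambda>j. a (b + j) - 1) [0..<tapes M] = map (\<lambda>j. a' (b + j) - 1) [0..<tapes M]"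
      using that(1) by (intro map_cong) auto
    moreover have "a (b + tapes M) = a' (b + tapes M)" "a i = a' i" using that by auto
    ultimately show ?thesis unfolding simulate_def by (simp only:)
  qed
  have 3: "fst (simulate M b a i) < S'" if S: "Suc (max (states M) (symbols M)) \<le> S'" "\<forall>i. a i < S'" for S' a i
  proof -
    let ?q = "a (b + tapes M) - 1" let ?as = "map (\<lambda>j. a (b + j) - 1) [0..<tapes M]"
    show ?thesis
    proof (cases "?q < states M \<and> set ?as \<subseteq> {..<symbols M}")
      case True
      note w = wf_tmD[OF M, of ?q ?as]
      have "fst (delta M ?q ?as) + 1 < S'" using w(1) True S(1) by simp
      moreover have "fst (snd (delta M ?q ?as) ! (i - b)) + 1 < S'" if "b \<le> i" "i < b + tapes M"
      proof -
        have "i - b < tapes M" using that by linarith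
        then show ?thesis using w(3)[of "i - b"] True S(1) by simp
      qed
      ultimately show ?thesis using True S(2) by (simp add: simulate_def Let_def)
    next
      case False
      then have "simulate M b a i = (a i, Stay)" unfolding simulate_def Let_def by (simp only: if_False)
      then show ?thesis using S(2) by simp
    qed
  qed
  show ?thesis using 1 2 3 by (simp only: fits.simps) blast
qed

definition simulates :: "tm \<Rightarrow> nat \<Rightarrow> config \<Rightarrow> tape_file \<Rightarrow> bool" where
  "simulates M b cfg ts \<longleftrightarrow> fst cfg < states M \<and> length (snd cfg) = tapes M \<and>
     is_stack (ts (b + tapes M)) [fst cfg + 1] \<and>
     (\<forall>j<tapes M. sim (snd cfg ! j) (ts (b + j)) \<and> (\<forall>z. snd (snd cfg ! j) z < symbols M))"

lemma simulates_step:
  assumes M: "wf_tm M" and s: "simulates M b cfg ts" and run: "fst cfg \<noteq> halt_state M"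
  defines "ts' \<equiv> \<lambda>i. act_tape (simulate M b (reads ts) i) (ts i)"
  shows "simulates M b (step M cfg) ts'" "\<And>i. i < b \<or> b + tapes M < i \<Longrightarrow> ts' i = ts i"
proof -
  obtain q us where cfg: "cfg = (q, us)" by (cases cfg)
  have q: "q < states M" and len: "length us = tapes M" and st: "is_stack (ts (b + tapes M)) [q + 1]"
    and u: "\<And>j. j < tapes M \<Longrightarrow> sim (us ! j) (ts (b + j))"
    and sym: "\<And>j z. j < tapes M \<Longrightarrow> snd (us ! j) z < symbols M"
    using s by (auto simp: simulates_def cfg)
  let ?as = "map read_tape us"
  have qr: "reads ts (b + tapes M) - 1 = q" using read_stack[OF st] by (simp add: reads_def)
  have asr: "map (\<lambda>j. reads ts (b + j) - 1) [0..<tapes M] = ?as"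
  proof (rule nth_equalityI)
    fix j assume "j < length (map (\<lambda>j. reads ts (b + j) - 1) [0..<tapes M])"
    then show "map (\<lambda>j. reads ts (b + j) - 1) [0..<tapes M] ! j = ?as ! j"
      using sim_read[OF u[of j]] len by (simp add: reads_def)
  qed (simp add: len)
  have read: "read_tape t = snd t (fst t)" for t by (cases t) simp
  have as: "set ?as \<subseteq> {..<symbols M}"
  proof
    fix x assume "x \<in> set ?as"
    then obtain j where "j < tapes M" "x = read_tape (us ! j)" using len by (auto simp: in_set_conv_nth)
    then show "x \<in> {..<symbols M}" using sym[of j] by (simp add: read)
  qed
  note w = wf_tmD[OF M q _ as, simplified len length_map, OF refl]
  have sm: "simulate M b (reads ts) i = (if i = b + tapes M then (fst (delta M q ?as) + 1, Stay)
        else if b \<le> i \<and> i < b + tapes M then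
          (fst (snd (delta M q ?as) ! (i - b)) + 1, snd (snd (delta M q ?as) ! (i - b)))
        else (reads ts i, Stay))" for i
    unfolding simulate_def Let_def qr asr using q as by simp
  show "ts' i = ts i" if "i < b \<or> b + tapes M < i" for i
  proof -
    have "ts' i = act_tape (reads ts i, Stay) (ts i)" using that by (auto simp: ts'_def sm)
    then show ?thesis by (simp add: reads_def act_tape_stay)
  qed
  have step: "step M cfg = (fst (delta M q ?as), map2 act_tape (snd (delta M q ?as)) us)"
    using run by (simp add: cfg step_def case_prod_unfold)
  have tape: "map2 act_tape (snd (delta M q ?as)) us ! j = act_tape (snd (delta M q ?as) ! j) (us ! j)" if "j < tapes M" for j
    using that w(2) len by simp
  show "simulates M b (step M cfg) ts'"
    unfolding simulates_def step fst_conv snd_conv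
  proof (intro conjI allI impI)
    show "fst (delta M q ?as) < states M" by (rule w(1))
    show "length (map2 act_tape (snd (delta M q ?as)) us) = tapes M" using w(2) len by simp
    have "is_stack (act_tape (fst (delta M q ?as) + 1, Stay) (ts (b + tapes M))) ((fst (delta M q ?as) + 1) # tl [q + 1])"
      by (rule stack_set_top[OF st]) auto
    then show "is_stack (ts' (b + tapes M)) [fst (delta M q ?as) + 1]" by (simp add: ts'_def sm)
  next
    fix j assume j: "j < tapes M"
    obtain a d where ad: "snd (delta M q ?as) ! j = (a, d)" by fastforce
    show "sim (map2 act_tape (snd (delta M q ?as)) us ! j) (ts' (b + j))"
      using sim_act[OF u[OF j], of a d] j unfolding tape[OF j] by (simp add: ts'_def sm ad)
    fix z
    have "a < symbols M" using w(3)[OF j] by (simp add: ad)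
    then show "snd (map2 act_tape (snd (delta M q ?as)) us ! j) z < symbols M"
      unfolding tape[OF j] ad using sym[OF j, of z] by (cases "us ! j") auto
  qed
qed

lemma simulates_run:
  assumes M: "wf_tm M" and "simulates M b cfg ts" "(step M ^^ t) cfg = (halt_state M, us)"
  shows "\<exists>t' ts'. t' \<le> 2 * t + 1 \<and>
    exec (While (b + tapes M) (- {halt_state M + 1}) (Act (simulate M b))) ts t' ts' \<and>
    simulates M b (halt_state M, us) ts' \<and> (\<forall>i. i < b \<or> b + tapes M < i \<longrightarrow> ts' i = ts i)"
  using assms(2,3)
proof (induction t arbitrary: cfg ts)
  case (0 cfg ts)
  then have st: "is_stack (ts (b + tapes M)) [halt_state M + 1]" by (simp add: simulates_def)
  then have "reads ts (b + tapes M) = halt_state M + 1" by (simp add: reads_def read_stack[OF st])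
  then have "exec (While (b + tapes M) (- {halt_state M + 1}) (Act (simulate M b))) ts 1 ts"
    by (intro exec.WhileF) simp
  then show ?case using 0 by (intro exI[of _ 1] exI[of _ ts]) simp
next
  case (Suc t cfg ts)
  have st: "is_stack (ts (b + tapes M)) [fst cfg + 1]" using Suc.prems(1) by (simp add: simulates_def)
  have r: "reads ts (b + tapes M) = fst cfg + 1" by (simp add: reads_def read_stack[OF st])
  show ?case
  proof (cases "fst cfg = halt_state M")
    case True
    have "step M cfg = cfg" using True by (cases cfg) (simp add: step_def)
    then have "(step M ^^ Suc t) cfg = cfg" by (induction t) auto
    then have "cfg = (halt_state M, us)" using Suc.prems(2) by simp
    moreover have "exec (While (b + tapes M) (- {halt_state M + 1}) (Act (simulate M b))) ts 1 ts"
      using r True by (intro exec.WhileF) simp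
    ultimately show ?thesis using Suc.prems(1) by (intro exI[of _ 1] exI[of _ ts]) simp
  next
    case False
    define ts1 where "ts1 = (\<lambda>i. act_tape (simulate M b (reads ts) i) (ts i))"
    have s1: "simulates M b (step M cfg) ts1"
      unfolding ts1_def by (rule simulates_step(1)[OF M Suc.prems(1) False])
    have s2: "ts1 i = ts i" if "i < b \<or> b + tapes M < i" for i
      using simulates_step(2)[OF M Suc.prems(1) False that] by (simp add: ts1_def)
    have "(step M ^^ t) (step M cfg) = (halt_state M, us)"
      using Suc.prems(2) by (simp add: funpow_Suc_right del: funpow.simps)
    from Suc.IH[OF s1 this] obtain t' ts' where t': "t' \<le> 2 * t + 1"
      "exec (While (b + tapes M) (- {halt_state M + 1}) (Act (simulate M b))) ts1 t' ts'"
      "simulates M b (halt_state M, us) ts'" "\<forall>i. i < b \<or> b + tapes M < i \<longrightarrow> ts' i = ts1 i" by blast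
    have "exec (Act (simulate M b)) ts 1 ts1" unfolding ts1_def by (rule exec.Act)
    then have "exec (While (b + tapes M) (- {halt_state M + 1}) (Act (simulate M b))) ts (Suc (1 + t')) ts'"
      using t'(2) r False by (intro exec.WhileT) auto
    moreover have "\<forall>i. i < b \<or> b + tapes M < i \<longrightarrow> ts' i = ts i" using t'(4) s2 by metis
    moreover have "Suc (1 + t') \<le> 2 * Suc t + 1" using t'(1) by simp
    ultimately show ?thesis using t'(3) by blast
  qed
qed

lemma sim_input:
  assumes "is_stack t (map Suc w)" shows "sim (input_tape w) t"
proof -
  have v: "visited t = {fst t..<fst t + int (length w)}"
    using is_stack_cells[OF assms] by (simp add: visited_def)
  have "contiguous (insert (fst t) (visited t))" unfolding v contiguous_def by auto
  moreover have "snd (input_tape w) z = snd t (z + fst t) - 1" for z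
    using assms by (auto simp: is_stack_def input_tape_def)
  moreover have "fst t = fst (input_tape w) + fst t" by (simp add: input_tape_def)
  ultimately show ?thesis unfolding sim_def by blast
qed

section \<open>Erasing the tapes of a simulated machine\<close>

definition tape_act :: "nat \<Rightarrow> (nat \<Rightarrow> nat) \<Rightarrow> move \<Rightarrow> com" where
  "tape_act r g m = Act (\<lambda>a i. if i = r then (g (a r), m) else (a i, Stay))"

lemma exec_tape_act: "exec (tape_act r g m) ts 1 (ts(r := act_tape (g (read_tape (ts r)), m) (ts r)))"
  using exec_Act_single[of r "\<lambda>a. (g (a r), m)" ts] by (simp add: tape_act_def reads_def)

lemma fits_tape_act:
  assumes "\<And>x S'. S \<le> S' \<Longrightarrow> x < S' \<Longrightarrow> g x < S'" shows "fits (Suc r) S (tape_act r g m)"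
  unfolding tape_act_def using fits_Act_single[of "Suc r" "\<lambda>a. g (a r)" S r m] assms by simp

definition erase :: "nat \<Rightarrow> com" where
  "erase r = Seq (tape_act r (max 1) Stay) (Seq (While r (- {0}) (tape_act r (\<lambda>x. x) MoveRight))
     (Seq (tape_act r (\<lambda>x. x) MoveLeft) (While r (- {0}) (tape_act r (\<lambda>_. 0) MoveLeft))))"

lemma fits_erase: "fits (Suc r) 2 (erase r)"
  unfolding erase_def by (auto intro!: fits_tape_act)

lemma exec_right:
  assumes "ts r = (p, c)" "\<And>j. j < n \<Longrightarrow> c (p + int j) \<noteq> 0" "c (p + int n) = 0"
  shows "exec (While r (- {0}) (tape_act r (\<lambda>x. x) MoveRight)) ts (2 * n + 1) (ts(r := (p + int n, c)))"
  using assms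
proof (induction n arbitrary: ts p)
  case 0
  then have "ts(r := (p + int 0, c)) = ts" by auto
  moreover have "reads ts r = 0" using 0 by (simp add: reads_def)
  ultimately show ?case using exec.WhileF[of ts r "- {0}"] by simp
next
  case (Suc n)
  define ts1 where "ts1 = ts(r := (p + 1, c))"
  have ne: "reads ts r \<noteq> 0" using Suc.prems(1) Suc.prems(2)[of 0] by (simp add: reads_def)
  have "act_tape (read_tape (ts r), MoveRight) (ts r) = (p + 1, c)" using Suc.prems(1) by simp
  then have 1: "exec (tape_act r (\<lambda>x. x) MoveRight) ts 1 ts1"
    using exec_tape_act[of r "\<lambda>x. x" MoveRight ts] by (simp add: ts1_def)
  have 2: "exec (While r (- {0}) (tape_act r (\<lambda>x. x) MoveRight)) ts1 (2 * n + 1) (ts1(r := (p + 1 + int n, c)))"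
  proof (rule Suc.IH)
    show "ts1 r = (p + 1, c)" by (simp add: ts1_def)
    show "c (p + 1 + int j) \<noteq> 0" if "j < n" for j
      using Suc.prems(2)[of "Suc j"] that by (simp add: algebra_simps)
    show "c (p + 1 + int n) = 0" using Suc.prems(3) by (simp add: algebra_simps)
  qed
  have "exec (While r (- {0}) (tape_act r (\<lambda>x. x) MoveRight)) ts (Suc (1 + (2 * n + 1))) (ts1(r := (p + 1 + int n, c)))"
    by (rule exec.WhileT[OF _ 1 2]) (use ne in simp)
  moreover have "p + 1 + int n = p + int (Suc n)" by simp
  moreover have "Suc (1 + (2 * n + 1)) = 2 * Suc n + 1" by simp
  ultimately show ?case by (simp only: ts1_def fun_upd_upd)
qed

lemma exec_erase_left:
  assumes "ts r = (p, c)" "\<And>j. j < n \<Longrightarrow> c (p - int j) \<noteq> 0" "c (p - int n) = 0"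
  shows "exec (While r (- {0}) (tape_act r (\<lambda>_. 0) MoveLeft)) ts (2 * n + 1)
     (ts(r := (p - int n, \<lambda>z. if p - int n < z \<and> z \<le> p then 0 else c z)))"
  using assms
proof (induction n arbitrary: ts p c)
  case 0
  have "(\<lambda>z. if p - int 0 < z \<and> z \<le> p then 0 else c z) = c" by auto
  with 0 have "ts(r := (p - int 0, \<lambda>z. if p - int 0 < z \<and> z \<le> p then 0 else c z)) = ts"
    by (simp only: diff_zero of_nat_0) (metis fun_upd_triv)
  moreover have "reads ts r = 0" using 0 by (simp add: reads_def)
  ultimately show ?case using exec.WhileF[of ts r "- {0}"] by simp
next
  case (Suc n)
  define ts1 where "ts1 = ts(r := (p - 1, c(p := 0)))"
  have ne: "reads ts r \<noteq> 0" using Suc.prems(1) Suc.prems(2)[of 0] by (simp add: reads_def)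
  have "act_tape (0, MoveLeft) (ts r) = (p - 1, c(p := 0))" using Suc.prems(1) by simp
  then have 1: "exec (tape_act r (\<lambda>_. 0) MoveLeft) ts 1 ts1"
    using exec_tape_act[of r "\<lambda>_. 0" MoveLeft ts] by (simp add: ts1_def)
  have 2: "exec (While r (- {0}) (tape_act r (\<lambda>_. 0) MoveLeft)) ts1 (2 * n + 1)
      (ts1(r := (p - 1 - int n, \<lambda>z. if p - 1 - int n < z \<and> z \<le> p - 1 then 0 else (c(p := 0)) z)))"
  proof (rule Suc.IH)
    show "ts1 r = (p - 1, c(p := 0))" by (simp add: ts1_def)
    show "(c(p := 0)) (p - 1 - int j) \<noteq> 0" if "j < n" for j
      using Suc.prems(2)[of "Suc j"] that by (simp add: algebra_simps)
    show "(c(p := 0)) (p - 1 - int n) = 0" using Suc.prems(3) by (simp add: algebra_simps)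
  qed
  have 3: "exec (While r (- {0}) (tape_act r (\<lambda>_. 0) MoveLeft)) ts (Suc (1 + (2 * n + 1)))
      (ts1(r := (p - 1 - int n, \<lambda>z. if p - 1 - int n < z \<and> z \<le> p - 1 then 0 else (c(p := 0)) z)))"
    by (rule exec.WhileT[OF _ 1 2]) (use ne in simp)
  have "(\<lambda>z. if p - 1 - int n < z \<and> z \<le> p - 1 then 0 else (c(p := 0)) z) =
      (\<lambda>z. if p - int (Suc n) < z \<and> z \<le> p then 0 else c z)"
    by (auto simp: fun_eq_iff)
  moreover have "p - 1 - int n = p - int (Suc n)" by simp
  moreover have "Suc (1 + (2 * n + 1)) = 2 * Suc n + 1" by simp
  ultimately show ?case using 3 by (simp only: ts1_def fun_upd_upd)
qed

text \<open>
  The head first marks its own cell, so that it stands inside the interval. It then moves to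
  the right end and erases all cells back to the left end.
\<close>

lemma exec_erase:
  assumes fin: "finite (visited (ts r))" and int: "contiguous (insert (fst (ts r)) (visited (ts r)))"
  shows "\<exists>t t'. t \<le> 4 * card (visited (ts r)) + 10 \<and> exec (erase r) ts t (ts(r := t')) \<and> is_stack t' []"
proof -
  obtain p c where pc: "ts r = (p, c)" by (cases "ts r") auto
  define c1 where "c1 = c(p := max 1 (c p))"
  define A where "A = insert p (visited (ts r))"
  have nz: "c1 z \<noteq> 0 \<longleftrightarrow> z \<in> A" for z by (auto simp: c1_def A_def visited_def pc)
  have A: "finite A" "A \<noteq> {}" "p \<in> A" using fin by (auto simp: A_def)
  define l where "l = Min A"
  define u where "u = Max A"
  have lu: "l \<in> A" "u \<in> A" "l \<le> p" "p \<le> u" using A by (auto simp: l_def u_def)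
  have A_eq: "A = {l..u}"
  proof
    show "A \<subseteq> {l..u}" using A(1) by (auto simp: l_def u_def)
    have "contiguous A" using int by (simp add: A_def pc)
    then have "z \<in> A" if "l \<le> z" "z \<le> u" for z
      using lu(1,2) that unfolding contiguous_def by blast
    then show "{l..u} \<subseteq> A" by (intro subsetI) simp
  qed
  have card: "nat (u + 1 - l) \<le> card (visited (ts r)) + 1"
  proof -
    have "card A \<le> card (visited (ts r)) + 1" unfolding A_def using fin by (simp add: card_insert_if)
    then show ?thesis by (simp add: A_eq)
  qed
  let ?n = "nat (u + 1 - p)" and ?m = "nat (u + 1 - l)"
  have 1: "exec (tape_act r (max 1) Stay) ts 1 (ts(r := (p, c1)))"
    using exec_tape_act[of r "max 1" Stay ts] by (simp add: pc c1_def)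
  have 2: "exec (While r (- {0}) (tape_act r (\<lambda>x. x) MoveRight)) (ts(r := (p, c1))) (2 * ?n + 1) (ts(r := (u + 1, c1)))"
  proof -
    have "exec (While r (- {0}) (tape_act r (\<lambda>x. x) MoveRight)) (ts(r := (p, c1))) (2 * ?n + 1)
        ((ts(r := (p, c1)))(r := (p + int ?n, c1)))"
    proof (rule exec_right)
      show "c1 (p + int j) \<noteq> 0" if "j < ?n" for j unfolding nz A_eq using that lu by auto
      show "c1 (p + int ?n) = 0" using nz[of "p + int ?n"] lu unfolding A_eq by auto
    qed simp
    then show ?thesis using lu by simp
  qed
  have 3: "exec (tape_act r (\<lambda>x. x) MoveLeft) (ts(r := (u + 1, c1))) 1 (ts(r := (u, c1)))"
    using exec_tape_act[of r "\<lambda>x. x" MoveLeft "ts(r := (u + 1, c1))"] by simp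
  define c2 where "c2 = (\<lambda>z. if u - int ?m < z \<and> z \<le> u then 0 else c1 z)"
  have 4: "exec (While r (- {0}) (tape_act r (\<lambda>_. 0) MoveLeft)) (ts(r := (u, c1))) (2 * ?m + 1) (ts(r := (u - int ?m, c2)))"
  proof -
    have "exec (While r (- {0}) (tape_act r (\<lambda>_. 0) MoveLeft)) (ts(r := (u, c1))) (2 * ?m + 1)
        ((ts(r := (u, c1)))(r := (u - int ?m, c2)))" unfolding c2_def
    proof (rule exec_erase_left)
      show "c1 (u - int j) \<noteq> 0" if "j < ?m" for j unfolding nz A_eq using that lu by auto
      show "c1 (u - int ?m) = 0" using nz[of "u - int ?m"] lu unfolding A_eq by auto
    qed simp
    then show ?thesis by simp
  qed
  have "c2 z = 0" for z using nz[of z] lu unfolding A_eq by (auto simp: c2_def)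
  then have "is_stack (u - int ?m, c2) []" by (simp add: is_stack_def)
  moreover have "exec (erase r) ts (1 + ((2 * ?n + 1) + (1 + (2 * ?m + 1)))) (ts(r := (u - int ?m, c2)))"
    unfolding erase_def by (rule exec.Seq[OF 1 exec.Seq[OF 2 exec.Seq[OF 3 4]]])
  moreover have "1 + ((2 * ?n + 1) + (1 + (2 * ?m + 1))) \<le> 4 * card (visited (ts r)) + 10"
  proof -
    have "?n \<le> ?m" using lu by simp
    then show ?thesis using card by linarith
  qed
  ultimately show ?thesis by blast
qed

primrec erase_all :: "nat \<Rightarrow> nat \<Rightarrow> com" where
  "erase_all b 0 = Act (\<lambda>a i. (a i, Stay))"
| "erase_all b (Suc k) = Seq (erase_all b k) (erase (b + k))"

lemma fits_erase_all: "fits (b + k) 2 (erase_all b k)"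
proof (induction k)
  case (Suc k)
  then show ?case using fits_mono[OF Suc, of "b + Suc k" 2] fits_erase[of "b + k"] by simp
qed simp

lemma exec_erase_all:
  assumes "\<And>j. j < k \<Longrightarrow> finite (visited (ts (b + j))) \<and> card (visited (ts (b + j))) \<le> B \<and>
      contiguous (insert (fst (ts (b + j))) (visited (ts (b + j))))"
  shows "\<exists>t ts'. t \<le> k * (4 * B + 10) + 1 \<and> exec (erase_all b k) ts t ts' \<and>
     (\<forall>j<k. is_stack (ts' (b + j)) []) \<and> (\<forall>i. i < b \<or> b + k \<le> i \<longrightarrow> ts' i = ts i)"
  using assms
proof (induction k)
  case 0
  have "exec (erase_all b 0) ts 1 ts"
    using exec.Act[of "\<lambda>a i. (a i, Stay)" ts] by (simp add: reads_def act_tape_stay)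
  then show ?case by (intro exI[of _ 1] exI[of _ ts]) simp
next
  case (Suc k)
  then obtain t ts' where t: "t \<le> k * (4 * B + 10) + 1" "exec (erase_all b k) ts t ts'"
    "\<forall>j<k. is_stack (ts' (b + j)) []" "\<forall>i. i < b \<or> b + k \<le> i \<longrightarrow> ts' i = ts i" by auto
  have eq: "ts' (b + k) = ts (b + k)" using t(4) by simp
  obtain u t' where u: "u \<le> 4 * card (visited (ts (b + k))) + 10" "exec (erase (b + k)) ts' u (ts'(b + k := t'))" "is_stack t' []"
    using exec_erase[of ts' "b + k"] Suc.prems[of k] unfolding eq by blast
  have "exec (erase_all b (Suc k)) ts (t + u) (ts'(b + k := t'))"
    using exec.Seq[OF t(2) u(2)] by simp
  moreover have "t + u \<le> Suc k * (4 * B + 10) + 1"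
    using t(1) u(1) Suc.prems[of k] by simp
  moreover have "\<forall>j<Suc k. is_stack ((ts'(b + k := t')) (b + j)) []"
    using t(3) u(3) by (simp add: less_Suc_eq)
  moreover have "\<forall>i. i < b \<or> b + Suc k \<le> i \<longrightarrow> (ts'(b + k := t')) i = ts i" using t(4) by simp
  ultimately show ?case by blast
qed

section \<open>A machine as a subroutine\<close>

definition set_symbol :: "nat \<Rightarrow> nat \<Rightarrow> com" where "set_symbol r v = tape_act r (\<lambda>_. v) Stay"

text \<open>
  The numerals of 0, 1 and 2 are told apart by at most two cells. The result goes to the tape
  of the state.
\<close>

definition read_digit :: "nat \<Rightarrow> nat \<Rightarrow> com" where
  "read_digit b st = Cond b {2} (set_symbol st 1)
     (Seq (tape_act b (\<lambda>x. x) MoveRight) (Cond b {2} (set_symbol st 3) (set_symbol st 2)))"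

lemma exec_set_symbol:
  assumes "is_stack (ts r) [x]" "v \<noteq> 0"
  shows "\<exists>t'. exec (set_symbol r v) ts 1 (ts(r := t')) \<and> is_stack t' [v]"
  using exec_tape_act[of r "\<lambda>_. v" Stay ts] stack_set_top[OF assms(1), of v] assms(2)
  unfolding set_symbol_def by (intro exI[of _ "act_tape (v, Stay) (ts r)"]) simp

lemma exec_read_digit:
  assumes s: "sim u (ts b)" and st: "is_stack (ts st) [x]" and ne: "b \<noteq> st"
    and res: "tape_result u (word v)" and v: "v \<le> 2"
  shows "\<exists>t ts'. t \<le> 5 \<and> exec (read_digit b st) ts t ts' \<and> is_stack (ts' st) [Suc v] \<and>
     contiguous (insert (fst (ts' b)) (visited (ts' b))) \<and> (\<forall>i. i \<noteq> b \<and> i \<noteq> st \<longrightarrow> ts' i = ts i)"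
proof -
  obtain p c where u: "u = (p, c)" by (cases u) auto
  have int: "contiguous (insert (fst (ts b)) (visited (ts b)))" using s by (simp add: sim_def)
  have r: "reads ts b - 1 = c p" using sim_read[OF s] by (simp add: reads_def u)
  consider "v = 0" | "v = 1" | "v = 2" using v by linarith
  then show ?thesis
  proof cases
    case 1
    then have "c p = 1" using res word_digits(1) by (simp add: tape_result_def u)
    then have r2: "reads ts b = 2" using r by simp
    obtain t' where t': "exec (set_symbol st 1) ts 1 (ts(st := t'))" "is_stack t' [1]"
      using exec_set_symbol[of ts st x 1] st by auto
    have "exec (read_digit b st) ts (Suc 1) (ts(st := t'))"
      unfolding read_digit_def by (rule exec.CondT[OF _ t'(1)]) (simp add: r2)
    then show ?thesis using t'(2) ne int 1
      by (intro exI[of _ 2] exI[of _ "ts(st := t')"]) (simp add: numeral_2_eq_2)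
  next
    case 2
    then have c: "c p = 2" "c (p + 1) = 0" using res word_digits(2) by (simp_all add: tape_result_def u)
    then have r3: "reads ts b = 3" using r by simp
    define ts1 where "ts1 = ts(b := act_tape (read_tape (ts b), MoveRight) (ts b))"
    have 1: "exec (tape_act b (\<lambda>x. x) MoveRight) ts 1 ts1" unfolding ts1_def by (rule exec_tape_act)
    have s1: "sim (act_tape (2, MoveRight) u) (ts1 b)"
      using sim_act[OF s, of 2 MoveRight] r3 by (simp add: ts1_def reads_def)
    have "reads ts1 b - 1 = 0" using sim_read[OF s1] c by (simp add: u reads_def)
    then have r1: "reads ts1 b \<noteq> 2" by simp
    obtain t' where t': "exec (set_symbol st 2) ts1 1 (ts1(st := t'))" "is_stack t' [2]"
      using exec_set_symbol[of ts1 st x 2] st ne by (auto simp: ts1_def)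
    have 2: "exec (Cond b {2} (set_symbol st 3) (set_symbol st 2)) ts1 (Suc 1) (ts1(st := t'))"
      by (rule exec.CondF[OF _ t'(1)]) (simp add: r1)
    have "exec (read_digit b st) ts (Suc (1 + Suc 1)) (ts1(st := t'))"
      unfolding read_digit_def by (rule exec.CondF[OF _ exec.Seq[OF 1 2]]) (simp add: r3)
    moreover have "contiguous (insert (fst ((ts1(st := t')) b)) (visited ((ts1(st := t')) b)))"
      using s1 ne by (simp add: sim_def)
    ultimately show ?thesis using t'(2) \<open>v = 1\<close>
      by (intro exI[of _ "Suc (1 + Suc 1)"] exI[of _ "ts1(st := t')"]) (auto simp: ts1_def numeral_2_eq_2)
  next
    case 3
    then have res': "tape_result u [2, 1]" using res word_digits(3) by simp
    have c: "c p = 2" "c (p + 1) = 1"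
      using res' unfolding tape_result_def u prod.case
      by (auto dest: spec[of _ 0] spec[of _ 1])
    then have r3: "reads ts b = 3" using r by simp
    define ts1 where "ts1 = ts(b := act_tape (read_tape (ts b), MoveRight) (ts b))"
    have 1: "exec (tape_act b (\<lambda>x. x) MoveRight) ts 1 ts1" unfolding ts1_def by (rule exec_tape_act)
    have s1: "sim (act_tape (2, MoveRight) u) (ts1 b)"
      using sim_act[OF s, of 2 MoveRight] r3 by (simp add: ts1_def reads_def)
    have "reads ts1 b - 1 = 1" using sim_read[OF s1] c by (simp add: u reads_def)
    then have r1: "reads ts1 b = 2" by simp
    obtain t' where t': "exec (set_symbol st 3) ts1 1 (ts1(st := t'))" "is_stack t' [3]"
      using exec_set_symbol[of ts1 st x 3] st ne by (auto simp: ts1_def)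
    have 2: "exec (Cond b {2} (set_symbol st 3) (set_symbol st 2)) ts1 (Suc 1) (ts1(st := t'))"
      by (rule exec.CondT[OF _ t'(1)]) (simp add: r1)
    have "exec (read_digit b st) ts (Suc (1 + Suc 1)) (ts1(st := t'))"
      unfolding read_digit_def by (rule exec.CondF[OF _ exec.Seq[OF 1 2]]) (simp add: r3)
    moreover have "contiguous (insert (fst ((ts1(st := t')) b)) (visited ((ts1(st := t')) b)))"
      using s1 ne by (simp add: sim_def)
    ultimately show ?thesis using t'(2) \<open>v = 2\<close>
      by (intro exI[of _ "Suc (1 + Suc 1)"] exI[of _ "ts1(st := t')"]) (auto simp: ts1_def numeral_3_eq_3)
  qed
qed

text \<open>
  The unary argument is still on the stack q, so a bound that is polynomial in the argument
  is polynomial in the height of the stacks.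
\<close>

lemma polytime_machine:
  assumes M: "wf_tm M" and time: "computes_in_time M f (poly p)" and f: "\<And>n. f n \<le> 2" and q: "q < b"
  defines "st \<equiv> b + tapes M"
  shows "polytime (\<lambda>N \<sigma>. \<sigma> b = map Suc (word (length (\<sigma> q))) \<and> (\<forall>j. 0 < j \<and> j < tapes M \<longrightarrow> \<sigma> (b + j) = []) \<and>
      \<sigma> st = [start_state M + 1])
    (\<lambda>\<sigma>. \<sigma>(b := [], st := [Suc (f (length (\<sigma> q)))]))"
proof -
  have k: "0 < tapes M" using M by (simp add: wf_tm_def)
  define loop where "loop = While st (- {halt_state M + 1}) (Act (simulate M b))"
  define prog where "prog = Seq loop (Seq (read_digit b st) (erase_all b (tapes M)))"
  define S where "S = Suc (max (states M) (symbols M)) + 10"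
  obtain d where d: "\<And>n. poly p n \<le> (n + d) ^ d" using poly_bounded_poly[of p] unfolding poly_bounded_def by blast
  define T where "T m = (m + d) ^ d" for m
  define B where "B m = (m + 1) + (2 * T m + 1) + 5" for m
  define w where "w m = (2 * T m + 1) + (5 + (tapes M * (4 * B m + 10) + 1))" for m
  have T: "poly_bounded T" unfolding T_def by (intro poly_bounded_power poly_bounded_add poly_bounded_id poly_bounded_const)
  have B: "poly_bounded B" unfolding B_def by (intro poly_bounded_add poly_bounded_mult poly_bounded_id poly_bounded_const T)
  have w: "poly_bounded w" unfolding w_def by (intro poly_bounded_add poly_bounded_mult poly_bounded_const T B)
  have fs: "fits (Suc r) S (set_symbol r v)" if "v < 10" for r v
    unfolding set_symbol_def by (rule fits_tape_act) (use that in \<open>simp add: S_def\<close>)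
  have fits: "fits (Suc st) S prog"
  proof -
    have "fits (Suc st) S (Act (simulate M b))"
      by (rule fits_mono[OF fits_simulate[OF M, of b]]) (auto simp: st_def S_def)
    moreover have "fits (Suc st) S (tape_act b (\<lambda>x. x) MoveRight)"
      by (rule fits_mono[OF fits_tape_act[of 0 "\<lambda>x. x" b]]) (auto simp: st_def)
    moreover have "fits (Suc st) S (erase_all b (tapes M))"
      by (rule fits_mono[OF fits_erase_all]) (auto simp: st_def S_def)
    ultimately show ?thesis
      using fs by (simp add: prog_def loop_def read_digit_def st_def)
  qed
  show ?thesis
  proof (rule PTI[OF fits w, where K' = b])
    fix N \<sigma> and ts0 :: tape_file
    assume I: "\<sigma> b = map Suc (word (length (\<sigma> q))) \<and> (\<forall>j. 0 < j \<and> j < tapes M \<longrightarrow> \<sigma> (b + j) = []) \<and>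
      \<sigma> st = [start_state M + 1]"
    define n where "n = length (\<sigma> q)"
    let ?m = "N + size_upto b \<sigma>"
    have nm: "n \<le> ?m" using length_le_size_upto[OF q, of \<sigma>] by (simp add: n_def)
    have Tm: "poly p n \<le> T ?m"
      using d[of n] power_mono[of "n + d" "?m + d" d] nm by (simp add: T_def)
    show "runs prog \<sigma> (\<sigma>(b := [], st := [Suc (f (length (\<sigma> q)))])) (w ?m)"
      unfolding runs_def
    proof (intro allI impI)
      fix ts assume represents: "represents ts \<sigma>"
      obtain t us where t: "t \<le> poly p n" "(step M ^^ t) (initial_config M n) = (halt_state M, us)"
        "tape_result (hd us) (word (f n))"
        using time unfolding computes_in_time_def by blast
      have stack: "is_stack (ts r) (\<sigma> r)" for r using represents by (simp add: represents_def)
      have s0: "simulates M b (initial_config M n) ts"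
        unfolding simulates_def
      proof (intro conjI allI impI)
        show "fst (initial_config M n) < states M" using M by (simp add: initial_config_def wf_tm_def)
        show "length (snd (initial_config M n)) = tapes M" using k by (simp add: initial_config_def)
        show "is_stack (ts (b + tapes M)) [fst (initial_config M n) + 1]"
          using stack[of st] I by (simp add: initial_config_def st_def)
      next
        fix j assume j: "j < tapes M"
        have u: "snd (initial_config M n) ! j = input_tape (if j = 0 then word n else [])"
          using j by (cases j) (simp_all add: initial_config_def)
        have "is_stack (ts (b + j)) (map Suc (if j = 0 then word n else []))"
          using stack[of "b + j"] I j by (cases "j = 0") (auto simp: n_def)
        then show "sim (snd (initial_config M n) ! j) (ts (b + j))"
          unfolding u by (rule sim_input)
        fix z
        have "x < symbols M" if "x \<in> set (word n)" for x
          using set_word[of n] M that by (auto simp: wf_tm_def)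
        moreover have "0 < symbols M" using M by (simp add: wf_tm_def)
        ultimately show "snd (snd (initial_config M n) ! j) z < symbols M"
          unfolding u by (auto simp: input_tape_def)
      qed
      obtain t1 ts1 where 1: "t1 \<le> 2 * t + 1" "exec loop ts t1 ts1" "simulates M b (halt_state M, us) ts1"
          "\<forall>i. i < b \<or> st < i \<longrightarrow> ts1 i = ts i"
        using simulates_run[OF M s0 t(2)] unfolding loop_def st_def by blast
      have us: "length us = tapes M" "us \<noteq> []" using 1(3) k by (auto simp: simulates_def)
      have sim: "sim (us ! j) (ts1 (b + j))" if "j < tapes M" for j
        using 1(3) that by (simp add: simulates_def)
      have "\<exists>t ts'. t \<le> 5 \<and> exec (read_digit b st) ts1 t ts' \<and> is_stack (ts' st) [Suc (f n)] \<and>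
         contiguous (insert (fst (ts' b)) (visited (ts' b))) \<and> (\<forall>i. i \<noteq> b \<and> i \<noteq> st \<longrightarrow> ts' i = ts1 i)"
      proof (rule exec_read_digit)
        show "sim (us ! 0) (ts1 b)" using sim[of 0] k by simp
        show "is_stack (ts1 st) [halt_state M + 1]" using 1(3) by (simp add: simulates_def st_def)
        show "tape_result (us ! 0) (word (f n))" using t(3) us by (simp add: hd_conv_nth)
      qed (use k f in \<open>simp_all add: st_def\<close>)
      then obtain t2 ts2 where 2: "t2 \<le> 5" "exec (read_digit b st) ts1 t2 ts2" "is_stack (ts2 st) [Suc (f n)]"
         "contiguous (insert (fst (ts2 b)) (visited (ts2 b)))" "\<forall>i. i \<noteq> b \<and> i \<noteq> st \<longrightarrow> ts2 i = ts1 i" by blast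
      have cells: "finite (visited (ts2 (b + j))) \<and> card (visited (ts2 (b + j))) \<le> B ?m \<and>
          contiguous (insert (fst (ts2 (b + j))) (visited (ts2 (b + j))))" if j: "j < tapes M" for j
      proof -
        have v: "visited (ts (b + j)) = {fst (ts (b + j))..<fst (ts (b + j)) + int (length (\<sigma> (b + j)))}"
          using is_stack_cells[OF stack] by (simp add: visited_def)
        have "length (\<sigma> (b + j)) \<le> n + 1"
          using I j length_word_le[of n] by (cases "j = 0") (auto simp: n_def)
        then have c0: "card (visited (ts (b + j))) \<le> n + 1" "finite (visited (ts (b + j)))"
          unfolding v by simp_all
        note e1 = exec_cells[OF 1(2), of "b + j", folded visited_def, OF c0(2)]
        note e2 = exec_cells[OF 2(2), of "b + j", folded visited_def, OF conjunct1[OF e1]]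
        have "card (visited (ts2 (b + j))) \<le> B ?m"
          unfolding B_def using e1 e2 c0(1) 1(1) 2(1) t(1) Tm nm by linarith
        moreover have "contiguous (insert (fst (ts2 (b + j))) (visited (ts2 (b + j))))"
        proof (cases "j = 0")
          case True
          then show ?thesis using 2(4) by simp
        next
          case False
          then have "ts2 (b + j) = ts1 (b + j)" using 2(5) j by (simp add: st_def)
          then show ?thesis using sim[OF j] by (simp add: sim_def)
        qed
        ultimately show ?thesis using e2 by blast
      qed
      obtain t3 ts3 where 3: "t3 \<le> tapes M * (4 * B ?m + 10) + 1" "exec (erase_all b (tapes M)) ts2 t3 ts3"
         "\<forall>j<tapes M. is_stack (ts3 (b + j)) []" "\<forall>i. i < b \<or> b + tapes M \<le> i \<longrightarrow> ts3 i = ts2 i"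
        using exec_erase_all[of "tapes M" ts2 b "B ?m"] cells by blast
      have "represents ts3 (\<sigma>(b := [], st := [Suc (f (length (\<sigma> q)))]))"
        unfolding represents_def
      proof
        fix r
        consider "r = st" | "b \<le> r" "r < st" | "r < b \<or> st < r" by linarith
        then show "is_stack (ts3 r) ((\<sigma>(b := [], st := [Suc (f (length (\<sigma> q)))])) r)"
        proof cases
          case 1
          then show ?thesis using 3(4) 2(3) by (simp add: st_def n_def)
        next
          case 2
          then obtain j where j: "r = b + j" "j < tapes M" by (metis le_Suc_ex nat_add_left_cancel_less st_def)
          then have "\<sigma> r = [] \<or> r = b" using I by (cases "j = 0") auto
          then show ?thesis using 3(3) j by (auto simp: st_def)
        next
          case r: 3
          then have "ts3 r = ts r" using 3(4) 2(5) 1(4) k by (auto simp: st_def)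
          then show ?thesis using stack[of r] r k by (auto simp: st_def)
        qed
      qed
      moreover have "exec prog ts (t1 + (t2 + t3)) ts3"
        unfolding prog_def by (rule exec.Seq[OF 1(2) exec.Seq[OF 2(2) 3(2)]])
      moreover have "t1 + (t2 + t3) \<le> w ?m"
        unfolding w_def using 1(1) 2(1) 3(1) t(1) Tm by linarith
      ultimately show "\<exists>t ts'. t \<le> w ?m \<and> exec prog ts t ts' \<and> represents ts' (\<sigma>(b := [], st := [Suc (f (length (\<sigma> q)))]))"
        by blast
    qed
  qed
qed

lemma polytime_symbol_to_unary:
  assumes st: "st \<noteq> out"
  shows "polytime (\<lambda>N \<sigma>. \<sigma> out = [] \<and> (\<exists>v\<le>2. \<sigma> st = [Suc v])) (\<lambda>\<sigma>. \<sigma>(out := unary (top_symbol (\<sigma> st) - 1)))"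
proof -
  let ?T = "\<lambda>_ _. True"
  have 1: "polytime ?T (\<lambda>\<sigma>. if top_symbol (\<sigma> st) \<in> {2, 3} then \<sigma>(out := 1 # \<sigma> out) else \<sigma>)"
    by (rule polytime_if[OF polytime_push_const polytime_skip]) simp
  have 2: "polytime ?T (\<lambda>\<sigma>. if top_symbol (\<sigma> st) \<in> {3} then \<sigma>(out := 1 # \<sigma> out) else \<sigma>)"
    by (rule polytime_if[OF polytime_push_const polytime_skip]) simp
  show ?thesis
  proof (rule polytime_seq[OF polytime_weaken[OF 1] 2])
    fix N :: nat and \<sigma> :: stacks
    assume "\<sigma> out = [] \<and> (\<exists>v\<le>2. \<sigma> st = [Suc v])"
    then obtain v where v: "\<sigma> out = []" "v \<le> 2" "\<sigma> st = [Suc v]" by blast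
    let ?t = "if top_symbol (\<sigma> st) \<in> {2, 3} then \<sigma>(out := 1 # \<sigma> out) else \<sigma>"
    have "v = 0 \<or> v = 1 \<or> v = 2" using v(2) by linarith
    then show "(if top_symbol (?t st) \<in> {3} then ?t(out := 1 # ?t out) else ?t) = \<sigma>(out := unary (top_symbol (\<sigma> st) - 1))"
      using v(1,3) st by (elim disjE) (simp_all add: numeral_2_eq_2 numeral_3_eq_3 fun_eq_iff)
  qed (rule refl | simp)+
qed

text \<open>
  A digit sequence that is computable in polynomial time in the argument can be called from
  programs like a basic function.
\<close>

theorem computes_of_poly_time:
  assumes f: "f \<in> poly_time_in_argument" "range f \<subseteq> {0, 1, 2}"
  shows "computes 1 (\<lambda>xs. f (xs ! 0))"
proof (rule computesI)
  fix ins :: "nat list" and out b :: nat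
  assume ins: "length ins = 1" "set ins \<subseteq> {..<b}" and out: "out < b" "out \<notin> set ins"
  obtain q where q: "ins = [q]" using ins(1) by (auto simp: length_Suc_conv)
  have qb: "q < b" "q \<noteq> out" using ins out by (auto simp: q)
  obtain M p where M: "wf_tm M" "computes_in_time M f (poly p)"
    using f(1) unfolding poly_time_in_argument_def by blast
  have f2: "f n \<le> 2" for n
  proof -
    have "f n \<in> {0, 1, 2}" using f(2) by (rule subsetD) (rule rangeI)
    then show ?thesis by auto
  qed
  have k: "0 < tapes M" using M by (simp add: wf_tm_def)
  let ?T = "\<lambda>_ _. True"
  let ?st = "b + tapes M"
  have 1: "polytime (empty_from b) (\<lambda>\<sigma>. \<sigma>(b := map Suc (word (length (\<sigma> q))), ?st := [start_state M + 1]))"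
    by (rule polytime_seq[OF polytime_word[OF qb(1)] polytime_push_const[of "start_state M + 1" ?T ?st]])
      (use k in \<open>auto simp: empty_from_def fun_eq_iff\<close>)
  have 2: "polytime (empty_from b) (\<lambda>\<sigma>. \<sigma>(?st := [Suc (f (length (\<sigma> q)))]))"
    by (rule polytime_seq[OF 1 polytime_machine[OF M f2 qb(1)]]) (use k qb in \<open>auto simp: empty_from_def fun_eq_iff\<close>)
  have 3: "polytime (empty_from b) (\<lambda>\<sigma>. \<sigma>(?st := [Suc (f (length (\<sigma> q)))], out := []))"
    by (rule polytime_seq[OF 2 polytime_clear[of ?T out]]) auto
  have st: "?st \<noteq> out" using out by simp
  have 5: "polytime (empty_from b) (\<lambda>\<sigma>. \<sigma>(?st := [Suc (f (length (\<sigma> q)))], out := unary (f (length (\<sigma> q)))))"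
    by (rule polytime_seq[OF 3 polytime_symbol_to_unary[OF st]]) (use st f2 in \<open>auto simp: fun_eq_iff\<close>)
  have "polytime (empty_from b) (\<lambda>\<sigma>. \<sigma>(out := unary (f (length (\<sigma> q)))))"
    by (rule polytime_seq[OF 5 polytime_clear[of ?T ?st]]) (use st in \<open>auto simp: empty_from_def fun_eq_iff\<close>)
  then show "polytime (empty_from b) (\<lambda>\<sigma>. \<sigma>(out := unary (f (map (\<lambda>r. length (\<sigma> r)) ins ! 0))))"
    by (simp add: q)
qed

section \<open>Linear forms of binary numbers\<close>

text \<open>
  A cell holds one bit of each of two numbers, the bits being those of the symbol diminished
  by 1. Lists of cells start with the least significant bits.
\<close>

definition rem_bit :: "nat \<Rightarrow> int" where "rem_bit x = int ((x - 1) mod 2)"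
definition root_bit :: "nat \<Rightarrow> int" where "root_bit x = int ((x - 1) div 2 mod 2)"

primrec rem_value :: "nat list \<Rightarrow> int" where
  "rem_value [] = 0" | "rem_value (x # xs) = rem_bit x + 2 * rem_value xs"

primrec root_value :: "nat list \<Rightarrow> int" where
  "root_value [] = 0" | "root_value (x # xs) = root_bit x + 2 * root_value xs"

definition cell :: "int \<Rightarrow> int \<Rightarrow> nat" where "cell a y = 1 + nat (a mod 2) + 2 * nat (y mod 2)"

lemma cell_bits: "rem_bit (cell a y) = a mod 2" "root_bit (cell a y) = y mod 2" "cell a y \<noteq> 0" "cell a y \<le> 4"
proof -
  have "a mod 2 = 0 \<or> a mod 2 = 1" "y mod 2 = 0 \<or> y mod 2 = 1" by auto
  then show "rem_bit (cell a y) = a mod 2" "root_bit (cell a y) = y mod 2" "cell a y \<noteq> 0" "cell a y \<le> 4"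
    by (auto simp: rem_bit_def root_bit_def cell_def)
qed

text \<open>
  A linear form with small integer coefficients is evaluated bit by bit with a small signed
  carry. The carry that remains at the end is negative exactly if the value of the form is.
\<close>

primrec carry_out :: "int \<Rightarrow> int \<Rightarrow> int \<Rightarrow> nat list \<Rightarrow> int" where
  "carry_out \<alpha> \<beta> c [] = c"
| "carry_out \<alpha> \<beta> c (x # xs) = carry_out \<alpha> \<beta> ((\<alpha> * rem_bit x + \<beta> * root_bit x + c) div 2) xs"

text \<open>
  One pass evaluates two linear forms at once, since the approximate root and the remainder
  are updated together.
\<close>

primrec combine :: "int \<Rightarrow> int \<Rightarrow> int \<Rightarrow> int \<Rightarrow> int \<Rightarrow> int \<Rightarrow> nat list \<Rightarrow> nat list" where
  "combine \<alpha> \<beta> c \<gamma> \<delta> d [] = []"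
| "combine \<alpha> \<beta> c \<gamma> \<delta> d (x # xs) =
     cell (\<alpha> * rem_bit x + \<beta> * root_bit x + c) (\<gamma> * rem_bit x + \<delta> * root_bit x + d) #
     combine \<alpha> \<beta> ((\<alpha> * rem_bit x + \<beta> * root_bit x + c) div 2) \<gamma> \<delta> ((\<gamma> * rem_bit x + \<delta> * root_bit x + d) div 2) xs"

lemma length_combine [simp]: "length (combine \<alpha> \<beta> c \<gamma> \<delta> d xs) = length xs"
  by (induction xs arbitrary: c d) auto

lemma combine_rem_value:
  "rem_value (combine \<alpha> \<beta> c \<gamma> \<delta> d xs) + 2 ^ length xs * carry_out \<alpha> \<beta> c xs = \<alpha> * rem_value xs + \<beta> * root_value xs + c"
proof (induction xs arbitrary: c d)
  case (Cons x xs)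
  let ?t = "\<alpha> * rem_bit x + \<beta> * root_bit x + c"
  let ?u = "(\<gamma> * rem_bit x + \<delta> * root_bit x + d) div 2"
  have "rem_value (combine \<alpha> \<beta> c \<gamma> \<delta> d (x # xs)) + 2 ^ length (x # xs) * carry_out \<alpha> \<beta> c (x # xs)
     = ?t mod 2 + 2 * (rem_value (combine \<alpha> \<beta> (?t div 2) \<gamma> \<delta> ?u xs) + 2 ^ length xs * carry_out \<alpha> \<beta> (?t div 2) xs)"
    by (simp add: cell_bits)
  also have "\<dots> = ?t mod 2 + 2 * (\<alpha> * rem_value xs + \<beta> * root_value xs + ?t div 2)"
    by (simp only: Cons)
  also have "\<dots> = \<alpha> * rem_value (x # xs) + \<beta> * root_value (x # xs) + c"
    using mult_div_mod_eq[of 2 ?t] by (simp add: algebra_simps)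
  finally show ?case .
qed simp

lemma combine_root_value:
  "root_value (combine \<alpha> \<beta> c \<gamma> \<delta> d xs) + 2 ^ length xs * carry_out \<gamma> \<delta> d xs = \<gamma> * rem_value xs + \<delta> * root_value xs + d"
proof (induction xs arbitrary: c d)
  case (Cons x xs)
  let ?t = "\<gamma> * rem_bit x + \<delta> * root_bit x + d"
  let ?u = "(\<alpha> * rem_bit x + \<beta> * root_bit x + c) div 2"
  have "root_value (combine \<alpha> \<beta> c \<gamma> \<delta> d (x # xs)) + 2 ^ length (x # xs) * carry_out \<gamma> \<delta> d (x # xs)
     = ?t mod 2 + 2 * (root_value (combine \<alpha> \<beta> ?u \<gamma> \<delta> (?t div 2) xs) + 2 ^ length xs * carry_out \<gamma> \<delta> (?t div 2) xs)"
    by (simp add: cell_bits)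
  also have "\<dots> = ?t mod 2 + 2 * (\<gamma> * rem_value xs + \<delta> * root_value xs + ?t div 2)"
    by (simp only: Cons)
  also have "\<dots> = \<gamma> * rem_value (x # xs) + \<delta> * root_value (x # xs) + d"
    using mult_div_mod_eq[of 2 ?t] by (simp add: algebra_simps)
  finally show ?case .
qed simp

lemma bits: "rem_bit x = 0 \<or> rem_bit x = 1" "root_bit x = 0 \<or> root_bit x = 1"
  by (auto simp: rem_bit_def root_bit_def)

lemma value_bounds:
  "0 \<le> rem_value xs" "rem_value xs < 2 ^ length xs" "0 \<le> root_value xs" "root_value xs < 2 ^ length xs"
proof -
  have "0 \<le> rem_value xs \<and> rem_value xs < 2 ^ length xs \<and> 0 \<le> root_value xs \<and> root_value xs < 2 ^ length xs"
  proof (induction xs)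
    case (Cons x xs)
    then show ?case using bits[of x] by auto
  qed simp
  then show "0 \<le> rem_value xs" "rem_value xs < 2 ^ length xs" "0 \<le> root_value xs" "root_value xs < 2 ^ length xs" by auto
qed

text \<open>
  A number between 0 and P has no carry beyond its bits.
\<close>

lemma quotient_zero:
  fixes v c w P :: int
  assumes "v + P * c = w" "0 \<le> v" "v < P" "0 \<le> w" "w < P" shows "c = 0"
proof (rule ccontr)
  assume "c \<noteq> 0"
  then consider "1 \<le> c" | "c \<le> -1" by linarith
  then show False
  proof cases
    case 1
    then have "P * 1 \<le> P * c" using assms by (intro mult_left_mono) auto
    then show False using assms by linarith
  next
    case 2
    then have "P * c \<le> P * (-1)" using assms by (intro mult_left_mono) auto
    then show False using assms by linarith
  qed
qed

lemma carry_out_neg: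
  "carry_out \<alpha> \<beta> c xs < 0 \<longleftrightarrow> \<alpha> * rem_value xs + \<beta> * root_value xs + c < 0"
proof -
  let ?v = "rem_value (combine \<alpha> \<beta> c 0 0 0 xs)" and ?P = "2 ^ length xs :: int" and ?c = "carry_out \<alpha> \<beta> c xs"
  have eq: "?v + ?P * ?c = \<alpha> * rem_value xs + \<beta> * root_value xs + c" by (rule combine_rem_value)
  have v: "0 \<le> ?v" "?v < ?P" using value_bounds[of "combine \<alpha> \<beta> c 0 0 0 xs"] by auto
  show ?thesis
  proof (cases "?c < 0")
    case True
    then have "?P * ?c \<le> ?P * (-1)" by (intro mult_left_mono) auto
    then show ?thesis using True eq v by linarith
  next
    case False
    then have "0 \<le> ?P * ?c" by simp
    then show ?thesis using False eq v by linarith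
  qed
qed

lemma combine_values:
  assumes "0 \<le> \<alpha> * rem_value xs + \<beta> * root_value xs + c" "\<alpha> * rem_value xs + \<beta> * root_value xs + c < 2 ^ length xs"
    "0 \<le> \<gamma> * rem_value xs + \<delta> * root_value xs + d" "\<gamma> * rem_value xs + \<delta> * root_value xs + d < 2 ^ length xs"
  shows "rem_value (combine \<alpha> \<beta> c \<gamma> \<delta> d xs) = \<alpha> * rem_value xs + \<beta> * root_value xs + c"
    "root_value (combine \<alpha> \<beta> c \<gamma> \<delta> d xs) = \<gamma> * rem_value xs + \<delta> * root_value xs + d"
proof -
  note b = value_bounds[of "combine \<alpha> \<beta> c \<gamma> \<delta> d xs", unfolded length_combine]
  have "carry_out \<alpha> \<beta> c xs = 0" using combine_rem_value b(1,2) assms(1,2) by (rule quotient_zero)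
  then show "rem_value (combine \<alpha> \<beta> c \<gamma> \<delta> d xs) = \<alpha> * rem_value xs + \<beta> * root_value xs + c"
    using combine_rem_value[of \<alpha> \<beta> c \<gamma> \<delta> d xs] by simp
  have "carry_out \<gamma> \<delta> d xs = 0" using combine_root_value b(3,4) assms(3,4) by (rule quotient_zero)
  then show "root_value (combine \<alpha> \<beta> c \<gamma> \<delta> d xs) = \<gamma> * rem_value xs + \<delta> * root_value xs + d"
    using combine_root_value[of \<alpha> \<beta> c \<gamma> \<delta> d xs] by simp
qed

lemma value_snoc:
  "rem_value (xs @ [x]) = rem_value xs + 2 ^ length xs * rem_bit x" "root_value (xs @ [x]) = root_value xs + 2 ^ length xs * root_bit x"
  by (induction xs) (auto simp: algebra_simps)

lemma ex_cells:
  assumes "0 \<le> A" "A < 2 ^ n" "0 \<le> Y" "Y < 2 ^ n"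
  shows "\<exists>xs. length xs = n \<and> rem_value xs = A \<and> root_value xs = Y \<and> 0 \<notin> set xs"
  using assms
proof (induction n arbitrary: A Y)
  case 0
  then show ?case by (intro exI[of _ "[]"]) auto
next
  case (Suc n)
  have "\<exists>xs. length xs = n \<and> rem_value xs = A div 2 \<and> root_value xs = Y div 2 \<and> 0 \<notin> set xs"
    by (rule Suc.IH) (use Suc.prems in auto)
  then obtain xs where "length xs = n" "rem_value xs = A div 2" "root_value xs = Y div 2" "0 \<notin> set xs" by blast
  then show ?case
    using cell_bits(3)[of A Y] by (intro exI[of _ "cell A Y # xs"]) (auto simp: cell_bits)
qed

text \<open>
  The pass works with the root Y and with the shifted remainder Z - Y^2 + Y, which lies
  between 0 and 2 Y, so that all numbers are natural. In these terms the conditions and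
  results of a root step are linear forms; s is the sum of the two next digits with weights 2
  and 1.
\<close>

definition test_up :: "nat list \<Rightarrow> nat \<Rightarrow> bool" where
  "test_up xs s \<longleftrightarrow> carry_out (-4) 6 (3 - int s) xs < 0"
definition test_down :: "nat list \<Rightarrow> nat \<Rightarrow> bool" where
  "test_down xs s \<longleftrightarrow> carry_out 4 (-2) (int s - 3) xs < 0"
definition next_digit :: "nat list \<Rightarrow> nat \<Rightarrow> nat" where
  "next_digit xs s = (if test_up xs s then 2 else if test_down xs s then 0 else 1)"
definition remainder_coeff :: "nat \<Rightarrow> int" where
  "remainder_coeff e = (if e = 2 then -6 else if e = 0 then 2 else -2)"
definition remainder_offset :: "nat \<Rightarrow> nat \<Rightarrow> int" where
  "remainder_offset e s = (if e = 0 then int s - 5 else int s - 3)"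
definition next_cells :: "nat list \<Rightarrow> nat \<Rightarrow> nat list" where
  "next_cells xs s = combine 4 (remainder_coeff (next_digit xs s)) (remainder_offset (next_digit xs s) s) 0 2 (int (next_digit xs s) - 1) xs @ [1]"

text \<open>
  The last condition leaves room for the new root and remainder in cells of the same number.
  One further cell per step preserves it, because Y + 1 at most doubles.
\<close>

definition encodes :: "nat list \<Rightarrow> nat \<Rightarrow> nat \<Rightarrow> bool" where
  "encodes xs Z Y \<longleftrightarrow> rem_value xs = int Z + int Y - int Y * int Y \<and> root_value xs = int Y \<and> 8 * (int Y + 1) \<le> 2 ^ length xs"

text \<open>
  Substituting Z = A + Y^2 - Y for the shifted remainder A into the definition of a root step
  removes all quadratic terms.
\<close>

lemma encodes_step:
  assumes near: "near_square Z Y" and enc: "encodes xs Z Y" and s: "s \<le> 6"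
  defines "Z' \<equiv> 4 * Z + s - 3"
  shows "next_digit xs s = root_step Z' Y + 1 - 2 * Y" "encodes (next_cells xs s) Z' (root_step Z' Y)"
proof -
  define Q where "Q = int Y * int Y"
  have Y3: "3 \<le> Y" and nZ: "int Z \<le> Q + int Y" "Q \<le> int Z + int Y"
    using near unfolding near_square_def Q_def of_nat_mult[symmetric] of_nat_add[symmetric] of_nat_le_iff by auto
  have "3 * int Y \<le> Q" unfolding Q_def using Y3 by (intro mult_right_mono) auto
  then have "6 \<le> Z" using nZ Y3 by linarith
  then have Z': "int Z' = 4 * int Z + int s - 3" by (simp add: Z'_def of_nat_diff)
  have A: "rem_value xs = int Z + int Y - Q" and Yv: "root_value xs = int Y" and len: "8 * (int Y + 1) \<le> 2 ^ length xs"
    using enc by (auto simp: encodes_def Q_def)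
  define Y' where "Y' = root_step Z' Y"
  have near': "near_square Z' Y'" using root_step_near[OF near s] by (simp add: Z'_def Y'_def)
  define e where "e = next_digit xs s"
  have up: "test_up xs s \<longleftrightarrow> 4 * Q + 2 * int Y < int Z'"
    unfolding test_up_def carry_out_neg A Yv Z' by auto
  have down: "test_down xs s \<longleftrightarrow> int Z' + 2 * int Y < 4 * Q"
    unfolding test_down_def carry_out_neg A Yv Z' by auto
  have up': "4 * Q + 2 * int Y < int Z' \<longleftrightarrow> 4 * (Y * Y) + 2 * Y < Z'"
  proof -
    have "int (4 * (Y * Y) + 2 * Y) = 4 * Q + 2 * int Y" by (simp add: Q_def)
    then show ?thesis by (metis of_nat_less_iff)
  qed
  have down': "int Z' + 2 * int Y < 4 * Q \<longleftrightarrow> Z' + 2 * Y < 4 * (Y * Y)"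
  proof -
    have "int (4 * (Y * Y)) = 4 * Q" "int (Z' + 2 * Y) = int Z' + 2 * int Y" by (simp_all add: Q_def)
    then show ?thesis by (metis of_nat_less_iff)
  qed
  have e: "e = (if 4 * (Y * Y) + 2 * Y < Z' then 2 else if Z' + 2 * Y < 4 * (Y * Y) then 0 else 1)"
    unfolding e_def next_digit_def up down up' down' by simp
  show "next_digit xs s = root_step Z' Y + 1 - 2 * Y"
    using Y3 unfolding e_def[symmetric] e root_step_def by auto
  have Y'_eq: "int Y' = 2 * int Y + (int e - 1)"
    using Y3 unfolding Y'_def root_step_def e by auto
  have e3: "e = 0 \<or> e = 1 \<or> e = 2" unfolding e by auto
  have A': "4 * rem_value xs + remainder_coeff e * root_value xs + remainder_offset e s = int Z' + int Y' - int Y' * int Y'"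
    using e3 unfolding A Yv Z' Y'_eq Q_def
    by (elim disjE) (simp_all add: remainder_coeff_def remainder_offset_def algebra_simps)
  have Yv': "0 * rem_value xs + 2 * root_value xs + (int e - 1) = int Y'"
    unfolding Yv Y'_eq by simp
  have n': "int Z' \<le> int Y' * int Y' + int Y'" "int Y' * int Y' \<le> int Z' + int Y'"
    using near' unfolding near_square_def of_nat_mult[symmetric] of_nat_add[symmetric] of_nat_le_iff by auto
  have Y'_le: "int Y' \<le> 2 * int Y + 1" using e3 Y'_eq by auto
  have vals: "rem_value (combine 4 (remainder_coeff e) (remainder_offset e s) 0 2 (int e - 1) xs) = int Z' + int Y' - int Y' * int Y'"
    "root_value (combine 4 (remainder_coeff e) (remainder_offset e s) 0 2 (int e - 1) xs) = int Y'"
  proof -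
    have b: "0 \<le> 4 * rem_value xs + remainder_coeff e * root_value xs + remainder_offset e s"
      "4 * rem_value xs + remainder_coeff e * root_value xs + remainder_offset e s < 2 ^ length xs"
      "0 \<le> 0 * rem_value xs + 2 * root_value xs + (int e - 1)"
      "0 * rem_value xs + 2 * root_value xs + (int e - 1) < 2 ^ length xs"
    proof -
      have lin: "z + y - w < P" "y < P" if "z \<le> w + y" "y \<le> 2 * v + 1" "8 * (v + 1) \<le> P" "0 \<le> v" for z y w v P :: int
        using that by simp_all
      show "0 \<le> 4 * rem_value xs + remainder_coeff e * root_value xs + remainder_offset e s" unfolding A' using n'(2) by simp
      show "4 * rem_value xs + remainder_coeff e * root_value xs + remainder_offset e s < 2 ^ length xs"
        unfolding A' by (rule lin(1)[OF n'(1) Y'_le len]) simp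
      show "0 \<le> 0 * rem_value xs + 2 * root_value xs + (int e - 1)" unfolding Yv' by simp
      show "0 * rem_value xs + 2 * root_value xs + (int e - 1) < 2 ^ length xs"
        unfolding Yv' by (rule lin(2)[OF n'(1) Y'_le len]) simp
    qed
    show "rem_value (combine 4 (remainder_coeff e) (remainder_offset e s) 0 2 (int e - 1) xs) = int Z' + int Y' - int Y' * int Y'"
      using combine_values(1)[OF b] A' by simp
    show "root_value (combine 4 (remainder_coeff e) (remainder_offset e s) 0 2 (int e - 1) xs) = int Y'"
      using combine_values(2)[OF b] Yv' by simp
  qed
  have "rem_bit 1 = 0" "root_bit 1 = 0" by (simp_all add: rem_bit_def root_bit_def)
  then show "encodes (next_cells xs s) Z' (root_step Z' Y)"
    unfolding encodes_def next_cells_def e_def[symmetric] Y'_def[symmetric] value_snoc vals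
    using Y'_le len by (simp add: vals)
qed

section \<open>The square root on a Turing machine\<close>

text \<open>
  Carries between -20 and 20 as symbols; the coefficients in use never leave this range.
\<close>

definition symbol :: "int \<Rightarrow> nat" where "symbol c = nat (max (-20) (min 20 c) + 21)"

lemma symbol_bounds: "symbol c \<noteq> 0" "symbol c \<le> 41"
  by (auto simp: symbol_def)

lemma symbol_inverse: "\<bar>c\<bar> \<le> 20 \<Longrightarrow> int (symbol c) - 21 = c"
  by (auto simp: symbol_def)

definition linear :: "int \<Rightarrow> int \<Rightarrow> nat \<Rightarrow> nat \<Rightarrow> int" where
  "linear \<alpha> \<beta> x k = \<alpha> * rem_bit x + \<beta> * root_bit x + (int k - 21)"

definition pass_step :: "(nat \<Rightarrow> nat \<Rightarrow> nat \<Rightarrow> nat) \<Rightarrow> int \<Rightarrow> int \<Rightarrow> int \<Rightarrow> int \<Rightarrow> nat list \<times> nat \<times> nat \<Rightarrow> nat \<Rightarrow> nat list \<times> nat \<times> nat" where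
  "pass_step out \<alpha> \<beta> \<gamma> \<delta> = (\<lambda>(T, k, l) x. (out x k l # T, symbol (linear \<alpha> \<beta> x k div 2), symbol (linear \<gamma> \<delta> x l div 2)))"

lemma small_carry:
  assumes "\<bar>\<alpha>\<bar> + \<bar>\<beta>\<bar> \<le> 10" "\<bar>c\<bar> \<le> 20" shows "\<bar>(\<alpha> * rem_bit x + \<beta> * root_bit x + c) div 2\<bar> \<le> 20"
proof -
  have "\<bar>\<alpha> * rem_bit x + \<beta> * root_bit x\<bar> \<le> 10" using assms(1) bits[of x] by auto
  then show ?thesis using assms(2) by linarith
qed

lemma pass_copy:
  assumes "\<bar>\<alpha>\<bar> + \<bar>\<beta>\<bar> \<le> 10" "\<bar>\<gamma>\<bar> + \<bar>\<delta>\<bar> \<le> 10" "\<bar>c\<bar> \<le> 20" "\<bar>d\<bar> \<le> 20"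
  shows "foldl (pass_step (\<lambda>x k l. x) \<alpha> \<beta> \<gamma> \<delta>) (T, symbol c, symbol d) xs
    = (rev xs @ T, symbol (carry_out \<alpha> \<beta> c xs), symbol (carry_out \<gamma> \<delta> d xs))
    \<and> \<bar>carry_out \<alpha> \<beta> c xs\<bar> \<le> 20 \<and> \<bar>carry_out \<gamma> \<delta> d xs\<bar> \<le> 20"
  using assms(3,4)
proof (induction xs arbitrary: T c d)
  case (Cons x xs)
  have "pass_step (\<lambda>x k l. x) \<alpha> \<beta> \<gamma> \<delta> (T, symbol c, symbol d) x
    = (x # T, symbol ((\<alpha> * rem_bit x + \<beta> * root_bit x + c) div 2), symbol ((\<gamma> * rem_bit x + \<delta> * root_bit x + d) div 2))"
    using Cons.prems by (simp add: pass_step_def linear_def symbol_inverse)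
  then show ?case
    using Cons.IH[OF small_carry[OF assms(1) Cons.prems(1)] small_carry[OF assms(2) Cons.prems(2)]] by simp
qed simp

lemma pass_combine:
  assumes "\<bar>\<alpha>\<bar> + \<bar>\<beta>\<bar> \<le> 10" "\<bar>\<gamma>\<bar> + \<bar>\<delta>\<bar> \<le> 10" "\<bar>c\<bar> \<le> 20" "\<bar>d\<bar> \<le> 20"
  shows "fst (foldl (pass_step (\<lambda>x k l. cell (linear \<alpha> \<beta> x k) (linear \<gamma> \<delta> x l)) \<alpha> \<beta> \<gamma> \<delta>) (T, symbol c, symbol d) xs)
    = rev (combine \<alpha> \<beta> c \<gamma> \<delta> d xs) @ T"
  using assms(3,4)
proof (induction xs arbitrary: T c d)
  case (Cons x xs)
  have "pass_step (\<lambda>x k l. cell (linear \<alpha> \<beta> x k) (linear \<gamma> \<delta> x l)) \<alpha> \<beta> \<gamma> \<delta> (T, symbol c, symbol d) x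
    = (cell (\<alpha> * rem_bit x + \<beta> * root_bit x + c) (\<gamma> * rem_bit x + \<delta> * root_bit x + d) # T,
       symbol ((\<alpha> * rem_bit x + \<beta> * root_bit x + c) div 2), symbol ((\<gamma> * rem_bit x + \<delta> * root_bit x + d) div 2))"
    using Cons.prems by (simp add: pass_step_def linear_def symbol_inverse)
  then show ?case
    using Cons.IH[OF small_carry[OF assms(1) Cons.prems(1)] small_carry[OF assms(2) Cons.prems(2)]] by simp
qed simp

lemma admissible_tops:
  assumes "\<And>x s k l e. F x s k l e \<le> c"
  shows "admissible (\<lambda>a. F (a 4) (a 6) (a 7) (a 8) (a 10))"
  by (rule admissible_bounded[of 11]) (use assms in simp_all)

text \<open>
  Stack 4 holds the cells, stack 5 receives the new ones in reverse order, stacks 7 and 8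
  hold the carries, and stack 10 holds the symbol of the digit on which the coefficients may
  depend.
\<close>

lemma polytime_pass:
  fixes out :: "nat \<Rightarrow> nat \<Rightarrow> nat \<Rightarrow> nat \<Rightarrow> nat" and \<alpha> \<beta> \<gamma> \<delta> :: "nat \<Rightarrow> int"
  assumes out: "\<And>e x k l. x \<noteq> 0 \<Longrightarrow> out e x k l \<noteq> 0"
    and adm: "admissible (\<lambda>a. out (a 10) (a 4) (a 7) (a 8))"
  shows "polytime (\<lambda>N \<sigma>. length (\<sigma> 7) = 1 \<and> length (\<sigma> 8) = 1)
    (\<lambda>\<sigma>. case foldl (pass_step (out (top_symbol (\<sigma> 10))) (\<alpha> (top_symbol (\<sigma> 10))) (\<beta> (top_symbol (\<sigma> 10))) (\<gamma> (top_symbol (\<sigma> 10))) (\<delta> (top_symbol (\<sigma> 10))))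
        (\<sigma> 5, top_symbol (\<sigma> 7), top_symbol (\<sigma> 8)) (\<sigma> 4) of (T, k, l) \<Rightarrow> \<sigma>(4 := [], 5 := T, 7 := [k], 8 := [l]))"
proof -
  let ?J = "\<lambda>N \<sigma>. length (\<sigma> 7) = 1 \<and> length (\<sigma> 8) = 1 \<and> \<sigma> 4 \<noteq> []"
  let ?nC = "\<lambda>e x k. symbol (linear (\<alpha> e) (\<beta> e) x k div 2)"
  let ?nD = "\<lambda>e x l. symbol (linear (\<gamma> e) (\<delta> e) x l div 2)"
  have 1: "polytime ?J (\<lambda>\<sigma>. \<sigma>(5 := out (top_symbol (\<sigma> 10)) (top_symbol (\<sigma> 4)) (top_symbol (\<sigma> 7)) (top_symbol (\<sigma> 8)) # \<sigma> 5))"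
  proof (rule polytime_assume_nonzero, rule polytime_push[OF adm])
    fix N :: nat and \<sigma> :: stacks assume J: "?J N \<sigma> \<and> (\<forall>r. 0 \<notin> set (\<sigma> r))"
    then obtain x xs where x: "\<sigma> 4 = x # xs" by (cases "\<sigma> 4") auto
    have "0 \<notin> set (\<sigma> 4)" using J by blast
    then show "out (top_symbol (\<sigma> 10)) (top_symbol (\<sigma> 4)) (top_symbol (\<sigma> 7)) (top_symbol (\<sigma> 8)) \<noteq> 0" by (intro out) (simp add: x)
  qed simp
  have 2: "polytime ?J (\<lambda>\<sigma>. \<sigma>(7 := ?nC (top_symbol (\<sigma> 10)) (top_symbol (\<sigma> 4)) (top_symbol (\<sigma> 7)) # tl (\<sigma> 7)))"
    by (rule polytime_set_top[where h = "\<lambda>a. ?nC (a 10) (a 4) (a 7)"],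
        rule admissible_tops[of "\<lambda>x s k l e. ?nC e x k" 41]) (auto simp: symbol_bounds)
  have 3: "polytime ?J (\<lambda>\<sigma>. \<sigma>(8 := ?nD (top_symbol (\<sigma> 10)) (top_symbol (\<sigma> 4)) (top_symbol (\<sigma> 8)) # tl (\<sigma> 8)))"
    by (rule polytime_set_top[where h = "\<lambda>a. ?nD (a 10) (a 4) (a 8)"],
        rule admissible_tops[of "\<lambda>x s k l e. ?nD e x l" 41]) (auto simp: symbol_bounds)
  have 12: "polytime ?J (\<lambda>\<sigma>. \<sigma>(5 := out (top_symbol (\<sigma> 10)) (top_symbol (\<sigma> 4)) (top_symbol (\<sigma> 7)) (top_symbol (\<sigma> 8)) # \<sigma> 5,
      7 := [?nC (top_symbol (\<sigma> 10)) (top_symbol (\<sigma> 4)) (top_symbol (\<sigma> 7))]))"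
    by (rule polytime_seq[OF 1 2]) (auto simp: length_Suc_conv)
  have 123: "polytime ?J (\<lambda>\<sigma>. \<sigma>(5 := out (top_symbol (\<sigma> 10)) (top_symbol (\<sigma> 4)) (top_symbol (\<sigma> 7)) (top_symbol (\<sigma> 8)) # \<sigma> 5,
      7 := [?nC (top_symbol (\<sigma> 10)) (top_symbol (\<sigma> 4)) (top_symbol (\<sigma> 7))], 8 := [?nD (top_symbol (\<sigma> 10)) (top_symbol (\<sigma> 4)) (top_symbol (\<sigma> 8))]))"
    by (rule polytime_seq[OF 12 3]) (auto simp: length_Suc_conv)
  have body: "polytime ?J (\<lambda>\<sigma>. \<sigma>(5 := out (top_symbol (\<sigma> 10)) (top_symbol (\<sigma> 4)) (top_symbol (\<sigma> 7)) (top_symbol (\<sigma> 8)) # \<sigma> 5,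
      7 := [?nC (top_symbol (\<sigma> 10)) (top_symbol (\<sigma> 4)) (top_symbol (\<sigma> 7))], 8 := [?nD (top_symbol (\<sigma> 10)) (top_symbol (\<sigma> 4)) (top_symbol (\<sigma> 8))],
      4 := tl (\<sigma> 4)))"
    by (rule polytime_seq[OF 123 polytime_pop[of "\<lambda>_ _. True" 4]]) auto
  let ?step = "\<lambda>\<sigma> :: stacks. pass_step (out (top_symbol (\<sigma> 10))) (\<alpha> (top_symbol (\<sigma> 10))) (\<beta> (top_symbol (\<sigma> 10))) (\<gamma> (top_symbol (\<sigma> 10))) (\<delta> (top_symbol (\<sigma> 10)))"
  let ?f = "\<lambda>(\<sigma> :: stacks) i. foldl (?step \<sigma>) (\<sigma> 5, top_symbol (\<sigma> 7), top_symbol (\<sigma> 8)) (take i (\<sigma> 4))"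
  let ?s = "\<lambda>\<sigma> i. \<sigma>(4 := drop i (\<sigma> 4), 5 := fst (?f \<sigma> i), 7 := [fst (snd (?f \<sigma> i))], 8 := [snd (snd (?f \<sigma> i))])"
  have len: "length (fst (foldl (pass_step o' a b c d) t xs)) = length (fst t) + length xs" for o' a b c d t xs
    by (induction xs arbitrary: t) (auto simp: pass_step_def split: prod.splits)
  have "polytime (\<lambda>N \<sigma>. length (\<sigma> 7) = 1 \<and> length (\<sigma> 8) = 1) (\<lambda>\<sigma>. ?s \<sigma> (length (\<sigma> 4)))"
  proof (rule polytime_foreach[where s = ?s and q = "\<lambda>m. m + 1" and B = 5, OF body])
    show "poly_bounded (\<lambda>m. m + 1)" by (intro poly_bounded_add poly_bounded_id poly_bounded_const)
    fix N :: nat and \<sigma> :: stacks and i r' :: nat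
    assume I: "length (\<sigma> 7) = 1 \<and> length (\<sigma> 8) = 1"
    show "?s \<sigma> 0 = \<sigma>" using I by (auto simp: fun_eq_iff length_Suc_conv)
    assume i: "i < length (\<sigma> 4)"
    show "length (?s \<sigma> i 7) = 1 \<and> length (?s \<sigma> i 8) = 1 \<and> ?s \<sigma> i 4 \<noteq> []" using i by simp
    obtain T k l where f: "?f \<sigma> i = (T, k, l)" by (metis prod_cases3)
    have f': "?f \<sigma> (Suc i) = ?step \<sigma> (T, k, l) (\<sigma> 4 ! i)"
      using f by (simp add: take_Suc_conv_app_nth[OF i])
    show "(\<lambda>\<sigma>. \<sigma>(5 := out (top_symbol (\<sigma> 10)) (top_symbol (\<sigma> 4)) (top_symbol (\<sigma> 7)) (top_symbol (\<sigma> 8)) # \<sigma> 5,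
      7 := [?nC (top_symbol (\<sigma> 10)) (top_symbol (\<sigma> 4)) (top_symbol (\<sigma> 7))], 8 := [?nD (top_symbol (\<sigma> 10)) (top_symbol (\<sigma> 4)) (top_symbol (\<sigma> 8))],
      4 := tl (\<sigma> 4))) (?s \<sigma> i) = ?s \<sigma> (Suc i)"
      unfolding f f' using drop_facts[OF i] by (auto simp: fun_eq_iff pass_step_def)
    have "length T = length (\<sigma> 5) + i" using len[of _ _ _ _ _ _ "take i (\<sigma> 4)"] f i
      by (metis fst_conv length_take min.absorb4)
    then show "length (?s \<sigma> i r') \<le> length (\<sigma> r') + (N + size_upto 5 \<sigma> + 1)"
      unfolding f using i length_le_size_upto[of 4 5 \<sigma>] by auto
  qed simp
  then show ?thesis by (rule polytime_cong) (simp add: case_prod_unfold)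
qed

lemma polytime_push_list: "0 \<notin> set xs \<Longrightarrow> polytime I (\<lambda>\<sigma>. \<sigma>(r := xs @ \<sigma> r))"
proof (induction xs)
  case Nil
  show ?case by (rule polytime_cong[OF polytime_skip]) simp
next
  case (Cons x xs)
  have xs: "polytime I (\<lambda>\<sigma>. \<sigma>(r := xs @ \<sigma> r))" by (rule Cons.IH) (use Cons.prems in simp)
  show ?case
    by (rule polytime_seq[OF xs polytime_push_const[of x "\<lambda>_ _. True" r]]) (use Cons.prems in auto)
qed

text \<open>
  A pass that copies the cells and keeps only the final carries decides the next digit.
\<close>

lemma polytime_digit_pass:
  "polytime (\<lambda>N \<sigma>. \<sigma> 5 = [] \<and> (\<exists>s\<le>6. \<sigma> 6 = [Suc s]) \<and> \<sigma> 7 = [] \<and> \<sigma> 8 = [])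
    (\<lambda>\<sigma>. \<sigma>(10 := [Suc (next_digit (\<sigma> 4) (top_symbol (\<sigma> 6) - 1))]))"
  (is "polytime ?I _")
proof -
  let ?T = "\<lambda>_ _. True"
  let ?c = "\<lambda>a. symbol (4 - int a)" and ?d = "\<lambda>a. symbol (int a - 4)"
  let ?e = "\<lambda>k l. if k < (21::nat) then 3 else if l < (21::nat) then 1 else (2::nat)"
  have c: "polytime ?I (\<lambda>\<sigma>. \<sigma>(7 := ?c (top_symbol (\<sigma> 6)) # \<sigma> 7))"
    by (rule polytime_push[where h = "\<lambda>a. ?c (a 6)"], rule admissible_tops[of "\<lambda>x s k l e. ?c s" 41])
      (auto simp: symbol_bounds)
  have d: "polytime ?T (\<lambda>\<sigma>. \<sigma>(8 := ?d (top_symbol (\<sigma> 6)) # \<sigma> 8))"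
    by (rule polytime_push[where h = "\<lambda>a. ?d (a 6)"], rule admissible_tops[of "\<lambda>x s k l e. ?d s" 41])
      (auto simp: symbol_bounds)
  have 1: "polytime ?I (\<lambda>\<sigma>. \<sigma>(7 := [?c (top_symbol (\<sigma> 6))], 8 := [?d (top_symbol (\<sigma> 6))]))"
    by (rule polytime_seq[OF c d]) auto
  have pass: "polytime (\<lambda>N \<sigma>. length (\<sigma> 7) = 1 \<and> length (\<sigma> 8) = 1)
    (\<lambda>\<sigma>. case foldl (pass_step (\<lambda>x k l. x) (-4) 6 4 (-2)) (\<sigma> 5, top_symbol (\<sigma> 7), top_symbol (\<sigma> 8)) (\<sigma> 4) of
      (T, k, l) \<Rightarrow> \<sigma>(4 := [], 5 := T, 7 := [k], 8 := [l]))"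
    by (rule polytime_pass[where out = "\<lambda>e x k l. x" and \<alpha> = "\<lambda>_. -4" and \<beta> = "\<lambda>_. 6" and \<gamma> = "\<lambda>_. 4" and \<delta> = "\<lambda>_. -2"])
      (auto intro: admissible_read)
  let ?C = "\<lambda>\<sigma>. carry_out (-4) 6 (3 - int (top_symbol (\<sigma> 6) - 1)) (\<sigma> 4)"
  let ?D = "\<lambda>\<sigma>. carry_out 4 (-2) (int (top_symbol (\<sigma> 6) - 1) - 3) (\<sigma> 4)"
  have fold: "foldl (pass_step (\<lambda>x k l. x) (-4) 6 4 (-2)) ([], ?c (top_symbol (\<sigma> 6)), ?d (top_symbol (\<sigma> 6))) (\<sigma> 4)
      = (rev (\<sigma> 4), symbol (?C \<sigma>), symbol (?D \<sigma>)) \<and> \<bar>?C \<sigma>\<bar> \<le> 20 \<and> \<bar>?D \<sigma>\<bar> \<le> 20" if "?I N \<sigma>" for N :: nat and \<sigma> :: stacks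
  proof -
    obtain s where s: "s \<le> 6" "\<sigma> 6 = [Suc s]" using \<open>?I N \<sigma>\<close> by blast
    show ?thesis using pass_copy[of "-4" 6 4 "-2" "3 - int s" "int s - 3" "[]" "\<sigma> 4"] s by simp
  qed
  have 2: "polytime ?I (\<lambda>\<sigma>. \<sigma>(4 := [], 5 := rev (\<sigma> 4), 7 := [symbol (?C \<sigma>)], 8 := [symbol (?D \<sigma>)]))"
  proof (rule polytime_seq[OF 1 pass])
    fix N :: nat and \<sigma> :: stacks assume I: "?I N \<sigma>"
    let ?t = "\<sigma>(7 := [?c (top_symbol (\<sigma> 6))], 8 := [?d (top_symbol (\<sigma> 6))])"
    have "foldl (pass_step (\<lambda>x k l. x) (-4) 6 4 (-2)) (?t 5, top_symbol (?t 7), top_symbol (?t 8)) (?t 4)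
      = (rev (\<sigma> 4), symbol (?C \<sigma>), symbol (?D \<sigma>))" using fold[OF I] I by simp
    then show "(case foldl (pass_step (\<lambda>x k l. x) (-4) 6 4 (-2)) (?t 5, top_symbol (?t 7), top_symbol (?t 8)) (?t 4) of
      (T, k, l) \<Rightarrow> ?t(4 := [], 5 := T, 7 := [k], 8 := [l]))
      = \<sigma>(4 := [], 5 := rev (\<sigma> 4), 7 := [symbol (?C \<sigma>)], 8 := [symbol (?D \<sigma>)])"
      by (simp only: prod.case) (auto simp: fun_eq_iff)
  qed simp
  have 3: "polytime ?I (\<lambda>\<sigma>. \<sigma>(4 := [], 5 := rev (\<sigma> 4), 7 := [symbol (?C \<sigma>)], 8 := [symbol (?D \<sigma>)], 10 := []))"
    by (rule polytime_seq[OF 2 polytime_clear[of ?T 10]]) auto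
  have e: "polytime ?T (\<lambda>\<sigma>. \<sigma>(10 := ?e (top_symbol (\<sigma> 7)) (top_symbol (\<sigma> 8)) # \<sigma> 10))"
    by (rule polytime_push[where h = "\<lambda>a. ?e (a 7) (a 8)"], rule admissible_bounded[of 11 _ 3]) auto
  have neg: "symbol c < 21 \<longleftrightarrow> c < 0" for c by (auto simp: symbol_def)
  have 4: "polytime ?I (\<lambda>\<sigma>. \<sigma>(4 := [], 5 := rev (\<sigma> 4), 7 := [symbol (?C \<sigma>)], 8 := [symbol (?D \<sigma>)],
      10 := [Suc (next_digit (\<sigma> 4) (top_symbol (\<sigma> 6) - 1))]))"
    by (rule polytime_seq[OF 3 e]) (auto simp: fun_eq_iff neg next_digit_def test_up_def test_down_def)
  have 5: "polytime ?I (\<lambda>\<sigma>. \<sigma>(4 := [], 5 := rev (\<sigma> 4), 7 := [], 8 := [symbol (?D \<sigma>)],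
      10 := [Suc (next_digit (\<sigma> 4) (top_symbol (\<sigma> 6) - 1))]))"
    by (rule polytime_seq[OF 4 polytime_clear[of ?T 7]]) (auto simp: fun_eq_iff)
  have 6: "polytime ?I (\<lambda>\<sigma>. \<sigma>(4 := [], 5 := rev (\<sigma> 4), 7 := [], 8 := [],
      10 := [Suc (next_digit (\<sigma> 4) (top_symbol (\<sigma> 6) - 1))]))"
    by (rule polytime_seq[OF 5 polytime_clear[of ?T 8]]) (auto simp: fun_eq_iff)
  show ?thesis
    by (rule polytime_seq[OF 6 polytime_move[of 5 4 ?T]]) (auto simp: fun_eq_iff)
qed

text \<open>
  With the digit known, a second pass computes the bits of the new root and remainder.
\<close>

lemma polytime_update_pass:
  "polytime (\<lambda>N \<sigma>. \<sigma> 5 = [] \<and> (\<exists>s\<le>6. \<sigma> 6 = [Suc s]) \<and> \<sigma> 7 = [] \<and> \<sigma> 8 = [] \<and>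
      \<sigma> 10 = [Suc (next_digit (\<sigma> 4) (top_symbol (\<sigma> 6) - 1))])
    (\<lambda>\<sigma>. \<sigma>(4 := next_cells (\<sigma> 4) (top_symbol (\<sigma> 6) - 1)))"
  (is "polytime ?I _")
proof -
  let ?T = "\<lambda>_ _. True"
  let ?c = "\<lambda>e a. symbol (remainder_offset (e - 1) (a - 1))" and ?d = "\<lambda>e. symbol (int e - 2)"
  let ?e = "\<lambda>\<sigma>. next_digit (\<sigma> 4) (top_symbol (\<sigma> 6) - 1)"
  let ?out = "\<lambda>e x k l. cell (linear 4 (remainder_coeff (e - 1)) x k) (linear 0 2 x l)"
  have c: "polytime ?I (\<lambda>\<sigma>. \<sigma>(7 := ?c (top_symbol (\<sigma> 10)) (top_symbol (\<sigma> 6)) # \<sigma> 7))"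
    by (rule polytime_push[where h = "\<lambda>a. ?c (a 10) (a 6)"], rule admissible_tops[of "\<lambda>x s k l e. ?c e s" 41])
      (auto simp: symbol_bounds)
  have d: "polytime ?T (\<lambda>\<sigma>. \<sigma>(8 := ?d (top_symbol (\<sigma> 10)) # \<sigma> 8))"
    by (rule polytime_push[where h = "\<lambda>a. ?d (a 10)"], rule admissible_tops[of "\<lambda>x s k l e. ?d e" 41])
      (auto simp: symbol_bounds)
  have 1: "polytime ?I (\<lambda>\<sigma>. \<sigma>(7 := [symbol (remainder_offset (?e \<sigma>) (top_symbol (\<sigma> 6) - 1))], 8 := [symbol (int (?e \<sigma>) - 1)]))"
    by (rule polytime_seq[OF c d]) auto
  have pass: "polytime (\<lambda>N \<sigma>. length (\<sigma> 7) = 1 \<and> length (\<sigma> 8) = 1)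
    (\<lambda>\<sigma>. case foldl (pass_step (?out (top_symbol (\<sigma> 10))) 4 (remainder_coeff (top_symbol (\<sigma> 10) - 1)) 0 2) (\<sigma> 5, top_symbol (\<sigma> 7), top_symbol (\<sigma> 8)) (\<sigma> 4) of
      (T, k, l) \<Rightarrow> \<sigma>(4 := [], 5 := T, 7 := [k], 8 := [l]))"
    by (rule polytime_pass[where out = ?out and \<alpha> = "\<lambda>_. 4" and \<beta> = "\<lambda>e. remainder_coeff (e - 1)" and \<gamma> = "\<lambda>_. 0" and \<delta> = "\<lambda>_. 2"],
       rule cell_bits(3), rule admissible_tops[of "\<lambda>x s k l e. ?out e x k l" 4]) (rule cell_bits(4))
  have fold: "\<exists>k l. foldl (pass_step (?out (Suc (?e \<sigma>))) 4 (remainder_coeff (?e \<sigma>)) 0 2)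
        ([], symbol (remainder_offset (?e \<sigma>) (top_symbol (\<sigma> 6) - 1)), symbol (int (?e \<sigma>) - 1)) (\<sigma> 4)
      = (rev (combine 4 (remainder_coeff (?e \<sigma>)) (remainder_offset (?e \<sigma>) (top_symbol (\<sigma> 6) - 1)) 0 2 (int (?e \<sigma>) - 1) (\<sigma> 4)), k, l)" if "?I N \<sigma>" for N :: nat and \<sigma> :: stacks
  proof -
    obtain s where s: "s \<le> 6" "\<sigma> 6 = [Suc s]" using \<open>?I N \<sigma>\<close> by blast
    have e: "?e \<sigma> \<le> 2" by (simp add: next_digit_def)
    have "\<bar>4\<bar> + \<bar>remainder_coeff (?e \<sigma>)\<bar> \<le> 10" by (simp add: remainder_coeff_def)
    moreover have "\<bar>remainder_offset (?e \<sigma>) s\<bar> \<le> 20" using s(1) by (auto simp: remainder_offset_def)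
    moreover have "\<bar>int (?e \<sigma>) - 1\<bar> \<le> 20" using e by simp
    ultimately have "fst (foldl (pass_step (\<lambda>x k l. cell (linear 4 (remainder_coeff (?e \<sigma>)) x k) (linear 0 2 x l)) 4 (remainder_coeff (?e \<sigma>)) 0 2)
        ([], symbol (remainder_offset (?e \<sigma>) s), symbol (int (?e \<sigma>) - 1)) (\<sigma> 4))
      = rev (combine 4 (remainder_coeff (?e \<sigma>)) (remainder_offset (?e \<sigma>) s) 0 2 (int (?e \<sigma>) - 1) (\<sigma> 4)) @ []"
      by (intro pass_combine) auto
    then show ?thesis using s(2) by (simp add: prod_eq_iff)
  qed
  let ?N = "\<lambda>\<sigma>. combine 4 (remainder_coeff (?e \<sigma>)) (remainder_offset (?e \<sigma>) (top_symbol (\<sigma> 6) - 1)) 0 2 (int (?e \<sigma>) - 1) (\<sigma> 4)"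
  let ?F = "\<lambda>\<sigma>. foldl (pass_step (?out (Suc (?e \<sigma>))) 4 (remainder_coeff (?e \<sigma>)) 0 2)
        ([], symbol (remainder_offset (?e \<sigma>) (top_symbol (\<sigma> 6) - 1)), symbol (int (?e \<sigma>) - 1)) (\<sigma> 4)"
  have 2: "polytime ?I (\<lambda>\<sigma>. \<sigma>(4 := [], 5 := rev (?N \<sigma>), 7 := [fst (snd (?F \<sigma>))], 8 := [snd (snd (?F \<sigma>))]))"
  proof (rule polytime_seq[OF 1 pass])
    fix N :: nat and \<sigma> :: stacks assume I: "?I N \<sigma>"
    obtain k l where kl: "?F \<sigma> = (rev (?N \<sigma>), k, l)" using fold[OF I] by blast
    let ?t = "\<sigma>(7 := [symbol (remainder_offset (?e \<sigma>) (top_symbol (\<sigma> 6) - 1))], 8 := [symbol (int (?e \<sigma>) - 1)])"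
    have t: "?t 5 = []" "top_symbol (?t 7) = symbol (remainder_offset (?e \<sigma>) (top_symbol (\<sigma> 6) - 1))" "top_symbol (?t 8) = symbol (int (?e \<sigma>) - 1)"
      "?t 4 = \<sigma> 4" "top_symbol (?t 10) = Suc (?e \<sigma>)" using I by simp_all
    show "(case foldl (pass_step (?out (top_symbol (?t 10))) 4 (remainder_coeff (top_symbol (?t 10) - 1)) 0 2) (?t 5, top_symbol (?t 7), top_symbol (?t 8)) (?t 4) of
      (T, k, l) \<Rightarrow> ?t(4 := [], 5 := T, 7 := [k], 8 := [l]))
      = \<sigma>(4 := [], 5 := rev (?N \<sigma>), 7 := [fst (snd (?F \<sigma>))], 8 := [snd (snd (?F \<sigma>))])"
      unfolding t diff_Suc_1 kl[unfolded diff_Suc_1] prod.case fst_conv snd_conv by (auto simp: fun_eq_iff)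
  qed simp
  have 3: "polytime ?I (\<lambda>\<sigma>. \<sigma>(4 := [], 5 := 1 # rev (?N \<sigma>), 7 := [fst (snd (?F \<sigma>))], 8 := [snd (snd (?F \<sigma>))]))"
    by (rule polytime_seq[OF 2 polytime_push_const[of 1 ?T 5]]) (auto simp: fun_eq_iff)
  have 4: "polytime ?I (\<lambda>\<sigma>. \<sigma>(4 := [], 5 := 1 # rev (?N \<sigma>), 7 := [], 8 := [snd (snd (?F \<sigma>))]))"
    by (rule polytime_seq[OF 3 polytime_clear[of ?T 7]]) (auto simp: fun_eq_iff)
  have 5: "polytime ?I (\<lambda>\<sigma>. \<sigma>(4 := [], 5 := 1 # rev (?N \<sigma>)))"
    by (rule polytime_seq[OF 4 polytime_clear[of ?T 8]]) (auto simp: fun_eq_iff)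
  show ?thesis
    by (rule polytime_seq[OF 5 polytime_move[of 5 4 ?T]]) (auto simp: fun_eq_iff next_cells_def)
qed

text \<open>
  The two next digits of the radicand come as one unary number, which is turned into a symbol
  by counting, since actions see only the tops of stacks.
\<close>

lemma polytime_root_step:
  assumes S: "computes 1 (\<lambda>xs. S (xs ! 0))" "\<And>i. S i \<le> 6"
  shows "polytime (\<lambda>N \<sigma>. empty_from 12 N \<sigma> \<and> (\<forall>r. 5 \<le> r \<and> r \<le> 9 \<longrightarrow> \<sigma> r = []))
    (\<lambda>\<sigma>. \<sigma>(10 := [Suc (next_digit (\<sigma> 4) (S (length (\<sigma> 3))))], 4 := next_cells (\<sigma> 4) (S (length (\<sigma> 3))),
      3 := 1 # \<sigma> 3, 11 := tl (\<sigma> 11)))"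
  (is "polytime ?I _")
proof -
  let ?T = "\<lambda>_ _. True"
  let ?S = "\<lambda>\<sigma> :: stacks. S (length (\<sigma> 3))"
  have S9: "polytime (empty_from 12) (\<lambda>\<sigma>. \<sigma>(9 := unary (?S \<sigma>)))"
    using computesD[OF S(1), of "[3]" 12 9] by simp
  have 1: "polytime ?I (\<lambda>\<sigma>. \<sigma>(9 := unary (?S \<sigma>)))" by (rule polytime_weaken[OF S9]) auto
  have 2: "polytime ?I (\<lambda>\<sigma>. \<sigma>(9 := unary (?S \<sigma>), 6 := [1]))"
    by (rule polytime_seq[OF 1 polytime_push_const[of 1 ?T 6]]) auto
  have inc: "polytime (\<lambda>N \<sigma>. \<sigma> 6 \<noteq> []) (\<lambda>\<sigma>. \<sigma>(6 := min (Suc (top_symbol (\<sigma> 6))) 8 # tl (\<sigma> 6)))"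
    by (rule polytime_set_top[where h = "\<lambda>a. min (Suc (a 6)) 8"], rule admissible_tops[of "\<lambda>x s k l e. min (Suc s) 8" 8]) auto
  have body: "polytime (\<lambda>N \<sigma>. \<sigma> 6 \<noteq> []) (\<lambda>\<sigma>. \<sigma>(6 := min (Suc (top_symbol (\<sigma> 6))) 8 # tl (\<sigma> 6), 9 := tl (\<sigma> 9)))"
    by (rule polytime_seq[OF inc polytime_pop[of ?T 9]]) auto
  let ?s = "\<lambda>\<sigma> i. \<sigma>(6 := [Suc i], 9 := drop i (\<sigma> 9))"
  have count: "polytime (\<lambda>N \<sigma>. \<sigma> 6 = [1] \<and> length (\<sigma> 9) \<le> 6) (\<lambda>\<sigma>. ?s \<sigma> (length (\<sigma> 9)))"
  proof (rule polytime_foreach[where s = ?s and q = "\<lambda>m. m + 1" and B = 0, OF body])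
    show "poly_bounded (\<lambda>m. m + 1)" by (intro poly_bounded_add poly_bounded_id poly_bounded_const)
  qed (auto simp: drop_facts fun_eq_iff)
  have 3: "polytime ?I (\<lambda>\<sigma>. \<sigma>(6 := [Suc (?S \<sigma>)]))"
    by (rule polytime_seq[OF 2 count]) (use S(2) in \<open>auto simp: fun_eq_iff\<close>)
  have 4: "polytime ?I (\<lambda>\<sigma>. \<sigma>(6 := [Suc (?S \<sigma>)], 10 := [Suc (next_digit (\<sigma> 4) (?S \<sigma>))]))"
    by (rule polytime_seq[OF 3 polytime_digit_pass]) (use S(2) in auto)
  have 5: "polytime ?I (\<lambda>\<sigma>. \<sigma>(6 := [Suc (?S \<sigma>)], 10 := [Suc (next_digit (\<sigma> 4) (?S \<sigma>))], 4 := next_cells (\<sigma> 4) (?S \<sigma>)))"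
    by (rule polytime_seq[OF 4 polytime_update_pass]) (use S(2) in auto)
  have 6: "polytime ?I (\<lambda>\<sigma>. \<sigma>(10 := [Suc (next_digit (\<sigma> 4) (?S \<sigma>))], 4 := next_cells (\<sigma> 4) (?S \<sigma>)))"
    by (rule polytime_seq[OF 5 polytime_clear[of ?T 6]]) (auto simp: fun_eq_iff)
  have 7: "polytime ?I (\<lambda>\<sigma>. \<sigma>(10 := [Suc (next_digit (\<sigma> 4) (?S \<sigma>))], 4 := next_cells (\<sigma> 4) (?S \<sigma>), 3 := 1 # \<sigma> 3))"
    by (rule polytime_seq[OF 6 polytime_push_const[of 1 ?T 3]]) auto
  show ?thesis by (rule polytime_seq[OF 7 polytime_pop[of ?T 11]]) auto
qed

global_interpretation stack_fn: clone computes
proof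
  show "computes k (\<lambda>_. 0)" for k by (intro computes_grz2 grzegorczyk.zero)
  show "computes 1 (\<lambda>xs. Suc (xs ! 0))" by (intro computes_grz2 grzegorczyk.succ)
  show "computes k (\<lambda>xs. xs ! i)" if "i < k" for i k using that by (intro computes_grz2 grzegorczyk.proj)
qed (rule computes_comp)

text \<open>
  The digits of the radicand are obtained by calling the given machine, and n + 1 root steps
  on numbers of linear length produce the digit at position n.
\<close>

theorem poly_time_root_digit:
  assumes f: "f \<in> poly_time_in_argument" "range f \<subseteq> {0, 1, 2}" and near: "near_square M Y"
  shows "root_digit (\<lambda>i. f (i + c)) M Y \<in> poly_time_in_argument"
proof -
  let ?d = "\<lambda>i. f (i + c)"
  let ?T = "\<lambda>_ _. True"
  define S where "S i = 2 * ?d (2 * i) + ?d (2 * i + 1)" for i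
  have d: "range ?d \<subseteq> {0, 1, 2}" by (rule range_shift[OF f(2)])
  have d2: "?d i \<le> 2" for i
  proof -
    have "?d i \<in> {0, 1, 2}" using d by (rule subsetD) (rule rangeI)
    then show ?thesis by auto
  qed
  have S6: "S i \<le> 6" for i using d2[of "2 * i"] d2[of "2 * i + 1"] by (simp add: S_def)
  have cS: "computes 1 (\<lambda>xs. S (xs ! 0))"
  proof -
    have cf: "stack_fn.fn 1 (\<lambda>xs. f (xs ! 0))" by (intro stack_fn.fnI computes_of_poly_time f)
    have g: "stack_fn.fn k F" if "grz 2 k F" for k F using that by (intro stack_fn.fnI computes_grz)
    have even: "stack_fn.fn 1 (\<lambda>xs. f (2 * xs ! 0 + c))"
      by (rule stack_fn.fn_app1[OF cf], rule g) (intro grz_add grz_mult grz.fn_const grz.fn_proj; simp)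
    have odd: "stack_fn.fn 1 (\<lambda>xs. f (2 * xs ! 0 + 1 + c))"
      by (rule stack_fn.fn_app1[OF cf], rule g) (intro grz_add grz_mult grz.fn_const grz.fn_proj; simp)
    have sum: "stack_fn.fn 2 (\<lambda>ys. 2 * ys ! 0 + ys ! 1)"
      by (rule g) (intro grz_add grz_mult grz.fn_const grz.fn_proj; simp)
    have "stack_fn.fn 1 (\<lambda>xs. 2 * f (2 * xs ! 0 + c) + f (2 * xs ! 0 + 1 + c))"
      by (rule stack_fn.fn_app2[where p = "\<lambda>a b. 2 * a + b", OF sum even odd])
    then obtain F where F: "computes 1 F"
      "\<forall>xs. length xs = 1 \<longrightarrow> F xs = 2 * f (2 * xs ! 0 + c) + f (2 * xs ! 0 + 1 + c)"
      unfolding stack_fn.fn_def by blast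
    show ?thesis by (rule computes_cong[OF F(1)]) (use F(2) in \<open>simp add: S_def\<close>)
  qed
  define n0 where "n0 = 8 * (M + Y + 1)"
  obtain xs0 where xs0: "encodes xs0 M Y" "0 \<notin> set xs0"
  proof -
    have n0: "int n0 < 2 ^ n0" by (rule of_nat_less_two_power)
    have "\<exists>xs. length xs = n0 \<and> rem_value xs = int M + int Y - int Y * int Y \<and> root_value xs = int Y \<and> 0 \<notin> set xs"
    proof (rule ex_cells)
      have "int Y * int Y \<le> int M + int Y"
        using near unfolding near_square_def of_nat_mult[symmetric] of_nat_add[symmetric] of_nat_le_iff by simp
      then show "0 \<le> int M + int Y - int Y * int Y" by simp
      have sq: "0 \<le> int Y * int Y" by simp
      have "int M + int Y \<le> int n0" by (simp add: n0_def)
      then have "int M + int Y - int Y * int Y \<le> int n0" using sq by linarith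
      then show "int M + int Y - int Y * int Y < 2 ^ n0" using n0 by (rule le_less_trans)
      have "int Y \<le> int n0" by (simp add: n0_def)
      then show "int Y < 2 ^ n0" using n0 by (rule le_less_trans)
    qed simp
    then obtain xs where xs: "length xs = n0" "rem_value xs = int M + int Y - int Y * int Y" "root_value xs = int Y" "0 \<notin> set xs"
      by blast
    have "8 * (int Y + 1) \<le> int n0" by (simp add: n0_def)
    then have "8 * (int Y + 1) \<le> 2 ^ n0" using n0 by linarith
    then have "encodes xs M Y" unfolding encodes_def xs(1-3) by simp
    then show ?thesis using xs(4) by (rule that)
  qed
  define cells where "cells = rec_nat xs0 (\<lambda>i xs. next_cells xs (S i))"
  have cells: "cells 0 = xs0" "cells (Suc i) = next_cells (cells i) (S i)" for i by (simp_all add: cells_def)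
  have enc: "encodes (cells i) (scaled ?d M i) (root ?d M Y i)" for i
  proof (induction i)
    case (Suc i)
    show ?case
      using encodes_step(2)[OF root_near[OF near d] Suc S6] by (simp add: cells S_def)
  qed (simp add: cells xs0)
  have digit: "next_digit (cells i) (S i) = root_digit ?d M Y i" for i
    using encodes_step(1)[OF root_near[OF near d] enc S6, of i i] by (simp add: root_digit_def S_def)
  have len: "length (cells i) = length xs0 + i" for i
    by (induction i) (simp_all add: cells next_cells_def)

  let ?init = "\<lambda>N. (unary_stacks N)(11 := 1 # unary N, 4 := xs0)"
  have i1: "polytime (\<lambda>N \<sigma>. \<sigma> = unary_stacks N) (\<lambda>\<sigma>. \<sigma>(11 := unary (length (\<sigma> 1))))"
    by (rule polytime_weaken[OF polytime_copy[of 1 12 11]]) (auto simp: empty_from_def unary_stacks_def)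
  have i2: "polytime (\<lambda>N \<sigma>. \<sigma> = unary_stacks N) (\<lambda>\<sigma>. \<sigma>(11 := 1 # unary (length (\<sigma> 1))))"
    by (rule polytime_seq[OF i1 polytime_push_const[of 1 ?T 11]]) auto
  have i3: "polytime (\<lambda>N \<sigma>. \<sigma> = unary_stacks N) (\<lambda>\<sigma>. \<sigma>(11 := 1 # unary (length (\<sigma> 1)), 4 := xs0))"
    by (rule polytime_seq[OF i2 polytime_push_list[OF xs0(2), of ?T 4]]) (auto simp: unary_stacks_def)
  let ?s = "\<lambda>\<sigma> i. \<sigma>(3 := unary i, 4 := cells i, 10 := (if i = 0 then [] else [Suc (root_digit ?d M Y (i - 1))]), 11 := drop i (\<sigma> 11))"
  have loop: "polytime (\<lambda>N \<sigma>. \<sigma> = ?init N) (\<lambda>\<sigma>. ?s \<sigma> (length (\<sigma> 11)))"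
  proof (rule polytime_foreach[where s = ?s and q = "\<lambda>m. m + (length xs0 + 1)" and B = 12, OF polytime_root_step[OF cS S6]])
    show "poly_bounded (\<lambda>m. m + (length xs0 + 1))" by (intro poly_bounded_add poly_bounded_id poly_bounded_const)
    fix N :: nat and \<sigma> :: stacks and i r' :: nat
    assume \<sigma>: "\<sigma> = ?init N"
    show "?s \<sigma> 0 = \<sigma>" by (auto simp: \<sigma> unary_stacks_def fun_eq_iff cells)
    assume i: "i < length (\<sigma> 11)"
    show "empty_from 12 N (?s \<sigma> i) \<and> (\<forall>r. 5 \<le> r \<and> r \<le> 9 \<longrightarrow> ?s \<sigma> i r = [])"
      by (auto simp: \<sigma> unary_stacks_def empty_from_def)
    show "(\<lambda>\<sigma>. \<sigma>(10 := [Suc (next_digit (\<sigma> 4) (S (length (\<sigma> 3))))], 4 := next_cells (\<sigma> 4) (S (length (\<sigma> 3))),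
      3 := 1 # \<sigma> 3, 11 := tl (\<sigma> 11))) (?s \<sigma> i) = ?s \<sigma> (Suc i)"
      using drop_facts[OF i] by (auto simp: fun_eq_iff digit cells)
    have "i < N + size_upto 12 \<sigma>" using i length_le_size_upto[of 11 12 \<sigma>] by simp
    then show "length (?s \<sigma> i r') \<le> length (\<sigma> r') + (N + size_upto 12 \<sigma> + (length xs0 + 1))"
      by (auto simp: len)
  qed simp
  have l: "polytime (\<lambda>N \<sigma>. \<sigma> = unary_stacks N)
      (\<lambda>\<sigma>. (\<lambda>\<tau>. ?s \<tau> (length (\<tau> 11))) (\<sigma>(11 := 1 # unary (length (\<sigma> 1)), 4 := xs0)))"
    by (rule polytime_seq[OF i3 loop]) (auto simp: unary_stacks_def)
  have res: "(\<lambda>\<tau>. ?s \<tau> (length (\<tau> 11))) ((unary_stacks n)(11 := 1 # unary (length (unary_stacks n 1)), 4 := xs0))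
     = (unary_stacks n)(3 := unary (Suc n), 4 := cells (Suc n), 10 := [Suc (root_digit ?d M Y n)])" for n
    by (auto simp: unary_stacks_def fun_eq_iff)
  have l': "polytime (\<lambda>N \<sigma>. \<sigma> = unary_stacks N) (\<lambda>\<sigma>. \<sigma>(3 := unary (Suc (length (\<sigma> 1))), 4 := cells (Suc (length (\<sigma> 1))),
      10 := [Suc (root_digit ?d M Y (length (\<sigma> 1)))]))"
  proof (rule polytime_cong[OF l])
    fix N :: nat and \<sigma> :: stacks assume \<sigma>: "\<sigma> = unary_stacks N"
    have "length (unary_stacks N 1) = N" by (simp add: unary_stacks_def)
    then show "(\<lambda>\<tau>. ?s \<tau> (length (\<tau> 11))) (\<sigma>(11 := 1 # unary (length (\<sigma> 1)), 4 := xs0))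
      = \<sigma>(3 := unary (Suc (length (\<sigma> 1))), 4 := cells (Suc (length (\<sigma> 1))), 10 := [Suc (root_digit ?d M Y (length (\<sigma> 1)))])"
      unfolding \<sigma> using res[of N] by (simp only:)
  qed
  have e2: "root_digit ?d M Y n \<le> 2" for n
  proof -
    have "root_digit ?d M Y n \<in> {0, 1, 2}" using root_digit_range[OF near d] by (rule subsetD) (rule rangeI)
    then show ?thesis by auto
  qed
  have "polytime (\<lambda>N \<sigma>. \<sigma> = unary_stacks N) (\<lambda>\<sigma>. \<sigma>(3 := unary (Suc (length (\<sigma> 1))), 4 := cells (Suc (length (\<sigma> 1))),
      10 := [Suc (root_digit ?d M Y (length (\<sigma> 1)))], 2 := unary (root_digit ?d M Y (length (\<sigma> 1)))))"
    by (rule polytime_seq[OF l' polytime_symbol_to_unary[of 10 2]]) (use e2 in \<open>auto simp: unary_stacks_def\<close>)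
  then show ?thesis
    by (rule poly_time_of_unary) (use e2 in \<open>auto simp: unary_stacks_def\<close>)
qed

text \<open>
  Both ingredients of the diagonalization hold for the polynomial-time digit sequences: they
  include the second Grzegorczyk class, and they are closed under the extraction of roots.
\<close>

theorem no_computable_copy_P_numbers: "\<not> computable_copy P_numbers \<nu>"
  unfolding P_numbers_def
proof (rule no_computable_copy)
  show "digit_reals (grzegorczyk_unary 2) \<subseteq> digit_reals poly_time_in_argument"
    unfolding digit_reals_def using grz2_poly_time by blast
  have one: "(\<lambda>_. 1) \<in> poly_time_in_argument"
    by (rule grz2_poly_time) (unfold grzegorczyk_unary_iff, rule grz.fn_const, auto)
  show "\<exists>z\<in>digit_reals poly_time_in_argument. \<exists>w\<in>digit_reals poly_time_in_argument. z \<noteq> 0 \<and> x * (z * z) = w * w"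
    if "x \<in> digit_reals poly_time_in_argument" "0 < x" for x
    by (rule positive_times_square[OF poly_time_root_digit one that])
qed

theorem corollary2:
  shows "(\<nexists>\<nu>. computable_copy P_numbers \<nu>) \<and>
    (\<forall>n \<ge> 3. \<nexists>\<nu>. computable_copy (E_numbers n) \<nu>)"
  using no_computable_copy_P_numbers no_computable_copy_E_numbers by blast

end
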